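(* Let $\varphi:\mathbb{D}\to\mathbb{D}$ be a hyperbolic non-automorphism of second kind. Then for every $1<p<\infty$, $C_\varphi$ has Dunford's property $(C)$ on $H^p(\mathbb{D})$, and $C_\varphi^*$ acting on $H^p(\mathbb{D})^*$ does not have the single-valued extension property.
   Context: A hyperbolic non-automorphism of second kind is a linear fractional self-map of $\mathbb{D}$, not an automorphism, with two fixed points, one in $\mathbb{D}$ and the other on $\mathbb{T}$; every such map is conjugate to $\varphi_r(z)=\frac{rz}{1-(1-r)z}$ for some $0<r<1$. $C_\varphi f=f\circ\varphi$; $C_\varphi^*$ is the Banach adjoint. SVEP: for every open $U$ and analytic $f:U\to X$ with $(T-zI)f(z)=0$ on $U$, $f\equiv0$. Local spectrum $\sigma_T(x)$: complement of the union of open $U$ on which there is analytic $f$ with $(T-zI)f(z)=x$; $X_T(F)=\{x:\sigma_T(x)\subseteq F\}$; property $(C)$: $X_T(F)$ closed for all closed $F\subseteq\mathbb{C}$. *)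

theory Defs
  imports "HOL-Analysis.Analysis"
begin

text \<open>A linear fractional self-map of the unit disc, not an automorphism, whose
  fixed points (of the linear fractional extension) are exactly two points,
  one in the open disc and one on the unit circle.  If c = 0 the point at
  infinity is also fixed, which together with two finite fixed points would force
  the identity map, whose fixed set is all of the plane; hence requiring the finite
  fixed-point set to be exactly a two-element set already excludes this.\<close>

definition hyperbolic_nonaut_2nd :: "(complex \<Rightarrow> complex) \<Rightarrow> bool" where
  "hyperbolic_nonaut_2nd \<phi> \<longleftrightarrow>
     (\<exists>a b c d :: complex. a * d - b * c \<noteq> 0 \<and>
        (\<forall>z\<in>ball 0 1. c * z + d \<noteq> 0 \<and> \<phi> z = (a * z + b) / (c * z + d)) \<and>
        \<phi> ` ball 0 1 \<subseteq> ball 0 1 \<and>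
        \<phi> ` ball 0 1 \<noteq> ball 0 1 \<and>
        (\<exists>z0\<in>ball 0 1. \<exists>w0\<in>sphere 0 1.
            {z. c * z + d \<noteq> 0 \<and> (a * z + b) / (c * z + d) = z} = {z0, w0}))"

text \<open>Elements of H^p are represented by functions holomorphic on the disc and
  (canonically) zero outside of it.\<close>

definition hardy_mean :: "real \<Rightarrow> (complex \<Rightarrow> complex) \<Rightarrow> real \<Rightarrow> real" where
  "hardy_mean p f r =
     integral {0..2*pi} (\<lambda>t. cmod (f (complex_of_real r * cis t)) powr p) / (2 * pi)"

definition hardy :: "real \<Rightarrow> (complex \<Rightarrow> complex) set" where
  "hardy p = {f. f holomorphic_on ball 0 1 \<and> (\<forall>z. z \<notin> ball 0 1 \<longrightarrow> f z = 0) \<and>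
                 bdd_above (hardy_mean p f ` {0<..<1})}"

definition hardy_norm :: "real \<Rightarrow> (complex \<Rightarrow> complex) \<Rightarrow> real" where
  "hardy_norm p f = (SUP r\<in>{0<..<1}. hardy_mean p f r) powr (1 / p)"

definition hardy_dual :: "real \<Rightarrow> ((complex \<Rightarrow> complex) \<Rightarrow> complex) set" where
  "hardy_dual p = {L.
      (\<forall>f\<in>hardy p. \<forall>g\<in>hardy p. L (\<lambda>z. f z + g z) = L f + L g) \<and>
      (\<forall>f\<in>hardy p. \<forall>c. L (\<lambda>z. c * f z) = c * L f) \<and>
      (\<exists>K. \<forall>f\<in>hardy p. cmod (L f) \<le> K * hardy_norm p f) \<and>
      (\<forall>f. f \<notin> hardy p \<longrightarrow> L f = 0)}"

definition dual_norm :: "real \<Rightarrow> ((complex \<Rightarrow> complex) \<Rightarrow> complex) \<Rightarrow> real" where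
  "dual_norm p L = (SUP f\<in>{f\<in>hardy p. hardy_norm p f \<le> 1}. cmod (L f))"

definition comp_op :: "(complex \<Rightarrow> complex) \<Rightarrow> (complex \<Rightarrow> complex) \<Rightarrow> (complex \<Rightarrow> complex)" where
  "comp_op \<phi> f = (\<lambda>z. if z \<in> ball 0 1 then f (\<phi> z) else 0)"

definition hardy_adjoint ::
  "real \<Rightarrow> ((complex \<Rightarrow> complex) \<Rightarrow> (complex \<Rightarrow> complex)) \<Rightarrow>
   ((complex \<Rightarrow> complex) \<Rightarrow> complex) \<Rightarrow> ((complex \<Rightarrow> complex) \<Rightarrow> complex)" where
  "hardy_adjoint p T L = (\<lambda>f. if f \<in> hardy p then L (T f) else 0)"

text \<open>A normed space is given by a carrier X of functions 'a \<Rightarrow> complex (vector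
  operations pointwise) and a norm N.  Vector-valued holomorphy = strong
  (norm) complex differentiability at every point of the open set U.\<close>

definition vholo_on ::
  "('a \<Rightarrow> complex) set \<Rightarrow> (('a \<Rightarrow> complex) \<Rightarrow> real) \<Rightarrow> complex set \<Rightarrow>
   (complex \<Rightarrow> 'a \<Rightarrow> complex) \<Rightarrow> bool" where
  "vholo_on X N U F \<longleftrightarrow> open U \<and> (\<forall>z\<in>U. F z \<in> X) \<and>
     (\<forall>z\<in>U. \<exists>G\<in>X. ((\<lambda>w. N (\<lambda>a. (F w a - F z a) / (w - z) - G a)) \<longlongrightarrow> 0) (at z))"

definition SVEP ::
  "('a \<Rightarrow> complex) set \<Rightarrow> (('a \<Rightarrow> complex) \<Rightarrow> real) \<Rightarrow>
   (('a \<Rightarrow> complex) \<Rightarrow> ('a \<Rightarrow> complex)) \<Rightarrow> bool" where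
  "SVEP X N T \<longleftrightarrow> (\<forall>U F. open U \<and> vholo_on X N U F \<and>
       (\<forall>z\<in>U. (\<lambda>a. T (F z) a - z * F z a) = (\<lambda>a. 0)) \<longrightarrow> (\<forall>z\<in>U. F z = (\<lambda>a. 0)))"

definition local_spectrum ::
  "('a \<Rightarrow> complex) set \<Rightarrow> (('a \<Rightarrow> complex) \<Rightarrow> real) \<Rightarrow>
   (('a \<Rightarrow> complex) \<Rightarrow> ('a \<Rightarrow> complex)) \<Rightarrow> ('a \<Rightarrow> complex) \<Rightarrow> complex set" where
  "local_spectrum X N T x = - {w. \<exists>U F. open U \<and> w \<in> U \<and> vholo_on X N U F \<and>
       (\<forall>z\<in>U. (\<lambda>a. T (F z) a - z * F z a) = x)}"

definition local_spectral_subspace ::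
  "('a \<Rightarrow> complex) set \<Rightarrow> (('a \<Rightarrow> complex) \<Rightarrow> real) \<Rightarrow>
   (('a \<Rightarrow> complex) \<Rightarrow> ('a \<Rightarrow> complex)) \<Rightarrow> complex set \<Rightarrow> ('a \<Rightarrow> complex) set" where
  "local_spectral_subspace X N T S = {x\<in>X. local_spectrum X N T x \<subseteq> S}"

definition norm_closed_in ::
  "('a \<Rightarrow> complex) set \<Rightarrow> (('a \<Rightarrow> complex) \<Rightarrow> real) \<Rightarrow> ('a \<Rightarrow> complex) set \<Rightarrow> bool" where
  "norm_closed_in X N S \<longleftrightarrow> (\<forall>xs x. (\<forall>n. xs n \<in> S) \<and> x \<in> X \<and>
       (\<lambda>n. N (\<lambda>a. xs n a - x a)) \<longlonglongrightarrow> 0 \<longrightarrow> x \<in> S)"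

definition property_C ::
  "('a \<Rightarrow> complex) set \<Rightarrow> (('a \<Rightarrow> complex) \<Rightarrow> real) \<Rightarrow>
   (('a \<Rightarrow> complex) \<Rightarrow> ('a \<Rightarrow> complex)) \<Rightarrow> bool" where
  "property_C X N T \<longleftrightarrow>
     (\<forall>S. closed S \<longrightarrow> norm_closed_in X N (local_spectral_subspace X N T S))"

end

theory Submission
  imports Defs "HOL-Complex_Analysis.Complex_Analysis"
begin

text \<open>In the coordinate \<open>u = (z - \<alpha>) / (\<omega> - z)\<close>, where \<open>\<alpha>\<close> is the interior and \<open>\<omega>\<close> the boundary
  fixed point, the disc becomes a half-plane and \<open>\<phi>\<close> the dilation \<open>u \<mapsto> r u\<close> with \<open>0 < r < 1\<close>.
  Put \<open>\<rho>\<^sub>0 = r powr (1 / p)\<close>.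

  On the functions vanishing at \<open>\<alpha>\<close> the \<open>n\<close>-th iterate of the composition operator has norm
  \<open>O (n \<rho>\<^sub>0 ^ n)\<close>: divide by \<open>z - \<alpha>\<close>, majorise \<open>|h| powr p\<close> by a positive harmonic function, and dominate the
  factor \<open>|\<phi>\<^sub>n - \<alpha>| powr p\<close> by \<open>r ^ n\<close> times a sum of \<open>n + 1\<close> Poisson kernels at the scales \<open>r ^ j\<close>.
  Hence the resolvent series converges for \<open>|l| > \<rho>\<^sub>0\<close>. Conversely, if the local resolvent equation
  is solvable near some point of the disc \<open>|l| \<le> \<rho>\<^sub>0\<close>, then telescoping along the two-sided orbit
  \<open>r ^ n u\<close> gives a Laurent series vanishing on an open set, and the right-hand side is constant.
  So the local spectrum of a nonconstant function is the closed disc of radius \<open>\<rho>\<^sub>0\<close>, together with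
  \<open>1\<close> if the function does not vanish at \<open>\<alpha>\<close>, and property (C) can be read off.

  For \<open>r < |l| < \<rho>\<^sub>0\<close> the same Laurent series, summed over \<open>f (z\<^sub>n) - f \<alpha>\<close> along an orbit \<open>z\<^sub>n\<close>, is a
  bounded functional depending analytically on \<open>l\<close> and an eigenvector of the adjoint for \<open>l\<close>; the
  annulus is nonempty because \<open>p > 1\<close>.\<close>

section \<open>Poisson kernels and harmonic majorants\<close>

text \<open>Hardy norms are given by means over circles inside the disc and no boundary values are
  used, so estimates are made at a fixed radius below 1. The harmonic majorant is taken as the real
  part of a holomorphic function, so that Poisson's formula also applies to its compositions. The
  number \<open>\<rho>\<^sub>0\<close> arises twice, independently: as the decay rate of the
  iterates, and as the growth rate of point evaluations along backward orbits, where 1 - |z| shrinks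
  like \<open>r ^ n\<close> and evaluation costs a power -1/p of it. The agreement leaves no gap
  between the two halves of the argument. The obstacle inside the disc is convergence: along a
  forward orbit a function merely tends to its value at \<alpha>, so the series in 1 / l need not
  converge for small l. Subtracting \<open>r ^ j\<close> from the composition operator, for each j <
  k, removes the first k Taylor coefficients at the fixed point in the coordinate u and leaves decay
  \<open>(r ^ k) ^ n\<close>. These operators commute with composition and can be undone at the end:
  their kernels, apart from the constants, contain only functions too large on backward
  orbits.\<close>

definition poisson_kernel :: "real \<Rightarrow> complex \<Rightarrow> real \<Rightarrow> real" where
  "poisson_kernel R w t = (R\<^sup>2 - (cmod w)\<^sup>2) / (cmod (of_real R * cis t - w))\<^sup>2"

lemma circle_minus_nonzero:
  assumes "cmod w < R" shows "of_real R * cis t - w \<noteq> 0"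
proof
  assume "of_real R * cis t - w = 0"
  then have "cmod w = cmod (of_real R * cis t)" by simp
  also have "\<dots> = \<bar>R\<bar>" by (simp add: norm_mult)
  finally show False using assms by simp
qed

lemma poisson_kernel_pos:
  assumes "cmod w < R" shows "poisson_kernel R w t > 0"
proof -
  have "(cmod w)\<^sup>2 < R\<^sup>2" using assms by (simp add: power_strict_mono)
  then show ?thesis
    unfolding poisson_kernel_def using circle_minus_nonzero[OF assms, of t] by simp
qed

lemma continuous_on_poisson_kernel:
  assumes "cmod w < R" shows "continuous_on A (poisson_kernel R w)"
  unfolding poisson_kernel_def
  using circle_minus_nonzero[OF assms] by (intro continuous_intros) auto

text \<open>Cauchy's formula for the auxiliary function \<open>F\<close>, which is holomorphic on
  the closed disc and agrees with \<open>f\<close> at \<open>w\<close>. On the circle z * cnj z =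
  R^2, so the extra factor turns the Cauchy kernel into the Poisson kernel.\<close>

lemma poisson_formula:
  fixes f :: "complex \<Rightarrow> complex"
  assumes f: "f holomorphic_on ball 0 S" and "R < S" and w: "cmod w < R"
  shows "((\<lambda>t. of_real (poisson_kernel R w t) * f (of_real R * cis t)) has_integral 2 * pi * f w) {0..2*pi}"
proof -
  have R: "0 < R" using w norm_ge_zero[of w] by linarith
  define F where "F = (\<lambda>z. f z * (of_real (R\<^sup>2 - (cmod w)\<^sup>2)) / (of_real (R\<^sup>2) - cnj w * z))"
  have nz: "of_real (R\<^sup>2) - cnj w * z \<noteq> 0" if "z \<in> cball 0 R" for z
  proof
    assume "of_real (R\<^sup>2) - cnj w * z = 0"
    then have "cmod (of_real (R\<^sup>2)) = cmod w * cmod z"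
      by (metis complex_mod_cnj norm_mult right_minus_eq)
    moreover have "cmod w * cmod z \<le> cmod w * R" using that by (intro mult_left_mono) auto
    moreover have "cmod w * R < R * R" using w R by simp
    ultimately show False by (simp add: power2_eq_square norm_mult)
  qed
  have sub: "cball 0 R \<subseteq> ball 0 S" using \<open>R < S\<close> by auto
  have fR: "f holomorphic_on cball 0 R" by (rule holomorphic_on_subset[OF f sub])
  have F: "F holomorphic_on cball 0 R"
    unfolding F_def using nz by (intro holomorphic_intros fR) auto
  have "((\<lambda>u. F u/(u-w)) has_contour_integral (2 * of_real pi * \<i> * F w)) (circlepath 0 R)"
    using F w by (intro Cauchy_integral_circlepath_simple) auto
  then have 1: "((\<lambda>t. F (of_real R * cis t) / (of_real R * cis t - w) * R * \<i> * cis t) has_integral 2 * of_real pi * \<i> * F w) {0..2*pi}"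
    unfolding circlepath_def by (subst (asm) has_contour_integral_part_circlepath_iff) auto
  have 2: "F w = f w"
  proof -
    have "of_real (R\<^sup>2) - cnj w * w \<noteq> 0" using nz[of w] w by simp
    moreover have "cnj w * w = of_real ((cmod w)\<^sup>2)"
      by (simp only: complex_norm_square mult.commute)
    ultimately show ?thesis unfolding F_def by (simp add: field_simps)
  qed
  have 3: "F (of_real R * cis t) / (of_real R * cis t - w) * R * \<i> * cis t
      = \<i> * (of_real (poisson_kernel R w t) * f (of_real R * cis t))" for t
  proof -
    define z where "z = of_real R * cis t"
    have z: "z * cnj z = of_real (R\<^sup>2)" unfolding z_def
      by (simp add: cis_cnj power2_eq_square mult.assoc[symmetric] cis_mult)
    have zw: "z - w \<noteq> 0" unfolding z_def by (rule circle_minus_nonzero[OF w])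
    then have zw': "cnj z - cnj w \<noteq> 0" by (metis complex_cnj_cancel_iff right_minus_eq)
    have z0: "z \<noteq> 0" using z R by auto
    have a: "of_real (R\<^sup>2) - cnj w * z = z * (cnj z - cnj w)" using z by (simp add: algebra_simps)
    have b: "of_real ((cmod (z - w))\<^sup>2) = (z - w) * (cnj z - cnj w)"
      by (simp only: complex_norm_square complex_cnj_diff)
    have "F z / (z - w) * (\<i> * z) = \<i> * (of_real (R\<^sup>2 - (cmod w)\<^sup>2) / of_real ((cmod (z - w))\<^sup>2) * f z)"
      unfolding F_def a b using zw zw' z0 by (simp add: divide_simps)
    then show ?thesis unfolding poisson_kernel_def z_def[symmetric] of_real_divide
      by (simp add: z_def mult_ac)
  qed
  have "((\<lambda>t. - \<i> * (\<i> * (of_real (poisson_kernel R w t) * f (of_real R * cis t)))) has_integral - \<i> * (2 * of_real pi * \<i> * f w)) {0..2*pi}"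
    using 1 unfolding 2 3 by (rule has_integral_mult_right)
  then show ?thesis by (simp add: mult_ac)
qed

lemma poisson_kernel_integral:
  assumes "cmod w < R" shows "(poisson_kernel R w has_integral 2 * pi) {0..2*pi}"
proof -
  have "((\<lambda>t. complex_of_real (poisson_kernel R w t) * 1) has_integral of_real (2 * pi) * 1) {0..2*pi}"
    by (rule poisson_formula[of "\<lambda>_. 1" "R + 1"]) (use assms in auto)
  from has_integral_linear[OF this bounded_linear_Re] show ?thesis
    by (simp add: o_def)
qed

lemma hardy_continuous:
  assumes "f holomorphic_on ball 0 1" "0 \<le> R" "R < 1"
  shows "continuous_on A (\<lambda>t. f (of_real R * cis t))"
proof (rule continuous_on_compose2[of "ball 0 1" f])
  show "continuous_on (ball 0 1) f" using assms holomorphic_on_imp_continuous_on by blast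
  show "continuous_on A (\<lambda>t. of_real R * cis t)" by (intro continuous_intros)
  show "(\<lambda>t. complex_of_real R * cis t) ` A \<subseteq> ball 0 1" using assms by (auto simp: norm_mult)
qed

lemma hardy_powr_continuous:
  assumes "f holomorphic_on ball 0 1" "0 \<le> R" "R < 1" "0 < p"
  shows "continuous_on A (\<lambda>t. cmod (f (of_real R * cis t)) powr p)"
  using assms by (intro continuous_on_powr' continuous_intros hardy_continuous) auto

text \<open>Young's inequality with the conjugate exponents p and p / (p - 1). Rearranged, it says
  that x powr p lies above its tangent at \<open>u\<close>; both the subharmonicity estimate and
  Minkowski's inequality rest on this form of convexity.\<close>

lemma young_tangent:
  fixes a u p :: real
  assumes "0 \<le> a" "0 \<le> u" "1 < p"
  shows "a * u powr (p - 1) \<le> a powr p / p + (1 - 1 / p) * u powr p"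
proof -
  define q where "q = p / (p - 1)"
  have q: "1 < q" "1 / p + 1 / q = 1" "(p - 1) * q = p" using assms unfolding q_def by (auto simp: field_simps)
  have "a * u powr (p - 1) \<le> a powr p / p + (u powr (p - 1)) powr q / q"
    using assms q by (intro Youngs_inequality) auto
  also have "(u powr (p - 1)) powr q / q = (1 / q) * u powr p" using q by (simp add: powr_powr)
  also have "1 / q = 1 - 1 / p" using q by simp
  finally show ?thesis .
qed

lemma powr_minus_one_mult: "x * x powr (p - 1) = x powr p" if "0 \<le> x" for x p :: real
proof (cases "x = 0")
  case False
  then show ?thesis using powr_add[of x 1 "p-1"] that by simp
qed simp

text \<open>Subharmonicity of |f| powr p. With a = |f w|, Poisson's formula bounds a by the weighted
  average of |f|. Multiplying by a powr (p - 1) and applying the tangent inequality at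
  \<open>a\<close> under the integral reproduces the left side with the factor 1 - 1/p, which is
  absorbed.\<close>

lemma poisson_jensen:
  fixes f :: "complex \<Rightarrow> complex"
  assumes f: "f holomorphic_on ball 0 1" and "R < 1" and w: "cmod w < R" and p: "1 < p"
  shows "2 * pi * cmod (f w) powr p
    \<le> integral {0..2*pi} (\<lambda>t. poisson_kernel R w t * cmod (f (of_real R * cis t)) powr p)"
proof -
  define a where "a = cmod (f w)"
  define X where "X = (\<lambda>t. cmod (f (of_real R * cis t)))"
  have R: "0 \<le> R" using w norm_ge_zero[of w] by linarith
  have cX: "continuous_on {0..2*pi} X" unfolding X_def
    using hardy_continuous[OF f R \<open>R < 1\<close>] by (intro continuous_intros)
  have cXp: "continuous_on {0..2*pi} (\<lambda>t. X t powr p)" unfolding X_def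
    using hardy_powr_continuous[OF f R \<open>R < 1\<close>] p by auto
  note cP = continuous_on_poisson_kernel[OF w]
  have P0: "0 \<le> poisson_kernel R w t" for t using poisson_kernel_pos[OF w] less_imp_le by blast
  note ii = integrable_continuous_real
  have iP: "integral {0..2*pi} (poisson_kernel R w) = 2 * pi"
    using poisson_kernel_integral[OF w] by (rule integral_unique)
  have A: "2 * pi * a \<le> integral {0..2*pi} (\<lambda>t. poisson_kernel R w t * X t)"
  proof -
    note hi = poisson_formula[OF f \<open>R < 1\<close> w]
    have "cmod (integral {0..2*pi} (\<lambda>t. of_real (poisson_kernel R w t) * f (of_real R * cis t)))
      \<le> integral {0..2*pi} (\<lambda>t. poisson_kernel R w t * X t)"
    proof (rule integral_norm_bound_integral)
      show "(\<lambda>t. of_real (poisson_kernel R w t) * f (of_real R * cis t)) integrable_on {0..2*pi}"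
        using hi by blast
      show "(\<lambda>t. poisson_kernel R w t * X t) integrable_on {0..2*pi}"
        by (intro ii continuous_intros cX cP)
      show "\<And>t. t \<in> {0..2*pi} \<Longrightarrow> cmod (of_real (poisson_kernel R w t) * f (of_real R * cis t)) \<le> poisson_kernel R w t * X t"
        using P0 by (simp add: norm_mult X_def)
    qed
    then show ?thesis using integral_unique[OF hi] by (simp add: norm_mult a_def)
  qed
  have "2 * pi * a * a powr (p - 1) \<le> integral {0..2*pi} (\<lambda>t. poisson_kernel R w t * X t) * a powr (p-1)"
    using A by (intro mult_right_mono) auto
  also have "\<dots> = integral {0..2*pi} (\<lambda>t. poisson_kernel R w t * X t * a powr (p-1))" by simp
  also have "\<dots> \<le> integral {0..2*pi} (\<lambda>t. poisson_kernel R w t * X t powr p / p + poisson_kernel R w t * ((1 - 1 / p) * a powr p))"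
  proof (rule integral_le)
    show "(\<lambda>t. poisson_kernel R w t * X t * a powr (p-1)) integrable_on {0..2*pi}"
      by (intro ii continuous_intros cX cP)
    show "(\<lambda>t. poisson_kernel R w t * X t powr p / p + poisson_kernel R w t * ((1 - 1 / p) * a powr p)) integrable_on {0..2*pi}"
      using p by (intro ii continuous_intros cXp cP) auto
    fix t
    have "X t * a powr (p-1) \<le> X t powr p / p + (1 - 1 / p) * a powr p"
      by (rule young_tangent) (use p in \<open>auto simp: X_def a_def\<close>)
    from mult_left_mono[OF this P0[of t]]
    show "poisson_kernel R w t * X t * a powr (p-1) \<le> poisson_kernel R w t * X t powr p / p + poisson_kernel R w t * ((1 - 1 / p) * a powr p)"
      by (simp only: distrib_left mult.assoc times_divide_eq_right)
  qed
  also have "\<dots> = integral {0..2*pi} (\<lambda>t. poisson_kernel R w t * X t powr p / p) + integral {0..2*pi} (\<lambda>t. poisson_kernel R w t * ((1 - 1 / p) * a powr p))"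
    using p by (intro integral_add ii continuous_intros cXp cP) auto
  also have "\<dots> = integral {0..2*pi} (\<lambda>t. poisson_kernel R w t * X t powr p) / p + 2 * pi * ((1 - 1 / p) * a powr p)"
    using iP by simp
  also have "2 * pi * a * a powr (p - 1) = 2 * pi * a powr p"
    using powr_minus_one_mult[of a p] by (simp add: a_def)
  finally have "2 * pi * a powr p \<le> integral {0..2*pi} (\<lambda>t. poisson_kernel R w t * X t powr p) / p + 2 * pi * ((1 - 1 / p) * a powr p)" .
  then have "2 * pi * a powr p / p \<le> integral {0..2*pi} (\<lambda>t. poisson_kernel R w t * X t powr p) / p"
    by (simp add: algebra_simps)
  then show ?thesis using p by (simp add: divide_simps a_def X_def)
qed

text \<open>The quotient is holomorphic in \<open>w\<close>, so Poisson integrals of real data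
  become real parts of holomorphic functions.\<close>

lemma Re_herglotz:
  assumes "cmod w < R"
  shows "Re ((of_real R * cis t + w) / (of_real R * cis t - w)) = poisson_kernel R w t"
proof -
  define z where "z = of_real R * cis t"
  have z: "(Re z)\<^sup>2 + (Im z)\<^sup>2 = R\<^sup>2" unfolding z_def
    by (simp add: power_mult_distrib flip: distrib_left)
  have "Re ((z + w) / (z - w)) = (((Re z)\<^sup>2 + (Im z)\<^sup>2) - ((Re w)\<^sup>2 + (Im w)\<^sup>2)) / (cmod (z - w))\<^sup>2"
    unfolding Re_divide cmod_power2 by (simp add: power2_eq_square algebra_simps)
  then show ?thesis unfolding z unfolding z_def poisson_kernel_def cmod_power2[of w] .
qed

lemma poisson_kernel_le:
  assumes "cmod w < R"
  shows "poisson_kernel R w t \<le> (R + cmod w) / (R - cmod w)"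
proof -
  have "R - cmod w \<le> cmod (of_real R * cis t - w)"
    using norm_triangle_ineq2[of "of_real R * cis t" w] by (simp add: norm_mult)
  then have "(R - cmod w)\<^sup>2 \<le> (cmod (of_real R * cis t - w))\<^sup>2"
    using assms by (intro power_mono) auto
  then have "poisson_kernel R w t \<le> (R\<^sup>2 - (cmod w)\<^sup>2) / (R - cmod w)\<^sup>2"
    unfolding poisson_kernel_def using assms power_strict_mono[of "cmod w" R 2]
    by (intro divide_left_mono) (auto intro!: mult_pos_pos circle_minus_nonzero[OF assms, simplified])
  also have "\<dots> = (R + cmod w) / (R - cmod w)"
    using assms by (simp add: power2_eq_square square_diff_square_factored divide_simps)
  finally show ?thesis .
qed

lemma Re_of_real_mult: "Re (of_real x * z) = x * Re z"
  by simp

text \<open>\<open>A\<close> is the Herglotz integral of |f| powr p over the circle of radius R. A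
  holomorphic majorant, rather than a merely harmonic one, can be composed with a self-map and then
  fed to \<open>poisson_formula\<close>. The upper bound is Harnack's inequality.\<close>

lemma analytic_majorant:
  assumes f: "f holomorphic_on ball 0 1" and R: "0 < R" "R < 1" and p: "1 < p"
  obtains A where "A holomorphic_on ball 0 R"
    "\<And>w. w \<in> ball 0 R \<Longrightarrow> cmod (f w) powr p \<le> Re (A w)"
    "\<And>w. w \<in> ball 0 R \<Longrightarrow> Re (A w) \<le> (R + cmod w) / (R - cmod w) * hardy_mean p f R"
proof
  define X where "X = (\<lambda>t. cmod (f (of_real R * cis t)) powr p)"
  have cX: "continuous_on B X" for B unfolding X_def
    using hardy_powr_continuous[OF f _ \<open>R < 1\<close>] R p by auto
  define h where "h = (\<lambda>w t. of_real (X t) * ((of_real R * cis t + w) / (of_real R * cis t - w)))"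
  define A where "A = (\<lambda>w. integral (cbox 0 (2*pi)) (h w) / (2 * pi))"
  have nz: "of_real R * cis t - w \<noteq> 0" if "w \<in> ball 0 R" for w :: complex and t
    using circle_minus_nonzero[of w R t] that by simp
  have ch: "continuous_on B (h w)" if "w \<in> ball 0 R" for w B
    unfolding h_def using nz[OF that] by (intro continuous_intros cX) auto
  have "(\<lambda>w. integral (cbox 0 (2*pi)) (h w)) holomorphic_on ball 0 R"
  proof (rule leibniz_rule_holomorphic)
    fix w :: complex and t :: real assume w: "w \<in> ball 0 R"
    show "((\<lambda>w. h w t) has_field_derivative of_real (X t) * (2 * of_real R * cis t / (of_real R * cis t - w)\<^sup>2)) (at w within ball 0 R)"
      unfolding h_def using nz[OF w, of t]
      by (auto intro!: derivative_eq_intros simp: power2_eq_square field_simps)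
  next
    show "continuous_on (ball 0 R \<times> cbox 0 (2*pi)) (\<lambda>(w, t). of_real (X t) * (2 * of_real R * cis t / (of_real R * cis t - w)\<^sup>2))"
      unfolding case_prod_beta
      using nz by (intro continuous_intros continuous_on_compose2[OF cX[of UNIV]]) auto
  qed (auto intro!: integrable_continuous ch simp del: box_real)
  then show "A holomorphic_on ball 0 R" unfolding A_def by (intro holomorphic_intros) auto
  have ReA: "Re (A w) = integral {0..2*pi} (\<lambda>t. poisson_kernel R w t * X t) / (2 * pi)" if "w \<in> ball 0 R" for w
  proof -
    have "Re (integral {0..2*pi} (h w)) = integral {0..2*pi} (\<lambda>t. Re (h w t))"
      using integral_linear[OF integrable_continuous_real[OF ch[OF that]] bounded_linear_Re]
      by (simp add: o_def)
    moreover have "Re (h w t) = poisson_kernel R w t * X t" for t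
      proof -
      have "Re (h w t) = X t * Re ((of_real R * cis t + w) / (of_real R * cis t - w))"
        unfolding h_def by (rule Re_of_real_mult)
      then show ?thesis using Re_herglotz[of w R t] that by simp
    qed
    ultimately show ?thesis unfolding A_def by (simp flip: of_real_mult add: Re_divide_of_real)
  qed
  show "cmod (f w) powr p \<le> Re (A w)" if w: "w \<in> ball 0 R" for w
    using poisson_jensen[OF f \<open>R < 1\<close> _ p, of w] w unfolding ReA[OF w] X_def
    by (simp add: divide_simps mult_ac)
  show "Re (A w) \<le> (R + cmod w) / (R - cmod w) * hardy_mean p f R" if w: "w \<in> ball 0 R" for w
  proof -
    have wR: "cmod w < R" using w by simp
    have "integral {0..2*pi} (\<lambda>t. poisson_kernel R w t * X t) \<le> integral {0..2*pi} (\<lambda>t. (R + cmod w) / (R - cmod w) * X t)"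
    proof (rule integral_le)
      show "(\<lambda>t. poisson_kernel R w t * X t) integrable_on {0..2*pi}"
        by (intro integrable_continuous_real continuous_intros cX continuous_on_poisson_kernel[OF wR])
      show "(\<lambda>t. (R + cmod w) / (R - cmod w) * X t) integrable_on {0..2*pi}"
        by (intro integrable_continuous_real continuous_on_mult_left cX)
      show "poisson_kernel R w t * X t \<le> (R + cmod w) / (R - cmod w) * X t" for t
        using poisson_kernel_le[OF wR] by (intro mult_right_mono) (auto simp: X_def)
    qed
    also have "\<dots> = (R + cmod w) / (R - cmod w) * integral {0..2*pi} X" by simp
    finally show ?thesis unfolding ReA[OF w] hardy_mean_def X_def times_divide_eq_right
      by (rule divide_right_mono) simp
  qed
qed

section \<open>Hardy spaces\<close>

lemma hardy_mean_nonneg: "0 \<le> hardy_mean p f r"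
  unfolding hardy_mean_def
  using Henstock_Kurzweil_Integration.integral_nonneg[of "\<lambda>t. cmod (f (complex_of_real r * cis t)) powr p" "{0..2*pi}"]
    not_integrable_integral[of "\<lambda>t. cmod (f (complex_of_real r * cis t)) powr p" "{0..2*pi}"] by fastforce

lemma hardy_holomorphic: "f \<in> hardy p \<Longrightarrow> f holomorphic_on ball 0 1"
  and hardy_outside: "f \<in> hardy p \<Longrightarrow> z \<notin> ball 0 1 \<Longrightarrow> f z = 0"
  by (simp_all add: hardy_def)

lemma hardy_norm_nonneg: "0 \<le> hardy_norm p f"
  unfolding hardy_norm_def by simp

lemma hardy_mean_le:
  assumes f: "f \<in> hardy p" and r: "0 < r" "r < 1" and p: "0 < p"
  shows "hardy_mean p f r \<le> hardy_norm p f powr p"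
proof -
  define S where "S = (SUP r\<in>{0<..<1}. hardy_mean p f r)"
  have le: "hardy_mean p f r \<le> S"
    unfolding S_def using f r by (intro cSUP_upper) (auto simp: hardy_def)
  also have "S = hardy_norm p f powr p"
    unfolding hardy_norm_def S_def[symmetric] using p le hardy_mean_nonneg[of p f r] by (simp add: powr_powr)
  finally show ?thesis .
qed

lemma hardyI:
  assumes "f holomorphic_on ball 0 1" "\<And>z. z \<notin> ball 0 1 \<Longrightarrow> f z = 0"
    and B: "0 \<le> B" "\<And>r. 0 < r \<Longrightarrow> r < 1 \<Longrightarrow> hardy_mean p f r \<le> B powr p" and p: "0 < p"
  shows "f \<in> hardy p" "hardy_norm p f \<le> B"
proof -
  have "bdd_above (hardy_mean p f ` {0<..<1})" using B by (intro bdd_aboveI[of _ "B powr p"]) auto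
  then show "f \<in> hardy p" unfolding hardy_def using assms by auto
  have "(SUP r\<in>{0<..<1}. hardy_mean p f r) \<le> B powr p"
    using B by (intro cSUP_least) auto
  moreover have "0 \<le> (SUP r\<in>{0<..<1}. hardy_mean p f r)"
    using \<open>f \<in> hardy p\<close> hardy_mean_nonneg[of p f "1/2"]
    by (intro cSUP_upper2[of _ _ "1/2"]) (auto simp: hardy_def)
  ultimately have "hardy_norm p f \<le> (B powr p) powr (1 / p)"
    unfolding hardy_norm_def using p by (intro powr_mono2) auto
  then show "hardy_norm p f \<le> B" using p B by (simp add: powr_powr)
qed

lemma hardy_mean_mono:
  assumes "f holomorphic_on ball 0 1" "g holomorphic_on ball 0 1" and r: "0 < r" "r < 1" and p: "0 < p"
    and "\<And>z. cmod z = r \<Longrightarrow> cmod (f z) powr p \<le> c * cmod (g z) powr p"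
  shows "hardy_mean p f r \<le> c * hardy_mean p g r"
proof -
  have "integral {0..2*pi} (\<lambda>t. cmod (f (of_real r * cis t)) powr p) \<le> integral {0..2*pi} (\<lambda>t. c * cmod (g (of_real r * cis t)) powr p)"
    using assms
    by (intro integral_le integrable_continuous_real continuous_on_mult_left hardy_powr_continuous) (auto simp: norm_mult)
  then show ?thesis unfolding hardy_mean_def by (simp add: divide_right_mono)
qed

lemma hardy_norm_le_scale:
  assumes f: "f holomorphic_on ball 0 1" "\<And>z. z \<notin> ball 0 1 \<Longrightarrow> f z = 0" and g: "g \<in> hardy p" and p: "0 < p" and "0 \<le> c"
    and le: "\<And>z. z \<in> ball 0 1 \<Longrightarrow> cmod (f z) \<le> c * cmod (g z)"
  shows "f \<in> hardy p" "hardy_norm p f \<le> c * hardy_norm p g"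
proof -
  have *: "hardy_mean p f r \<le> (c * hardy_norm p g) powr p" if r: "0 < r" "r < 1" for r
  proof -
    have "hardy_mean p f r \<le> c powr p * hardy_mean p g r"
    proof (rule hardy_mean_mono)
      fix z assume "cmod z = r"
      then have "cmod (f z) powr p \<le> (c * cmod (g z)) powr p"
        using le[of z] r p by (intro powr_mono2) auto
      then show "cmod (f z) powr p \<le> c powr p * cmod (g z) powr p"
        using \<open>0 \<le> c\<close> by (simp add: powr_mult)
    qed (use f g r p in \<open>auto intro: hardy_holomorphic\<close>)
    also have "\<dots> \<le> c powr p * hardy_norm p g powr p"
      using hardy_mean_le[OF g r p] by (intro mult_left_mono) auto
    finally show ?thesis using \<open>0 \<le> c\<close> hardy_norm_nonneg by (simp add: powr_mult)
  qed
  show "f \<in> hardy p" "hardy_norm p f \<le> c * hardy_norm p g"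
    using hardyI[OF f _ * p] \<open>0 \<le> c\<close> hardy_norm_nonneg by (auto simp: mult_nonneg_nonneg)
qed

lemma hardy_scale:
  assumes f: "f \<in> hardy p" and p: "0 < p"
  shows "(\<lambda>z. c * f z) \<in> hardy p" "hardy_norm p (\<lambda>z. c * f z) \<le> cmod c * hardy_norm p f"
  using hardy_norm_le_scale[of "\<lambda>z. c * f z" f p "cmod c"] assms
    holomorphic_on_mult[OF holomorphic_on_const hardy_holomorphic[OF f]] hardy_outside[OF f]
  by (auto simp: norm_mult)

lemma hardy_bounded:
  assumes f: "f holomorphic_on ball 0 1" "\<And>z. z \<notin> ball 0 1 \<Longrightarrow> f z = 0"
    and b: "\<And>z. z \<in> ball 0 1 \<Longrightarrow> cmod (f z) \<le> B" and p: "0 < p"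
  shows "f \<in> hardy p" "hardy_norm p f \<le> B"
proof -
  have B: "0 \<le> B" using order_trans[OF norm_ge_zero b[of 0]] by simp
  have *: "hardy_mean p f r \<le> B powr p" if r: "0 < r" "r < 1" for r
  proof -
    have "hardy_mean p f r \<le> B powr p * hardy_mean p (\<lambda>_. 1) r"
    proof (rule hardy_mean_mono)
      fix z assume "cmod z = r"
      then show "cmod (f z) powr p \<le> B powr p * cmod 1 powr p"
        using b[of z] r p by (auto intro!: powr_mono2)
    qed (use f r p in auto)
    then show ?thesis by (simp add: hardy_mean_def)
  qed
  show "f \<in> hardy p" "hardy_norm p f \<le> B" using hardyI[OF f B * p] by auto
qed

text \<open>Convexity of x powr p at (X + Y) / (A + B), which is the convex combination of X / A and
  Y / B with weights A / (A + B) and B / (A + B). With A and B in the role of the two norms,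
  integration yields Minkowski's inequality.\<close>

lemma powr_sum_le:
  fixes X Y A B p :: real
  assumes "0 \<le> X" "0 \<le> Y" "0 < A" "0 < B" "1 < p"
  shows "(X + Y) powr p \<le> (A + B) powr p * (A / (A + B) * (X powr p / A powr p) + B / (A + B) * (Y powr p / B powr p))"
proof -
  define a b u \<theta> where "a = X / A" and "b = Y / B" and "u = (X + Y) / (A + B)" and "\<theta> = A / (A + B)"
  have nn: "0 \<le> a" "0 \<le> b" "0 \<le> u" "0 \<le> \<theta>" "0 \<le> 1 - \<theta>" using assms unfolding a_def b_def u_def \<theta>_def
    by (auto simp: divide_simps)
  have B: "B / (A + B) = 1 - \<theta>" using assms unfolding \<theta>_def by (simp add: field_simps)
  have u: "u = \<theta> * a + (1 - \<theta>) * b"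
    unfolding B[symmetric] using assms unfolding a_def b_def u_def \<theta>_def by (simp add: add_divide_distrib)
  have "u powr p = u * u powr (p - 1)" using powr_minus_one_mult[OF nn(3)] by simp
  also have "\<dots> = \<theta> * (a * u powr (p - 1)) + (1 - \<theta>) * (b * u powr (p - 1))"
    by (subst u) (simp add: algebra_simps)
  also have "\<dots> \<le> \<theta> * (a powr p / p + (1 - 1 / p) * u powr p) + (1 - \<theta>) * (b powr p / p + (1 - 1 / p) * u powr p)"
    using nn young_tangent \<open>1 < p\<close> by (intro add_mono mult_left_mono) auto
  also have "\<dots> = (\<theta> * a powr p + (1 - \<theta>) * b powr p) / p + (1 - 1 / p) * u powr p"
    by (simp add: algebra_simps add_divide_distrib diff_divide_distrib)
  finally have "u powr p / p \<le> (\<theta> * a powr p + (1 - \<theta>) * b powr p) / p"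
    by (simp add: algebra_simps)
  then have *: "u powr p \<le> \<theta> * a powr p + (1 - \<theta>) * b powr p"
    using \<open>1 < p\<close> by (simp add: divide_le_cancel)
  have "(X + Y) powr p = (A + B) powr p * u powr p"
    using assms unfolding u_def by (simp add: powr_divide)
  then show ?thesis using mult_left_mono[OF *, of "(A + B) powr p"] assms unfolding B \<theta>_def[symmetric]
    by (simp add: a_def b_def powr_divide)
qed

lemma hardy_add:
  assumes f: "f \<in> hardy p" and g: "g \<in> hardy p" and p: "1 < p"
  shows "(\<lambda>z. f z + g z) \<in> hardy p"
    and "hardy_norm p (\<lambda>z. f z + g z) \<le> hardy_norm p f + hardy_norm p g"
proof -
  have hol: "f holomorphic_on ball 0 1" "g holomorphic_on ball 0 1" using f g hardy_holomorphic by auto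
  \<comment> \<open>Strictly positive upper bounds A and B stand for the norms, since a norm may be
    zero and could then not be divided by; the slack is removed at the end by
    \<open>field_le_epsilon\<close>.\<close>
  have *: "hardy_mean p (\<lambda>z. f z + g z) r \<le> (A + B) powr p"
    if A: "0 < A" "hardy_norm p f \<le> A" and B: "0 < B" "hardy_norm p g \<le> B" and r: "0 < r" "r < 1" for A B r
  proof -
    define c where "c = (A + B) powr p * (A / (A + B)) / A powr p"
    define d where "d = (A + B) powr p * (B / (A + B)) / B powr p"
    have cd: "0 \<le> c" "0 \<le> d" unfolding c_def d_def using A B by auto
    have ci: "continuous_on {0..2*pi} (\<lambda>t. cmod (f (of_real r * cis t)) powr p)"
      "continuous_on {0..2*pi} (\<lambda>t. cmod (g (of_real r * cis t)) powr p)"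
      using hol r p by (auto intro!: hardy_powr_continuous)
    have ci2: "continuous_on {0..2*pi} (\<lambda>t. cmod (f (of_real r * cis t) + g (of_real r * cis t)) powr p)"
      using hardy_powr_continuous[of "\<lambda>z. f z + g z" r p] hol r p by (auto intro: holomorphic_intros)
    have "integral {0..2*pi} (\<lambda>t. cmod (f (of_real r * cis t) + g (of_real r * cis t)) powr p)
      \<le> integral {0..2*pi} (\<lambda>t. c * cmod (f (of_real r * cis t)) powr p + d * cmod (g (of_real r * cis t)) powr p)"
    proof (intro integral_le integrable_continuous_real continuous_on_add continuous_on_mult_left ci ci2)
      fix t
      let ?x = "f (of_real r * cis t)" and ?y = "g (of_real r * cis t)"
      have "cmod (?x + ?y) powr p \<le> (cmod ?x + cmod ?y) powr p"
        using p by (intro powr_mono2 norm_triangle_ineq) auto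
      also have "\<dots> \<le> c * cmod ?x powr p + d * cmod ?y powr p"
        using powr_sum_le[of "cmod ?x" "cmod ?y" A B p] A B p unfolding c_def d_def
        by (simp add: algebra_simps)
      finally show "cmod (?x + ?y) powr p \<le> c * cmod ?x powr p + d * cmod ?y powr p" .
    qed
    also have "\<dots> = c * integral {0..2*pi} (\<lambda>t. cmod (f (of_real r * cis t)) powr p) + d * integral {0..2*pi} (\<lambda>t. cmod (g (of_real r * cis t)) powr p)"
      by (subst integral_add) (auto intro!: integrable_continuous_real continuous_on_mult_left ci)
    finally have "hardy_mean p (\<lambda>z. f z + g z) r \<le> c * hardy_mean p f r + d * hardy_mean p g r"
      unfolding hardy_mean_def by (simp add: divide_simps)
    also have "\<dots> \<le> c * A powr p + d * B powr p"
    proof -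
      have "hardy_mean p f r \<le> A powr p"
        using hardy_mean_le[OF f r] powr_mono2[of p "hardy_norm p f" A] A p hardy_norm_nonneg by force
      moreover have "hardy_mean p g r \<le> B powr p"
        using hardy_mean_le[OF g r] powr_mono2[of p "hardy_norm p g" B] B p hardy_norm_nonneg by force
      ultimately show ?thesis using cd by (intro add_mono mult_left_mono) auto
    qed
    also have "\<dots> = (A + B) powr p * (A / (A + B) + B / (A + B))"
      unfolding c_def d_def distrib_left using A B by simp
    also have "A / (A + B) + B / (A + B) = 1" using A B by (simp flip: add_divide_distrib)
    finally show ?thesis by simp
  qed
  have hol2: "(\<lambda>z. f z + g z) holomorphic_on ball 0 1" using hol by (intro holomorphic_intros)
  have z: "f z + g z = 0" if "z \<notin> ball 0 1" for z using hardy_outside[OF f that] hardy_outside[OF g that] by simp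
  have p0: "0 < p" using p by simp
  have **: "(\<lambda>z. f z + g z) \<in> hardy p \<and> hardy_norm p (\<lambda>z. f z + g z) \<le> hardy_norm p f + hardy_norm p g + e" if "0 < e" for e
  proof -
    have "hardy_mean p (\<lambda>z. f z + g z) r \<le> (hardy_norm p f + hardy_norm p g + e) powr p" if "0 < r" "r < 1" for r
      using *[of "hardy_norm p f + e/2" "hardy_norm p g + e/2" r] that \<open>0 < e\<close> hardy_norm_nonneg[of p f] hardy_norm_nonneg[of p g]
      by (simp add: algebra_simps)
    moreover have "0 \<le> hardy_norm p f + hardy_norm p g + e"
      using hardy_norm_nonneg[of p f] hardy_norm_nonneg[of p g] \<open>0 < e\<close> by simp
    ultimately show ?thesis using hardyI[OF hol2 z _ _ p0] by blast
  qed
  show "(\<lambda>z. f z + g z) \<in> hardy p" using **[of 1] by simp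
  show "hardy_norm p (\<lambda>z. f z + g z) \<le> hardy_norm p f + hardy_norm p g"
    by (rule field_le_epsilon) (use ** in blast)
qed

lemma hardy_diff:
  assumes f: "f \<in> hardy p" and g: "g \<in> hardy p" and p: "1 < p"
  shows "(\<lambda>z. f z - g z) \<in> hardy p"
    and "hardy_norm p (\<lambda>z. f z - g z) \<le> hardy_norm p f + hardy_norm p g"
  using hardy_add[OF f hardy_scale(1)[OF g, of "-1"] p] hardy_scale(2)[OF g, of "-1"] p by auto

lemma hardy_zero: "0 < p \<Longrightarrow> (\<lambda>_. 0) \<in> hardy p" "0 < p \<Longrightarrow> hardy_norm p (\<lambda>_. 0) = 0"
  using hardy_bounded[of "\<lambda>_. 0" 0 p] hardy_norm_nonneg[of p "\<lambda>_. 0"] by auto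

lemma hardy_sum:
  assumes "\<And>i. i \<in> I \<Longrightarrow> f i \<in> hardy p" "finite I" and p: "1 < p"
  shows "(\<lambda>z. \<Sum>i\<in>I. f i z) \<in> hardy p"
    and "hardy_norm p (\<lambda>z. \<Sum>i\<in>I. f i z) \<le> (\<Sum>i\<in>I. hardy_norm p (f i))"
proof -
  have "(\<lambda>z. \<Sum>i\<in>I. f i z) \<in> hardy p \<and> hardy_norm p (\<lambda>z. \<Sum>i\<in>I. f i z) \<le> (\<Sum>i\<in>I. hardy_norm p (f i))"
    using assms(2,1)
  proof (induction I rule: finite_induct)
    case empty then show ?case using hardy_zero p by auto
  next
    case (insert i I)
    then show ?case using hardy_add[of "f i" p "\<lambda>z. \<Sum>i\<in>I. f i z"] p by fastforce
  qed
  then show "(\<lambda>z. \<Sum>i\<in>I. f i z) \<in> hardy p" "hardy_norm p (\<lambda>z. \<Sum>i\<in>I. f i z) \<le> (\<Sum>i\<in>I. hardy_norm p (f i))"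
    by auto
qed

lemma disc_const_hardy:
  assumes "0 < p" shows "(\<lambda>z. if z \<in> ball 0 1 then c else 0) \<in> hardy p"
    and "hardy_norm p (\<lambda>z. if z \<in> ball 0 1 then c else 0) \<le> cmod c"
proof -
  have "(\<lambda>z. if z \<in> ball 0 1 then c else 0) holomorphic_on ball 0 1"
    by (rule holomorphic_transform[of "\<lambda>_. c"]) auto
  then show "(\<lambda>z. if z \<in> ball 0 1 then c else 0) \<in> hardy p"
    "hardy_norm p (\<lambda>z. if z \<in> ball 0 1 then c else 0) \<le> cmod c"
    using hardy_bounded[of "\<lambda>z. if z \<in> ball 0 1 then c else 0" "cmod c" p] assms by auto
qed

text \<open>From the midpoint of |w| and 1 onwards the Harnack factor is bounded independently of R:
  its numerator is at most 2 and its denominator at least (1 - |w|) / 2.\<close>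

lemma majorant_bound:
  fixes R M :: real and w :: complex
  assumes "cmod w < 1" "(1 + cmod w) / 2 \<le> R" "R < 1" "0 \<le> m" "m \<le> M"
  shows "(R + cmod w) / (R - cmod w) * m \<le> 4 * M / (1 - cmod w)"
proof -
  have "(R + cmod w) / (R - cmod w) \<le> 2 / ((1 - cmod w) / 2)"
    using assms by (intro frac_le) (auto simp: field_simps)
  then have "(R + cmod w) / (R - cmod w) * m \<le> 2 / ((1 - cmod w) / 2) * M"
    using assms by (intro mult_mono) auto
  then show ?thesis by simp
qed

text \<open>A weighted form of Littlewood subordination: the Poisson average of the holomorphic
  majorant composed with \<psi> is its value at \<psi> b, and Harnack bounds that value. The bound
  \<open>M\<close> is demanded only for radii from \<open>R0\<close> on, because it will be applied
  to a quotient by z - \<alpha>, which is controlled only near the circle.\<close>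

lemma poisson_composition_bound:
  assumes h: "h holomorphic_on ball 0 1" and p: "1 < p"
    and psi: "\<psi> holomorphic_on ball 0 1" "\<psi> ` ball 0 1 \<subseteq> ball 0 1"
    and \<rho>: "\<rho> < 1" and b: "cmod b < \<rho>" and "R0 < 1"
    and M: "\<And>R. 0 < R \<Longrightarrow> R0 \<le> R \<Longrightarrow> R < 1 \<Longrightarrow> hardy_mean p h R \<le> M"
  shows "integral {0..2*pi} (\<lambda>t. poisson_kernel \<rho> b t * cmod (h (\<psi> (of_real \<rho> * cis t))) powr p) / (2 * pi)
    \<le> 4 * M / (1 - cmod (\<psi> b))"
proof -
  have \<rho>0: "0 < \<rho>" using b norm_ge_zero[of b] by linarith
  define \<rho>' where "\<rho>' = (\<rho> + 1) / 2"
  have \<rho>': "\<rho> < \<rho>'" "\<rho>' < 1" using \<rho> unfolding \<rho>'_def by auto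
  have sub: "cball 0 \<rho>' \<subseteq> ball (0::complex) 1" using \<rho>' by auto
  have "compact (\<psi> ` cball 0 \<rho>')"
    using holomorphic_on_imp_continuous_on[OF psi(1)] sub by (intro compact_continuous_image) (auto intro: continuous_on_subset)
  moreover have "\<psi> ` cball 0 \<rho>' \<noteq> {}" using \<rho>' \<rho>0 by auto
  ultimately obtain y where y: "y \<in> \<psi> ` cball 0 \<rho>'" "\<And>x. x \<in> \<psi> ` cball 0 \<rho>' \<Longrightarrow> dist 0 x \<le> dist 0 y"
    using distance_attains_sup[of "\<psi> ` cball 0 \<rho>'" 0] by blast
  have y1: "cmod y < 1" using y(1) psi(2) sub by (auto simp: subset_iff)
  define w where "w = \<psi> b"
  have b1: "b \<in> ball 0 1" using b \<rho> by simp
  have w1: "cmod w < 1" using psi(2) b1 unfolding w_def by (auto simp: subset_iff image_subset_iff)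
  \<comment> \<open>R has to be at least \<open>R0\<close>, to exceed |y|, the largest modulus in
    the \<psi>-image of the closed disc of radius \<open>\<rho>'\<close>, and to lie past the
    midpoint of |w| and 1.\<close>
  define R where "R = max (max R0 ((1 + cmod y) / 2)) ((1 + cmod w) / 2)"
  have R: "0 < R" "R < 1" "R0 \<le> R" "cmod y < R" "(1 + cmod w) / 2 \<le> R"
    unfolding R_def using y1 w1 \<open>R0 < 1\<close> norm_ge_zero[of w] by (auto simp: less_max_iff_disj add_pos_nonneg)
  have \<psi>R: "\<psi> z \<in> ball 0 R" if "z \<in> ball 0 \<rho>'" for z
    using y(2)[of "\<psi> z"] R that by auto
  obtain A where A: "A holomorphic_on ball 0 R"
    "\<And>w. w \<in> ball 0 R \<Longrightarrow> cmod (h w) powr p \<le> Re (A w)"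
    "\<And>w. w \<in> ball 0 R \<Longrightarrow> Re (A w) \<le> (R + cmod w) / (R - cmod w) * hardy_mean p h R"
    using analytic_majorant[OF h R(1,2) p] by blast
  have hol: "(A \<circ> \<psi>) holomorphic_on ball 0 \<rho>'"
    using \<psi>R sub by (intro holomorphic_on_compose_gen[OF holomorphic_on_subset[OF psi(1)] A(1)]) auto
  have "((\<lambda>t. Re (of_real (poisson_kernel \<rho> b t) * (A \<circ> \<psi>) (of_real \<rho> * cis t))) has_integral Re (2 * pi * (A \<circ> \<psi>) b)) {0..2*pi}"
    using has_integral_linear[OF poisson_formula[OF hol \<rho>'(1) b] bounded_linear_Re] by (simp add: o_def)
  then have hi: "((\<lambda>t. poisson_kernel \<rho> b t * Re (A (\<psi> (of_real \<rho> * cis t)))) has_integral 2 * pi * Re (A w)) {0..2*pi}"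
    by (simp add: w_def)
  have "integral {0..2*pi} (\<lambda>t. poisson_kernel \<rho> b t * cmod (h (\<psi> (of_real \<rho> * cis t))) powr p) \<le> 2 * pi * Re (A w)"
    unfolding integral_unique[OF hi, symmetric]
  proof (rule integral_le)
    have "(h \<circ> \<psi>) holomorphic_on ball 0 1" using psi h by (intro holomorphic_on_compose_gen)
    from hardy_powr_continuous[OF this, of \<rho> p] 
    have "continuous_on {0..2*pi} (\<lambda>t. cmod (h (\<psi> (of_real \<rho> * cis t))) powr p)"
      using \<rho> \<rho>0 p by (simp add: o_def)
    then show "(\<lambda>t. poisson_kernel \<rho> b t * cmod (h (\<psi> (of_real \<rho> * cis t))) powr p) integrable_on {0..2*pi}"
      by (intro integrable_continuous_real continuous_on_mult continuous_on_poisson_kernel[OF b])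
    show "(\<lambda>t. poisson_kernel \<rho> b t * Re (A (\<psi> (of_real \<rho> * cis t)))) integrable_on {0..2*pi}"
      using hi by blast
    fix t :: real
    have "of_real \<rho> * cis t \<in> ball 0 \<rho>'" using \<rho>' \<rho>0 by (simp add: norm_mult)
    then show "poisson_kernel \<rho> b t * cmod (h (\<psi> (of_real \<rho> * cis t))) powr p \<le> poisson_kernel \<rho> b t * Re (A (\<psi> (of_real \<rho> * cis t)))"
      using less_imp_le[OF poisson_kernel_pos[OF b]] A(2)[OF \<psi>R] by (intro mult_left_mono) auto
  qed
  then have "integral {0..2*pi} (\<lambda>t. poisson_kernel \<rho> b t * cmod (h (\<psi> (of_real \<rho> * cis t))) powr p) / (2 * pi) \<le> Re (A w)"
    by (simp add: divide_simps mult_ac)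
  also have "w \<in> ball 0 R" unfolding w_def using b \<rho>' by (intro \<psi>R) auto
  then have "Re (A w) \<le> (R + cmod w) / (R - cmod w) * hardy_mean p h R" by (rule A(3))
  also have "\<dots> \<le> 4 * M / (1 - cmod w)"
    using w1 R M hardy_mean_nonneg by (intro majorant_bound) auto
  finally show ?thesis unfolding w_def .
qed

text \<open>The majorant at the midpoint radius, followed by a p-th root. The exponent 1 / p is what
  later turns a distance of order \<open>r ^ n\<close> from the circle into a power of
  \<open>\<rho>\<^sub>0\<close>.\<close>

lemma hardy_growth:
  assumes f: "f \<in> hardy p" and p: "1 < p" and w: "cmod w < 1"
  shows "cmod (f w) \<le> (4 / (1 - cmod w)) powr (1 / p) * hardy_norm p f"
proof -
  define R where "R = (1 + cmod w) / 2"
  have R: "0 < R" "R < 1" "cmod w < R" "(1 + cmod w) / 2 \<le> R" using w norm_ge_zero[of w] unfolding R_def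
    by (auto simp: add_pos_nonneg)
  obtain A where A: "\<And>w. w \<in> ball 0 R \<Longrightarrow> cmod (f w) powr p \<le> Re (A w)"
    "\<And>w. w \<in> ball 0 R \<Longrightarrow> Re (A w) \<le> (R + cmod w) / (R - cmod w) * hardy_mean p f R"
    using analytic_majorant[OF hardy_holomorphic[OF f] R(1,2) p] by metis
  have "cmod (f w) powr p \<le> (R + cmod w) / (R - cmod w) * hardy_mean p f R"
    using A[of w] R by simp
  also have "\<dots> \<le> 4 * (hardy_norm p f powr p) / (1 - cmod w)"
    using w R f p hardy_mean_nonneg by (intro majorant_bound hardy_mean_le) auto
  finally have "cmod (f w) powr p \<le> 4 / (1 - cmod w) * (hardy_norm p f powr p)" by simp
  then have "(cmod (f w) powr p) powr (1/p) \<le> (4 / (1 - cmod w) * (hardy_norm p f powr p)) powr (1/p)"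
    using p by (intro powr_mono2) auto
  also have "\<dots> = (4 / (1 - cmod w)) powr (1 / p) * (hardy_norm p f powr p) powr (1/p)"
    using w by (intro powr_mult)
  finally show ?thesis using p hardy_norm_nonneg[of p f] by (simp add: powr_powr)
qed

section \<open>Iterates in the half-plane coordinate\<close>

lemma scale_between:
  fixes r v :: real
  assumes "r ^ n \<le> v" "v < 1"
  obtains j where "j \<le> n" "v \<le> r ^ j" "r * r ^ j \<le> v"
proof -
  define J where "J = (LEAST j. r ^ j \<le> v)"
  have J: "r ^ J \<le> v" "J \<le> n" unfolding J_def using assms by (auto intro: LeastI Least_le)
  have "J \<noteq> 0"
  proof
    assume "J = 0" then show False using J(1) assms(2) by simp
  qed
  then obtain j where j: "J = Suc j" using not0_implies_Suc by blast
  have "\<not> r ^ j \<le> v" using not_less_Least[of j "\<lambda>j. r ^ j \<le> v"] j unfolding J_def by simp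
  then show ?thesis using that[of j] J unfolding j by simp
qed

lemma cmod_of_real_diff: "cmod (of_real a - of_real b) = \<bar>a - b\<bar>"
  by (metis norm_of_real of_real_diff)

lemma cmod_one_minus_of_real: "cmod (1 - of_real b) = \<bar>1 - b\<bar>"
  using cmod_of_real_diff[of 1 b] by simp

section \<open>The half-plane model and the norms of the iterates\<close>

locale second_kind =
  fixes \<alpha> \<omega> :: complex and r p :: real and \<phi> :: "complex \<Rightarrow> complex"
  assumes \<alpha>: "cmod \<alpha> < 1" and \<omega>: "cmod \<omega> = 1" and r: "0 < r" "r < 1" and p: "1 < p"
    and \<phi>: "\<And>z. z \<in> ball 0 1 \<Longrightarrow>
      \<phi> z = (\<alpha> + \<omega> * (of_real r * ((z - \<alpha>) / (\<omega> - z)))) / (1 + of_real r * ((z - \<alpha>) / (\<omega> - z)))"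
begin

definition "\<kappa> z = (z - \<alpha>) / (\<omega> - z)"
definition "\<mu> u = (\<alpha> + \<omega> * u) / (1 + u)"
text \<open>This is |1 + u|^2 - |\<alpha> + \<omega> u|^2 written as an affine function of
  \<open>u\<close>. Its positivity places \<open>\<mu> u\<close> in the disc, so \<open>H\<close> is
  the half-plane onto which \<open>\<kappa>\<close> maps the disc.\<close>

definition "level u = 1 - (cmod \<alpha>)\<^sup>2 + 2 * Re (u * (1 - \<omega> * cnj \<alpha>))"
definition "H = {u. 0 < level u}"
text \<open>Closed form of the n-th power of the composition operator: n steps of the map are a
  single dilation by \<open>r ^ n\<close>. The value 0 off the disc follows the convention of
  \<open>hardy\<close>.\<close>

definition iter :: "nat \<Rightarrow> (complex \<Rightarrow> complex) \<Rightarrow> complex \<Rightarrow> complex" where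
  "iter n f = (\<lambda>z. if z \<in> ball 0 1 then f (\<mu> (of_real (r ^ n) * \<kappa> z)) else 0)"
definition "\<rho>\<^sub>0 = r powr (1 / p)"

lemma level_eq: "level u = (cmod (1 + u))\<^sup>2 - (cmod (\<alpha> + \<omega> * u))\<^sup>2"
proof -
  have w: "\<omega> * cnj \<omega> = 1" using \<omega> by (simp add: complex_norm_square[symmetric])
  have "of_real ((cmod (1 + u))\<^sup>2 - (cmod (\<alpha> + \<omega> * u))\<^sup>2)
      = (1 + u) * cnj (1 + u) - (\<alpha> + \<omega> * u) * cnj (\<alpha> + \<omega> * u)"
    by (simp only: of_real_diff complex_norm_square)
  also have "\<dots> = 1 - \<alpha> * cnj \<alpha> + (u * (1 - \<omega> * cnj \<alpha>) + cnj (u * (1 - \<omega> * cnj \<alpha>))) + u * cnj u * (1 - \<omega> * cnj \<omega>)"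
    by (simp add: algebra_simps)
  also have "\<dots> = 1 - of_real ((cmod \<alpha>)\<^sup>2) + of_real (2 * Re (u * (1 - \<omega> * cnj \<alpha>)))"
    unfolding w complex_add_cnj complex_norm_square by simp
  also have "\<dots> = of_real (level u)" unfolding level_def by simp
  finally show ?thesis by (simp only: of_real_eq_iff)
qed

lemma \<alpha>_sq: "(cmod \<alpha>)\<^sup>2 < 1"
  using \<alpha> by (simp add: power_less_one_iff)

lemma H_nonzero: assumes "u \<in> H" shows "1 + u \<noteq> 0"
proof
  assume "1 + u = 0"
  then have "level u \<le> 0" unfolding level_eq by simp
  then show False using assms by (simp add: H_def)
qed

lemma \<mu>_norm: assumes "u \<in> H" shows "1 - (cmod (\<mu> u))\<^sup>2 = level u / (cmod (1 + u))\<^sup>2"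
  using H_nonzero[OF assms] unfolding level_eq \<mu>_def by (simp add: norm_divide power_divide diff_divide_distrib)

lemma \<mu>_in_disc: assumes "u \<in> H" shows "\<mu> u \<in> ball 0 1"
proof -
  have "0 < 1 - (cmod (\<mu> u))\<^sup>2" unfolding \<mu>_norm[OF assms] using assms H_nonzero[OF assms] by (simp add: H_def)
  then show ?thesis by (simp add: power_less_one_iff)
qed

lemma \<omega>_minus: "z \<in> ball 0 1 \<Longrightarrow> \<omega> - z \<noteq> 0" "\<omega> - \<alpha> \<noteq> 0"
  using \<omega> \<alpha> by auto

lemma one_plus_\<kappa>: assumes "z \<in> ball 0 1" shows "1 + \<kappa> z = (\<omega> - \<alpha>) / (\<omega> - z)"
  unfolding \<kappa>_def using \<omega>_minus(1)[OF assms] by (simp add: field_simps)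

lemma \<mu>_\<kappa>: assumes "z \<in> ball 0 1" shows "\<mu> (\<kappa> z) = z"
proof -
  have "\<alpha> + \<omega> * \<kappa> z = z * ((\<omega> - \<alpha>) / (\<omega> - z))"
    unfolding \<kappa>_def using \<omega>_minus(1)[OF assms] by (simp add: field_simps)
  then show ?thesis unfolding \<mu>_def one_plus_\<kappa>[OF assms] using \<omega>_minus(1)[OF assms] \<omega>_minus(2) by simp
qed

lemma \<kappa>_\<mu>: assumes "u \<in> H" shows "\<kappa> (\<mu> u) = u"
proof -
  have nz: "1 + u \<noteq> 0" by (rule H_nonzero[OF assms])
  have "\<mu> u - \<alpha> = (\<omega> - \<alpha>) * u / (1 + u)" "\<omega> - \<mu> u = (\<omega> - \<alpha>) / (1 + u)"
    unfolding \<mu>_def using nz by (simp_all add: field_simps)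
  then show ?thesis unfolding \<kappa>_def using nz \<omega>_minus(2) by simp
qed

lemma \<kappa>_in_H: assumes "z \<in> ball 0 1" shows "\<kappa> z \<in> H"
proof -
  have nz: "1 + \<kappa> z \<noteq> 0" unfolding one_plus_\<kappa>[OF assms] using \<omega>_minus(1)[OF assms] \<omega>_minus(2) by simp
  have "\<alpha> + \<omega> * \<kappa> z = z * (1 + \<kappa> z)" using \<mu>_\<kappa>[OF assms] nz unfolding \<mu>_def by (simp add: field_simps)
  then have "level (\<kappa> z) = (cmod (1 + \<kappa> z))\<^sup>2 * (1 - (cmod z)\<^sup>2)"
    unfolding level_eq by (simp only: norm_mult power_mult_distrib) (simp add: right_diff_distrib)
  moreover have "(cmod z)\<^sup>2 < 1" using assms by (simp add: power_less_one_iff)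
  ultimately show ?thesis unfolding H_def using nz by simp
qed

lemma level_scale: "level (of_real s * u) = (1 - s) * (1 - (cmod \<alpha>)\<^sup>2) + s * level u"
  unfolding level_def mult.assoc Re_of_real_mult by (simp add: algebra_simps)

lemma H_scale: assumes "u \<in> H" "0 \<le> s" "s \<le> 1" shows "of_real s * u \<in> H"
proof (cases "s = 0")
  case True
  then show ?thesis using \<alpha>_sq by (simp add: H_def level_def)
next
  case False
  then have "0 < s * level u" using assms by (simp add: H_def)
  moreover have "0 \<le> (1 - s) * (1 - (cmod \<alpha>)\<^sup>2)" using assms \<alpha>_sq by (intro mult_nonneg_nonneg) auto
  ultimately show ?thesis unfolding H_def mem_Collect_eq level_scale by linarith
qed

lemma r_power: "0 < r ^ n" "r ^ n \<le> 1"
  using r by (auto simp: power_le_one)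

lemma H_iter: assumes "u \<in> H" shows "of_real (r ^ n) * u \<in> H"
  using r_power[of n] by (intro H_scale[OF assms]) auto

lemma iter_in_disc: "z \<in> ball 0 1 \<Longrightarrow> \<mu> (of_real (r ^ n) * \<kappa> z) \<in> ball 0 1"
  by (intro \<mu>_in_disc H_iter \<kappa>_in_H)

lemma comp_op_eq_iter: "comp_op \<phi> f = iter 1 f"
proof
  fix z show "comp_op \<phi> f z = iter 1 f z"
    unfolding comp_op_def iter_def using \<phi>[of z] by (simp add: \<mu>_def \<kappa>_def)
qed

lemma iter_iter: "iter n (iter k f) = iter (n + k) f"
proof
  fix z
  show "iter n (iter k f) z = iter (n + k) f z"
  proof (cases "z \<in> ball 0 1")
    case True
    have "of_real (r ^ k) * \<kappa> (\<mu> (of_real (r ^ n) * \<kappa> z)) = of_real (r ^ (n + k)) * \<kappa> z"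
      using \<kappa>_\<mu>[OF H_iter[OF \<kappa>_in_H[OF True], of n]] by (simp add: power_add mult_ac)
    then show ?thesis using iter_in_disc[OF True, of n] True by (simp add: iter_def)
  qed (simp add: iter_def)
qed

lemma iter_0: "f \<in> hardy p \<Longrightarrow> iter 0 f = f"
  by (auto simp: iter_def fun_eq_iff \<mu>_\<kappa> hardy_outside)

lemma \<kappa>_\<alpha>: "\<kappa> \<alpha> = 0" and \<mu>_0: "\<mu> 0 = \<alpha>"
  by (simp_all add: \<kappa>_def \<mu>_def)

lemma iter_\<alpha>: "iter n f \<alpha> = f \<alpha>"
  using \<alpha> by (simp add: iter_def \<kappa>_\<alpha> \<mu>_0)

lemma \<kappa>_holomorphic: "\<kappa> holomorphic_on ball 0 1"
  unfolding \<kappa>_def using \<omega>_minus(1) by (intro holomorphic_intros) auto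

lemma \<mu>_holomorphic: "\<mu> holomorphic_on H"
  unfolding \<mu>_def using H_nonzero by (intro holomorphic_intros) auto

lemma map_iter_holomorphic: "(\<lambda>z. \<mu> (of_real (r ^ n) * \<kappa> z)) holomorphic_on ball 0 1"
proof -
  have "(\<mu> \<circ> (\<lambda>z. of_real (r ^ n) * \<kappa> z)) holomorphic_on ball 0 1"
    using H_iter[OF \<kappa>_in_H]
    by (intro holomorphic_on_compose_gen[OF _ \<mu>_holomorphic] holomorphic_intros \<kappa>_holomorphic) auto
  then show ?thesis by (simp add: o_def)
qed

lemma iter_holomorphic:
  assumes "f holomorphic_on ball 0 1" shows "iter n f holomorphic_on ball 0 1"
proof (rule holomorphic_transform)
  show "(f \<circ> (\<lambda>z. \<mu> (of_real (r ^ n) * \<kappa> z))) holomorphic_on ball 0 1"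
    using iter_in_disc by (intro holomorphic_on_compose_gen[OF map_iter_holomorphic assms]) auto
qed (simp add: iter_def)

text \<open>After clearing denominators, an iterate is close to \<alpha> for small s unless the
  remaining denominator is small, that is, unless z is near \<omega>. The 4 bounds the product of
  |\<omega> - \<alpha>| and |z - \<alpha>|, each at most 2.\<close>

lemma \<mu>_minus_\<alpha>:
  assumes z: "z \<in> ball 0 1" and s: "0 < s" "s \<le> 1"
  shows "cmod (\<mu> (of_real s * \<kappa> z) - \<alpha>) \<le> 4 * s / cmod (\<omega> - s * \<alpha> - (1 - s) * z)"
proof -
  have nz: "\<omega> - z \<noteq> 0" using \<omega>_minus(1)[OF z] .
  have nz2: "1 + of_real s * \<kappa> z \<noteq> 0" using s by (intro H_nonzero H_scale \<kappa>_in_H z) auto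
  have 1: "1 + of_real s * \<kappa> z = (\<omega> - s * \<alpha> - (1 - s) * z) / (\<omega> - z)"
    unfolding \<kappa>_def using nz by (simp add: field_simps)
  have "\<mu> (of_real s * \<kappa> z) - \<alpha> = (\<omega> - \<alpha>) * (of_real s * \<kappa> z) / (1 + of_real s * \<kappa> z)"
    unfolding \<mu>_def using nz2 by (simp add: field_simps)
  also have "\<dots> = s * ((\<omega> - \<alpha>) * (z - \<alpha>)) / (\<omega> - s * \<alpha> - (1 - s) * z)"
    unfolding 1 using nz by (simp add: \<kappa>_def)
  finally have "cmod (\<mu> (of_real s * \<kappa> z) - \<alpha>) = s * (cmod (\<omega> - \<alpha>) * cmod (z - \<alpha>)) / cmod (\<omega> - s * \<alpha> - (1 - s) * z)"
    using s by (simp add: norm_mult norm_divide)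
  also have "\<dots> \<le> s * (2 * 2) / cmod (\<omega> - s * \<alpha> - (1 - s) * z)"
  proof -
    have "cmod (\<omega> - \<alpha>) \<le> 2" using norm_triangle_ineq4[of \<omega> \<alpha>] \<alpha> \<omega> by simp
    moreover have "cmod (z - \<alpha>) \<le> 2" using norm_triangle_ineq4[of z \<alpha>] \<alpha> z by simp
    ultimately show ?thesis using s by (intro divide_right_mono mult_left_mono mult_mono) auto
  qed
  finally show ?thesis by (simp add: mult.commute)
qed

text \<open>The left side decays only like an inverse distance from \<omega>, a Poisson kernel like
  an inverse square, so one kernel is taken for each scale \<open>r ^ j\<close>. If the denominator,
  divided by 1 - |\<alpha>|, lies between r ^ (j + 1) and r ^ j, then |\<omega> - (1 - r ^ j) z| is
  at most 2 r ^ j, and the j-th summand alone dominates.\<close>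

lemma inverse_denominator_le_sum:
  assumes z: "z \<in> ball 0 1"
  shows "1 / cmod (\<omega> - of_real (r ^ n) * \<alpha> - (1 - of_real (r ^ n)) * z)
    \<le> 4 / ((1 - cmod \<alpha>) * r) * (\<Sum>j\<le>n. r ^ j / (cmod (\<omega> - (1 - of_real (r ^ j)) * z))\<^sup>2)"
proof -
  define s where "s = r ^ n"
  define W where "W = cmod (\<omega> - of_real s * \<alpha> - (1 - of_real s) * z)"
  define a where "a = 1 - cmod \<alpha>"
  define v where "v = W / a"
  define g where "g = (\<lambda>j. r ^ j / (cmod (\<omega> - (1 - of_real (r ^ j)) * z))\<^sup>2)"
  have s: "0 < s" "s \<le> 1" unfolding s_def using r_power by auto
  have a: "0 < a" "a \<le> 1" unfolding a_def using \<alpha> by auto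
  have "cmod (of_real s * \<alpha> + (1 - of_real s) * z) \<le> s * cmod \<alpha> + (1 - s) * cmod z"
    using norm_triangle_ineq[of "of_real s * \<alpha>" "(1 - of_real s) * z"] s
    by (simp add: norm_mult cmod_one_minus_of_real)
  also have "\<dots> \<le> s * cmod \<alpha> + (1 - s) * 1" using z s by (intro add_left_mono mult_left_mono) auto
  also have "\<dots> = 1 - s * a" unfolding a_def by (simp add: algebra_simps)
  finally have sW: "s * a \<le> W"
    unfolding W_def using \<omega> norm_triangle_ineq2[of \<omega> "of_real s * \<alpha> + (1 - of_real s) * z"]
    by (simp add: algebra_simps)
  then have sv: "s \<le> v" unfolding v_def using a by (simp add: field_simps)
  have v: "0 < v" using sv s by simp
  have W: "W = a * v" unfolding v_def using a by simp
  have Wpos: "0 < W" unfolding W using a v by simp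
  have g0: "0 \<le> g j" for j unfolding g_def using r_power[of j] by auto
  have gsum: "g j \<le> (\<Sum>j\<le>n. g j)" if "j \<le> n" for j
    using g0 that by (intro member_le_sum) auto
  have "1 / W \<le> 4 / (a * r) * (\<Sum>j\<le>n. g j)"
  proof (cases "v < 1")
    \<comment> \<open>For denominators of size at least 1 - |\<alpha>| the summand j = 0 suffices;
      it equals 1 because |\<omega>| = 1.\<close>
    case False
    have "1 / W \<le> 1 / a" unfolding W using False a by (intro divide_left_mono) auto
    also have "\<dots> \<le> 4 / (a * r) * 1" using a r by (simp add: field_simps)
    also have "4 / (a * r) * 1 \<le> 4 / (a * r) * (\<Sum>j\<le>n. g j)"
    proof (rule mult_left_mono)
      have "1 = g 0" unfolding g_def using \<omega> by simp
      then show "1 \<le> (\<Sum>j\<le>n. g j)" using gsum[of 0] by simp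
    qed (use a r in auto)
    finally show ?thesis .
  next
    case True
    obtain j where j: "j \<le> n" "v \<le> r ^ j" "r * r ^ j \<le> v"
      using scale_between[of r n v] sv True unfolding s_def by blast
    define \<delta> where "\<delta> = r ^ j"
    have \<delta>: "0 < \<delta>" "\<delta> \<le> 1" "s \<le> \<delta>" unfolding \<delta>_def using r_power j sv by auto
    have "cmod (\<omega> - (1 - of_real \<delta>) * z) \<le> W + cmod (of_real s * \<alpha> + (of_real \<delta> - of_real s) * z)"
      unfolding W_def
      by (rule order_trans[OF _ norm_triangle_ineq]) (simp add: algebra_simps)
    also have "cmod (of_real s * \<alpha> + (of_real \<delta> - of_real s) * z) \<le> s * cmod \<alpha> + (\<delta> - s) * cmod z"
      using norm_triangle_ineq[of "of_real s * \<alpha>" "(of_real \<delta> - of_real s) * z"] s \<delta>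
      by (simp add: norm_mult cmod_of_real_diff)
    also have "s * cmod \<alpha> + (\<delta> - s) * cmod z \<le> s * 1 + (\<delta> - s) * 1"
      using z s \<delta> \<alpha> by (intro add_mono mult_left_mono) auto
    also have "W \<le> v" unfolding W using a v by simp
    also have "v \<le> \<delta>" using j by (simp add: \<delta>_def)
    finally have le: "cmod (\<omega> - (1 - of_real \<delta>) * z) \<le> 2 * \<delta>" by simp
    have "cmod ((1 - of_real \<delta>) * z) < 1"
    proof -
      have "cmod ((1 - of_real \<delta>) * z) = (1 - \<delta>) * cmod z"
        using \<delta> by (simp add: norm_mult cmod_one_minus_of_real)
      also have "\<dots> \<le> 1 * cmod z" using \<delta> by (intro mult_right_mono) auto
      finally show ?thesis using z by simp
    qed
    then have pos: "0 < cmod (\<omega> - (1 - of_real \<delta>) * z)" using \<omega> by auto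
    have "\<delta> / (2 * \<delta>)\<^sup>2 \<le> g j"
      unfolding g_def \<delta>_def[symmetric] using le pos \<delta> by (intro divide_left_mono power_mono mult_pos_pos) auto
    moreover have "\<delta> / (2 * \<delta>)\<^sup>2 = 1 / (4 * \<delta>)" using \<delta> by (simp add: power2_eq_square)
    ultimately have gj: "1 / (4 * \<delta>) \<le> g j" by simp
    have "1 / W \<le> 1 / (a * (r * \<delta>))"
      unfolding W using j a r \<delta> v by (intro divide_left_mono mult_left_mono) (auto simp: \<delta>_def)
    also have "\<dots> = 4 / (a * r) * (1 / (4 * \<delta>))" by simp
    also have "\<dots> \<le> 4 / (a * r) * g j" using gj a r by (intro mult_left_mono) auto
    also have "\<dots> \<le> 4 / (a * r) * (\<Sum>j\<le>n. g j)"
      using gsum[OF j(1)] a r by (intro mult_left_mono) auto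
    finally show ?thesis .
  qed
  then show ?thesis unfolding W_def a_def g_def s_def by simp
qed

text \<open>Iterates send radial points to such u: \<open>\<kappa>\<close> maps (1 - d) \<omega> to
  (1 - d - \<alpha> cnj \<omega>) / d, and x is r ^ n / d. As 1 - \<omega> cnj \<alpha> is the
  conjugate of 1 - \<alpha> cnj \<omega>, a squared modulus appears in \<open>level u\<close> and
  keeps it at least (1 - |\<alpha>|)^2. The 18 is 9 times 2, from |1 + u| \<le> 3 and 1 + |\<mu> u|
  \<le> 2.\<close>

lemma \<mu>_away_from_circle:
  fixes x d :: real
  assumes x: "0 \<le> x" "x \<le> 1" and d: "0 \<le> d" "d \<le> 1" and u: "u = of_real x * (1 - of_real d - \<alpha> * cnj \<omega>)"
  shows "1 - cmod (\<mu> u) \<ge> (1 - cmod \<alpha>)\<^sup>2 / 18"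
proof -
  define \<beta> where "\<beta> = \<alpha> * cnj \<omega>"
  have w: "\<omega> * cnj \<omega> = 1" using \<omega> by (simp add: complex_norm_square[symmetric])
  have \<beta>: "cmod \<beta> = cmod \<alpha>" unfolding \<beta>_def using \<omega> by (simp add: norm_mult)
  have cb: "1 - \<omega> * cnj \<alpha> = cnj (1 - \<beta>)" unfolding \<beta>_def by simp
  \<comment> \<open>In fact an equality, by expanding |1 - \<beta>|^2. It splits the loss caused by
    d into half of \<open>N\<close> and half of the constant term of \<open>level\<close>, so that
    both keep a nonnegative share.\<close>
  have Re1: "Re (1 - \<beta>) \<le> (cmod (1 - \<beta>))\<^sup>2 / 2 + (1 - (cmod \<alpha>)\<^sup>2) / 2"
    unfolding \<beta>[symmetric] cmod_power2 by (simp add: power2_eq_square field_simps)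
  have Re0: "0 \<le> Re (1 - \<beta>)" using complex_Re_le_cmod[of \<beta>] \<beta> \<alpha> by simp
  define N where "N = (cmod (1 - \<beta>))\<^sup>2"
  have "Re (u * (1 - \<omega> * cnj \<alpha>)) = x * Re ((1 - \<beta>) * cnj (1 - \<beta>) - of_real d * cnj (1 - \<beta>))"
    unfolding u cb \<beta>_def[symmetric] mult.assoc Re_of_real_mult by (simp add: algebra_simps)
  also have "(1 - \<beta>) * cnj (1 - \<beta>) = of_real N" unfolding N_def by (simp only: complex_norm_square)
  finally have Re: "Re (u * (1 - \<omega> * cnj \<alpha>)) = x * (N - d * Re (1 - \<beta>))" by simp
  have N: "(1 - cmod \<alpha>)\<^sup>2 \<le> N"
    unfolding N_def \<beta>[symmetric] using norm_triangle_ineq2[of 1 \<beta>] \<beta> \<alpha> by (intro power_mono) auto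
  have A: "(1 - cmod \<alpha>)\<^sup>2 \<le> 1 - (cmod \<alpha>)\<^sup>2"
  proof -
    have "(1 - cmod \<alpha>) * (1 - cmod \<alpha>) \<le> (1 - cmod \<alpha>) * (1 + cmod \<alpha>)"
      using \<alpha> by (intro mult_left_mono) auto
    then show ?thesis by (simp add: power2_eq_square algebra_simps)
  qed
  have "d * Re (1 - \<beta>) \<le> 1 * Re (1 - \<beta>)" using d Re0 by (intro mult_right_mono) auto
  then have "N / 2 - (1 - (cmod \<alpha>)\<^sup>2) / 2 \<le> N - d * Re (1 - \<beta>)"
    using Re1 unfolding N_def by linarith
  then have "x * (N / 2 - (1 - (cmod \<alpha>)\<^sup>2) / 2) \<le> x * (N - d * Re (1 - \<beta>))" using x by (intro mult_left_mono) auto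
  then have "(1 - x) * (1 - (cmod \<alpha>)\<^sup>2) + x * N \<le> level u"
    unfolding level_def Re by argo
  moreover have "(1 - x) * (1 - cmod \<alpha>)\<^sup>2 + x * (1 - cmod \<alpha>)\<^sup>2 \<le> (1 - x) * (1 - (cmod \<alpha>)\<^sup>2) + x * N"
    using x A N by (intro add_mono mult_left_mono) auto
  ultimately have lev: "(1 - cmod \<alpha>)\<^sup>2 \<le> level u" by (simp add: algebra_simps)
  then have uH: "u \<in> H" using \<alpha> unfolding H_def by (auto intro: less_le_trans[of _ "(1 - cmod \<alpha>)\<^sup>2"])
  have "cmod u \<le> 1 * 2"
  proof -
    have "cmod (1 - of_real d - \<beta>) \<le> cmod (1 - of_real d) + cmod \<beta>" by (rule norm_triangle_ineq4)
    also have "cmod (1 - of_real d) = 1 - d" using d by (simp add: cmod_one_minus_of_real)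
    finally have "cmod (1 - of_real d - \<beta>) \<le> 2" using \<beta> \<alpha> d by simp
    then show ?thesis unfolding u norm_mult \<beta>_def[symmetric] using x by (intro mult_mono) auto
  qed
  then have "cmod (1 + u) \<le> 3" using norm_triangle_ineq[of 1 u] by simp
  then have "(cmod (1 + u))\<^sup>2 \<le> 3\<^sup>2" by (intro power_mono) auto
  then have "(1 - cmod \<alpha>)\<^sup>2 / 9 \<le> level u / (cmod (1 + u))\<^sup>2"
    using lev H_nonzero[OF uH] order_trans[OF zero_le_power2 lev] by (intro frac_le) auto
  also have "\<dots> = (1 - cmod (\<mu> u)) * (1 + cmod (\<mu> u))"
    unfolding \<mu>_norm[OF uH, symmetric] by (simp add: power2_eq_square algebra_simps)
  also have "\<dots> \<le> (1 - cmod (\<mu> u)) * 2" using \<mu>_in_disc[OF uH] by (intro mult_left_mono) auto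
  finally show ?thesis by simp
qed

lemma divide_zero:
  assumes f: "f holomorphic_on ball 0 1" "f \<alpha> = 0"
  obtains h where "h holomorphic_on ball 0 1" "\<And>z. z \<in> ball 0 1 \<Longrightarrow> f z = (z - \<alpha>) * h z"
proof
  define h where "h = (\<lambda>z. if z = \<alpha> then deriv f \<alpha> else f z / (z - \<alpha>))"
  show "h holomorphic_on ball 0 1"
    by (rule pole_theorem_open_0[OF f(1), of \<alpha>]) (auto simp: h_def f(2))
  show "f z = (z - \<alpha>) * h z" if "z \<in> ball 0 1" for z
    using f(2) by (simp add: h_def)
qed

text \<open>On circles beyond the midpoint of |\<alpha>| and 1 the divisor z - \<alpha> has modulus
  at least (1 - |\<alpha>|) / 2, so division costs only a constant factor.\<close>

lemma quotient_mean_le: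
  assumes f: "f \<in> hardy p" and h: "h holomorphic_on ball 0 1" "\<And>z. z \<in> ball 0 1 \<Longrightarrow> f z = (z - \<alpha>) * h z"
    and R: "(1 + cmod \<alpha>) / 2 \<le> R" "0 < R" "R < 1"
  shows "hardy_mean p h R \<le> (2 / (1 - cmod \<alpha>)) powr p * hardy_norm p f powr p"
proof -
  have "hardy_mean p h R \<le> (2 / (1 - cmod \<alpha>)) powr p * hardy_mean p f R"
  proof (rule hardy_mean_mono[OF h(1) hardy_holomorphic[OF f] R(2,3)])
    fix z assume z: "cmod z = R"
    have "(1 - cmod \<alpha>) / 2 \<le> cmod z - cmod \<alpha>" using R(1) z by (simp add: field_simps)
    also have "\<dots> \<le> cmod (z - \<alpha>)" by (rule norm_triangle_ineq2)
    finally have "(1 - cmod \<alpha>) / 2 * cmod (h z) \<le> cmod (z - \<alpha>) * cmod (h z)" by (intro mult_right_mono) auto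
    also have "\<dots> = cmod (f z)" using h(2)[of z] z R by (simp add: norm_mult)
    finally have "cmod (h z) \<le> 2 / (1 - cmod \<alpha>) * cmod (f z)" using \<alpha> by (simp add: field_simps)
    then have "cmod (h z) powr p \<le> (2 / (1 - cmod \<alpha>) * cmod (f z)) powr p" using p by (intro powr_mono2) auto
    also have "\<dots> = (2 / (1 - cmod \<alpha>)) powr p * cmod (f z) powr p" using \<alpha> by (intro powr_mult)
    finally show "cmod (h z) powr p \<le> (2 / (1 - cmod \<alpha>)) powr p * cmod (f z) powr p" .
  qed (use p in auto)
  also have "\<dots> \<le> (2 / (1 - cmod \<alpha>)) powr p * hardy_norm p f powr p"
    using hardy_mean_le[OF f R(2,3)] p by (intro mult_left_mono) auto
  finally show ?thesis .
qed

text \<open>The pole R^2 (1 - d) \<omega> is chosen by reflection: since R^2 = z cnj z on the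
  circle, its difference from z factors as z \<omega> times the conjugate of \<omega> - (1 - d) z.
  With d = r ^ j this is exactly the j-th denominator of
  \<open>inverse_denominator_le_sum\<close>.\<close>

lemma poisson_kernel_at_radial_point:
  assumes z: "z = of_real R * cis t" and R: "0 < R" and d: "0 \<le> d" "d \<le> 1"
  shows "poisson_kernel R (of_real (R\<^sup>2 * (1 - d)) * \<omega>) t = (1 - R\<^sup>2 * (1 - d)\<^sup>2) / (cmod (\<omega> - (1 - of_real d) * z))\<^sup>2"
proof -
  have zz: "of_real (R\<^sup>2) = z * cnj z"
    unfolding z by (simp add: cis_cnj power2_eq_square mult.assoc[symmetric] cis_mult)
  have w: "\<omega> * cnj \<omega> = 1" using \<omega> by (simp add: complex_norm_square[symmetric])
  have "z - of_real (R\<^sup>2 * (1 - d)) * \<omega> = z * \<omega> * cnj (\<omega> - (1 - of_real d) * z)"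
    using w by (simp only: of_real_mult zz) (simp add: algebra_simps)
  then have "cmod (z - of_real (R\<^sup>2 * (1 - d)) * \<omega>) = R * cmod (\<omega> - (1 - of_real d) * z)"
    using R \<omega> by (simp add: norm_mult z del: complex_cnj_diff)
  moreover have "cmod (of_real (R\<^sup>2 * (1 - d)) * \<omega>) = R\<^sup>2 * (1 - d)"
    using d \<omega> by (simp add: norm_mult norm_of_real del: of_real_mult)
  ultimately have "poisson_kernel R (of_real (R\<^sup>2 * (1 - d)) * \<omega>) t
     = (R\<^sup>2 - (R\<^sup>2 * (1 - d))\<^sup>2) / (R * cmod (\<omega> - (1 - of_real d) * z))\<^sup>2"
    unfolding poisson_kernel_def z[symmetric] by simp
  also have "R\<^sup>2 - (R\<^sup>2 * (1 - d))\<^sup>2 = R\<^sup>2 * (1 - R\<^sup>2 * (1 - d)\<^sup>2)"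
    by (simp add: power2_eq_square algebra_simps)
  finally show ?thesis using R by (simp add: power_mult_distrib)
qed

text \<open>Split |\<psi> - \<alpha>| powr p into the power p - 1, bounded by a constant, and one
  factor bounded by 4 s / W, which supplies \<open>r ^ n\<close>. The n + 1 Poisson kernels
  dominating that factor are integrated one by one against |h o \<psi>| powr p; the integrals are
  bounded uniformly because \<psi> keeps the poles at a fixed distance from the circle.\<close>

lemma iter_mean_bound:
  assumes f: "f \<in> hardy p" "f \<alpha> = 0" and R: "0 < R" "R < 1"
  defines "C \<equiv> 2 powr (p - 1) * 4 * (4 / ((1 - cmod \<alpha>) * r)) * (4 * (2 / (1 - cmod \<alpha>)) powr p * 18 / (1 - cmod \<alpha>)\<^sup>2)"
  shows "hardy_mean p (iter n f) R \<le> C * real (n + 1) * r ^ n * hardy_norm p f powr p"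
proof -
  define s where "s = r ^ n"
  have s: "0 < s" "s \<le> 1" unfolding s_def using r_power by auto
  define \<psi> where "\<psi> = (\<lambda>z. \<mu> (of_real s * \<kappa> z))"
  have \<psi>: "\<psi> holomorphic_on ball 0 1" "\<psi> ` ball 0 1 \<subseteq> ball 0 1" "\<And>z. z \<in> ball 0 1 \<Longrightarrow> \<psi> z \<in> ball 0 1"
    unfolding \<psi>_def s_def using map_iter_holomorphic iter_in_disc by auto
  obtain h where h: "h holomorphic_on ball 0 1" "\<And>z. z \<in> ball 0 1 \<Longrightarrow> f z = (z - \<alpha>) * h z"
    using divide_zero[OF hardy_holomorphic[OF f(1)] f(2)] by blast
  define M where "M = (2 / (1 - cmod \<alpha>)) powr p * hardy_norm p f powr p"
  have M0: "0 \<le> M" unfolding M_def by simp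
  have M: "hardy_mean p h R' \<le> M" if "0 < R'" "(1 + cmod \<alpha>) / 2 \<le> R'" "R' < 1" for R'
    unfolding M_def using quotient_mean_le[OF f(1) h] that by simp
  define b where "b = (\<lambda>j. of_real (R\<^sup>2 * (1 - r ^ j)) * \<omega>)"
  define K where "K = 2 powr (p - 1) * 4 * s * (4 / ((1 - cmod \<alpha>) * r))"
  have K0: "0 \<le> K" unfolding K_def using s r \<alpha> by simp
  have R2: "R\<^sup>2 < R" using R by (simp add: power2_eq_square)
  have cb: "cmod (b j) = R\<^sup>2 * (1 - r ^ j)" for j
    unfolding b_def using \<omega> r_power[of j] by (simp add: norm_mult norm_of_real del: of_real_mult)
  have bR: "cmod (b j) < R" for j
  proof -
    have "cmod (b j) \<le> R\<^sup>2 * 1" unfolding cb using r_power[of j] by (intro mult_left_mono) auto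
    then show ?thesis using R2 by simp
  qed
  have \<psi>b: "1 - cmod (\<psi> (b j)) \<ge> (1 - cmod \<alpha>)\<^sup>2 / 18" if "j \<le> n" for j
  proof -
    \<comment> \<open>With this d, \<open>b j\<close> is (1 - d) \<omega> and s \<le> r ^ j \<le> d,
      so s / d is an admissible x in \<open>\<mu>_away_from_circle\<close>.\<close>
    define d where "d = 1 - R\<^sup>2 * (1 - r ^ j)"
    have "R\<^sup>2 * (1 - r ^ j) \<le> 1 * (1 - r ^ j)" using R r_power[of j] by (intro mult_right_mono) (auto simp: power_le_one)
    then have d1: "r ^ j \<le> d" unfolding d_def by simp
    have d2: "d \<le> 1" unfolding d_def using r_power[of j] by simp
    have "s \<le> r ^ j" unfolding s_def using that r by (intro power_decreasing) auto
    then have sd: "s \<le> d" using d1 by simp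
    have w: "\<omega> * cnj \<omega> = 1" using \<omega> by (simp add: complex_norm_square[symmetric])
    have bd: "b j = (1 - of_real d) * \<omega>" unfolding b_def d_def by simp
    have w0: "\<omega> \<noteq> 0" using \<omega> by auto
    have "\<kappa> (b j) = \<omega> * (1 - of_real d - \<alpha> * cnj \<omega>) / (\<omega> * of_real d)"
      unfolding \<kappa>_def bd using w by (simp add: algebra_simps)
    also have "\<dots> = (1 - of_real d - \<alpha> * cnj \<omega>) / of_real d" using w0 by simp
    finally have "of_real s * \<kappa> (b j) = of_real (s / d) * (1 - of_real d - \<alpha> * cnj \<omega>)" by simp
    then show ?thesis unfolding \<psi>_def using s sd d2 by (intro \<mu>_away_from_circle[of "s / d" d]) auto
  qed
  have ch: "continuous_on {0..2*pi} (\<lambda>t. cmod (h (\<psi> (of_real R * cis t))) powr p)"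
    using hardy_powr_continuous[of "h \<circ> \<psi>" R p] holomorphic_on_compose_gen[OF \<psi>(1) h(1) \<psi>(2)] R p by (simp add: o_def)
  have cP: "continuous_on {0..2*pi} (\<lambda>t. poisson_kernel R (b j) t * cmod (h (\<psi> (of_real R * cis t))) powr p)" for j
    by (intro continuous_on_mult continuous_on_poisson_kernel bR ch)
  have cI: "continuous_on {0..2*pi} (\<lambda>t. cmod (iter n f (of_real R * cis t)) powr p)"
    using iter_holomorphic[OF hardy_holomorphic[OF f(1)]] R p by (intro hardy_powr_continuous) auto
  have "integral {0..2*pi} (\<lambda>t. cmod (iter n f (of_real R * cis t)) powr p)
    \<le> integral {0..2*pi} (\<lambda>t. K * (\<Sum>j\<le>n. poisson_kernel R (b j) t * cmod (h (\<psi> (of_real R * cis t))) powr p))"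
  proof (intro integral_le integrable_continuous_real continuous_on_mult_left continuous_on_sum cI cP)
    fix t :: real
    define z where "z = of_real R * cis t"
    have zR: "cmod z = R" unfolding z_def using R by (simp add: norm_mult)
    have z: "z \<in> ball 0 1" using zR R by simp
    define W where "W = cmod (\<omega> - of_real s * \<alpha> - (1 - of_real s) * z)"
    have P: "r ^ j / (cmod (\<omega> - (1 - of_real (r ^ j)) * z))\<^sup>2 \<le> poisson_kernel R (b j) t" for j
    proof -
      have "R\<^sup>2 * (1 - r ^ j)\<^sup>2 \<le> 1 * (1 - r ^ j)"
        unfolding power2_eq_square[of "1 - r ^ j"] mult.assoc[symmetric]
        using R r_power[of j] by (intro mult_right_mono mult_le_one) (auto simp: power_le_one mult_le_one)
      then show ?thesis
        unfolding b_def poisson_kernel_at_radial_point[OF z_def R(1) less_imp_le[OF r_power(1)] r_power(2)]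
        by (intro divide_right_mono) auto
    qed
    have "cmod (\<psi> z - \<alpha>) \<le> 2" using norm_triangle_ineq4[of "\<psi> z" \<alpha>] \<psi>(3)[OF z] \<alpha> by simp
    then have "cmod (\<psi> z - \<alpha>) powr (p - 1) \<le> 2 powr (p - 1)" using p by (intro powr_mono2) auto
    moreover have "cmod (\<psi> z - \<alpha>) \<le> 4 * s * (1 / W)"
      using \<mu>_minus_\<alpha>[OF z s] unfolding \<psi>_def W_def by simp
    ultimately have "cmod (\<psi> z - \<alpha>) * cmod (\<psi> z - \<alpha>) powr (p - 1) \<le> (4 * s * (1 / W)) * 2 powr (p - 1)"
      using s unfolding W_def by (intro mult_mono) auto
    also have "\<dots> \<le> (4 * s * (4 / ((1 - cmod \<alpha>) * r) * (\<Sum>j\<le>n. poisson_kernel R (b j) t))) * 2 powr (p - 1)"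
    proof -
      have "1 / W \<le> 4 / ((1 - cmod \<alpha>) * r) * (\<Sum>j\<le>n. r ^ j / (cmod (\<omega> - (1 - of_real (r ^ j)) * z))\<^sup>2)"
        unfolding W_def s_def by (rule inverse_denominator_le_sum[OF z])
      also have "\<dots> \<le> 4 / ((1 - cmod \<alpha>) * r) * (\<Sum>j\<le>n. poisson_kernel R (b j) t)"
        using P \<alpha> r by (intro mult_left_mono sum_mono) auto
      finally show ?thesis using s by (intro mult_right_mono mult_left_mono) auto
    qed
    also have "\<dots> = K * (\<Sum>j\<le>n. poisson_kernel R (b j) t)" unfolding K_def by (simp add: mult_ac)
    finally have le: "cmod (\<psi> z - \<alpha>) powr p \<le> K * (\<Sum>j\<le>n. poisson_kernel R (b j) t)"
      using powr_minus_one_mult[of "cmod (\<psi> z - \<alpha>)" p] by simp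
    have "iter n f z = (\<psi> z - \<alpha>) * h (\<psi> z)"
      using z h(2)[OF \<psi>(3)[OF z]] by (simp add: iter_def \<psi>_def s_def)
    then have "cmod (iter n f z) powr p = cmod (\<psi> z - \<alpha>) powr p * cmod (h (\<psi> z)) powr p"
      by (simp add: norm_mult powr_mult)
    also have "\<dots> \<le> (K * (\<Sum>j\<le>n. poisson_kernel R (b j) t)) * cmod (h (\<psi> z)) powr p"
      using le by (intro mult_right_mono) auto
    finally show "cmod (iter n f (of_real R * cis t)) powr p \<le> K * (\<Sum>j\<le>n. poisson_kernel R (b j) t * cmod (h (\<psi> (of_real R * cis t))) powr p)"
      unfolding z_def[symmetric] by (simp only: mult.assoc sum_distrib_right)
  qed
  also have "\<dots> = K * (\<Sum>j\<le>n. integral {0..2*pi} (\<lambda>t. poisson_kernel R (b j) t * cmod (h (\<psi> (of_real R * cis t))) powr p))"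
    by (simp add: integral_sum integrable_continuous_real cP)
  also have "\<dots> \<le> K * (\<Sum>j\<le>n. 2 * pi * (4 * M * 18 / (1 - cmod \<alpha>)\<^sup>2))"
  proof (intro mult_left_mono sum_mono K0)
    fix j assume "j \<in> {..n}"
    then have j: "j \<le> n" by simp
    have "integral {0..2*pi} (\<lambda>t. poisson_kernel R (b j) t * cmod (h (\<psi> (of_real R * cis t))) powr p) / (2 * pi)
      \<le> 4 * M / (1 - cmod (\<psi> (b j)))"
      using \<alpha> by (intro poisson_composition_bound[OF h(1) p \<psi>(1,2) R(2) bR, of "(1 + cmod \<alpha>) / 2"] M) auto
    also have "\<dots> \<le> 4 * M / ((1 - cmod \<alpha>)\<^sup>2 / 18)"
    proof (rule divide_left_mono[OF \<psi>b[OF j]])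
      have "0 < (1 - cmod \<alpha>)\<^sup>2 / 18" using \<alpha> by simp
      moreover from this have "0 < 1 - cmod (\<psi> (b j))" using \<psi>b[OF j] by linarith
      ultimately show "0 < (1 - cmod (\<psi> (b j))) * ((1 - cmod \<alpha>)\<^sup>2 / 18)" by (intro mult_pos_pos)
    qed (use M0 in auto)
    finally show "integral {0..2*pi} (\<lambda>t. poisson_kernel R (b j) t * cmod (h (\<psi> (of_real R * cis t))) powr p)
      \<le> 2 * pi * (4 * M * 18 / (1 - cmod \<alpha>)\<^sup>2)"
      by (simp add: pos_divide_le_eq mult_ac)
  qed
  also have "\<dots> = C * real (n + 1) * r ^ n * hardy_norm p f powr p * (2 * pi)"
    unfolding K_def C_def M_def s_def by simp
  finally show ?thesis unfolding hardy_mean_def by (simp only: pos_divide_le_eq[of "2 * pi"] pi_gt_zero zero_less_mult_iff zero_less_numeral simp_thms)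
qed

lemma \<rho>\<^sub>0: "0 < \<rho>\<^sub>0" "\<rho>\<^sub>0 < 1" "r < \<rho>\<^sub>0"
proof -
  show "0 < \<rho>\<^sub>0" using r by (simp add: \<rho>\<^sub>0_def)
  show "\<rho>\<^sub>0 < 1" using r p powr_less_mono2[of "1 / p" r 1] by (simp add: \<rho>\<^sub>0_def)
  show "r < \<rho>\<^sub>0" using r p powr_less_mono'[of r "1 / p" 1] by (simp add: \<rho>\<^sub>0_def)
qed

lemma iter_norm_bound:
  obtains C where "0 < C"
    "\<And>n f. f \<in> hardy p \<Longrightarrow> f \<alpha> = 0 \<Longrightarrow> iter n f \<in> hardy p"
    "\<And>n f. f \<in> hardy p \<Longrightarrow> f \<alpha> = 0 \<Longrightarrow> hardy_norm p (iter n f) \<le> C * real (n + 1) * \<rho>\<^sub>0 ^ n * hardy_norm p f"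
proof -
  define C where "C = 2 powr (p - 1) * 4 * (4 / ((1 - cmod \<alpha>) * r)) * (4 * (2 / (1 - cmod \<alpha>)) powr p * 18 / (1 - cmod \<alpha>)\<^sup>2)"
  have C: "0 < C" unfolding C_def using \<alpha> r by simp
  define D where "D = C powr (1 / p)"
  have D: "0 < D" "D powr p = C" unfolding D_def using C p by (simp_all add: powr_powr)
  have *: "iter n f \<in> hardy p \<and> hardy_norm p (iter n f) \<le> D * real (n + 1) * \<rho>\<^sub>0 ^ n * hardy_norm p f"
    if f: "f \<in> hardy p" "f \<alpha> = 0" for n f
  proof -
    have "\<rho>\<^sub>0 ^ n = (r ^ n) powr (1 / p)"
      unfolding \<rho>\<^sub>0_def using r by (simp add: powr_powr powr_realpow[symmetric] mult.commute)
    then have rn: "(\<rho>\<^sub>0 ^ n) powr p = r ^ n" using p r by (simp add: powr_powr)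
    \<comment> \<open>Enlarging n + 1 to its p-th power makes the p-th root leave a linear factor,
      which does not affect the rate \<open>\<rho>\<^sub>0\<close>.\<close>
    have n1: "real (n + 1) \<le> real (n + 1) powr p" using p powr_mono[of 1 p "real (n + 1)"] by simp
    have B0: "0 \<le> D * real (n + 1) * \<rho>\<^sub>0 ^ n * hardy_norm p f"
      using D \<rho>\<^sub>0 hardy_norm_nonneg by (intro mult_nonneg_nonneg) auto
    have "hardy_mean p (iter n f) R \<le> (D * real (n + 1) * \<rho>\<^sub>0 ^ n * hardy_norm p f) powr p" if R: "0 < R" "R < 1" for R
    proof -
      have "hardy_mean p (iter n f) R \<le> C * real (n + 1) * r ^ n * hardy_norm p f powr p"
        unfolding C_def by (rule iter_mean_bound[OF f R])
      also have "\<dots> \<le> C * real (n + 1) powr p * r ^ n * hardy_norm p f powr p"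
        using n1 C r by (intro mult_right_mono mult_left_mono) auto
      also have "\<dots> = (D * real (n + 1) * \<rho>\<^sub>0 ^ n * hardy_norm p f) powr p"
        using D \<rho>\<^sub>0 hardy_norm_nonneg[of p f] rn by (simp add: powr_mult)
      finally show ?thesis .
    qed
    then show ?thesis using hardyI[OF iter_holomorphic[OF hardy_holomorphic[OF f(1)]] _ B0, of n p] p
      by (auto simp: iter_def)
  qed
  show ?thesis using that[OF D(1)] * by blast
qed

text \<open>Constants on the disc are fixed by \<open>iter\<close>; subtracting the value at
  \<alpha> reduces to \<open>iter_norm_bound\<close>.\<close>

lemma iter_hardy: assumes f: "f \<in> hardy p" shows "iter n f \<in> hardy p"
proof -
  define c where "c = (\<lambda>z::complex. if z \<in> ball 0 1 then f \<alpha> else 0)"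
  have c: "c \<in> hardy p" unfolding c_def using p by (intro disc_const_hardy) auto
  have "(\<lambda>z. f z - c z) \<in> hardy p" using f c p by (intro hardy_diff)
  moreover have "f \<alpha> - c \<alpha> = 0" using \<alpha> by (simp add: c_def)
  ultimately have "iter n (\<lambda>z. f z - c z) \<in> hardy p" using iter_norm_bound by blast
  from hardy_add(1)[OF this c p] show ?thesis
    by (rule back_subst[of "\<lambda>h. h \<in> hardy p"]) (use iter_in_disc in \<open>auto simp: iter_def c_def fun_eq_iff\<close>)
qed

end

section \<open>The resolvent outside the disc\<close>

lemma hardy_growth_mono:
  assumes f: "f \<in> hardy p" and p: "1 < p" and w: "cmod w \<le> R" "R < 1" and B: "hardy_norm p f \<le> B"
  shows "cmod (f w) \<le> (4 / (1 - R)) powr (1 / p) * B"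
proof -
  have "cmod (f w) \<le> (4 / (1 - cmod w)) powr (1 / p) * hardy_norm p f"
    using w by (intro hardy_growth[OF f p]) auto
  also have "\<dots> \<le> (4 / (1 - R)) powr (1 / p) * B"
    using w p B hardy_norm_nonneg by (intro mult_mono powr_mono2 divide_left_mono) auto
  finally show ?thesis .
qed

text \<open>On each circle the growth estimate dominates all the functions by one constant, so the
  means converge. This plays the part of completeness when the Neumann series is summed
  pointwise.\<close>

lemma hardy_pointwise_limit:
  assumes f: "\<And>n. f n \<in> hardy p" "\<And>n. hardy_norm p (f n) \<le> B" and p: "1 < p"
    and g: "g holomorphic_on ball 0 1" "\<And>z. z \<notin> ball 0 1 \<Longrightarrow> g z = 0"
    and lim: "\<And>z. z \<in> ball 0 1 \<Longrightarrow> (\<lambda>n. f n z) \<longlonglongrightarrow> g z"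
  shows "g \<in> hardy p" "hardy_norm p g \<le> B"
proof -
  have B: "0 \<le> B" using order_trans[OF hardy_norm_nonneg f(2)] .
  have *: "hardy_mean p g R \<le> B powr p" if R: "0 < R" "R < 1" for R
  proof -
    define D where "D = ((4 / (1 - R)) powr (1 / p) * B) powr p"
    have cR: "cmod (of_real R * cis t) = R" for t using R by (simp add: norm_mult)
    have "(\<lambda>n. integral {0..2*pi} (\<lambda>t. cmod (f n (of_real R * cis t)) powr p)) \<longlonglongrightarrow> integral {0..2*pi} (\<lambda>t. cmod (g (of_real R * cis t)) powr p)"
    proof (rule dominated_convergence(2))
      show "(\<lambda>t. cmod (f n (of_real R * cis t)) powr p) integrable_on {0..2*pi}" for n
        using hardy_holomorphic[OF f(1)[of n]] R p by (intro integrable_continuous_real hardy_powr_continuous) auto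
      show "(\<lambda>t. D) integrable_on {0..2*pi}" by (rule integrable_const_ivl)
      show "norm (cmod (f n (of_real R * cis t)) powr p) \<le> D" for n t
        unfolding D_def using hardy_growth_mono[OF f(1) p _ R(2) f(2), of "of_real R * cis t"] cR p
        by (auto intro!: powr_mono2)
      show "(\<lambda>n. cmod (f n (of_real R * cis t)) powr p) \<longlonglongrightarrow> cmod (g (of_real R * cis t)) powr p" for t
        using lim[of "of_real R * cis t"] cR R p by (intro tendsto_powr' tendsto_norm tendsto_const) auto
    qed
    from tendsto_divide[OF this tendsto_const[of "2 * pi"]]
    have "(\<lambda>n. hardy_mean p (f n) R) \<longlonglongrightarrow> hardy_mean p g R" by (simp add: hardy_mean_def)
    moreover have "hardy_mean p (f n) R \<le> B powr p" for n
    proof -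
      have "hardy_mean p (f n) R \<le> hardy_norm p (f n) powr p" using f R p by (intro hardy_mean_le) auto
      also have "\<dots> \<le> B powr p" using f(2) p hardy_norm_nonneg by (intro powr_mono2) auto
      finally show ?thesis .
    qed
    ultimately show ?thesis by (intro LIMSEQ_le_const2) auto
  qed
  show "g \<in> hardy p" "hardy_norm p g \<le> B" using hardyI[OF g B *] p by auto
qed

text \<open>Local solutions add up on the intersection of their domains. This allows a function to
  be split into a constant and a part vanishing at \<alpha>.\<close>

lemma local_spectrum_add:
  assumes p: "1 < p"
    and T: "\<And>f g. T (\<lambda>z. f z + g z) = (\<lambda>z. T f z + T g z)"
    and x: "w \<notin> local_spectrum (hardy p) (hardy_norm p) T x" and y: "w \<notin> local_spectrum (hardy p) (hardy_norm p) T y"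
  shows "w \<notin> local_spectrum (hardy p) (hardy_norm p) T (\<lambda>z. x z + y z)"
proof -
  obtain U F where F: "open U" "w \<in> U" "vholo_on (hardy p) (hardy_norm p) U F" "\<And>z. z \<in> U \<Longrightarrow> (\<lambda>a. T (F z) a - z * F z a) = x"
    using x unfolding local_spectrum_def by auto
  obtain V G where G: "open V" "w \<in> V" "vholo_on (hardy p) (hardy_norm p) V G" "\<And>z. z \<in> V \<Longrightarrow> (\<lambda>a. T (G z) a - z * G z a) = y"
    using y unfolding local_spectrum_def by auto
  have "vholo_on (hardy p) (hardy_norm p) (U \<inter> V) (\<lambda>z a. F z a + G z a)"
    unfolding vholo_on_def
  proof (intro conjI ballI)
    show "open (U \<inter> V)" using F G by auto
    fix z assume z: "z \<in> U \<inter> V"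
    show "(\<lambda>a. F z a + G z a) \<in> hardy p" using z F(3) G(3) p by (intro hardy_add) (auto simp: vholo_on_def)
    obtain F' where F': "F' \<in> hardy p" "((\<lambda>w. hardy_norm p (\<lambda>a. (F w a - F z a) / (w - z) - F' a)) \<longlongrightarrow> 0) (at z)"
      using F(3) z unfolding vholo_on_def by blast
    obtain G' where G': "G' \<in> hardy p" "((\<lambda>w. hardy_norm p (\<lambda>a. (G w a - G z a) / (w - z) - G' a)) \<longlongrightarrow> 0) (at z)"
      using G(3) z unfolding vholo_on_def by blast
    have ev: "eventually (\<lambda>w. w \<in> U \<inter> V) (at z)"
      using F(1) G(1) z by (intro eventually_at_in_open') auto
    have "((\<lambda>w. hardy_norm p (\<lambda>a. (F w a + G w a - (F z a + G z a)) / (w - z) - (F' a + G' a))) \<longlongrightarrow> 0) (at z)"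
    proof (rule tendsto_0_le[OF tendsto_add_zero[OF F'(2) G'(2)], of _ 1])
      show "\<forall>\<^sub>F w in at z. norm (hardy_norm p (\<lambda>a. (F w a + G w a - (F z a + G z a)) / (w - z) - (F' a + G' a)))
        \<le> norm (hardy_norm p (\<lambda>a. (F w a - F z a) / (w - z) - F' a) + hardy_norm p (\<lambda>a. (G w a - G z a) / (w - z) - G' a)) * 1"
        using ev
      proof eventually_elim
        case (elim w)
        have eq: "(\<lambda>a. (F w a + G w a - (F z a + G z a)) / (w - z) - (F' a + G' a))
          = (\<lambda>a. ((F w a - F z a) / (w - z) - F' a) + ((G w a - G z a) / (w - z) - G' a))"
          by (simp add: fun_eq_iff add_divide_distrib diff_divide_distrib)
        have q: "(\<lambda>a. (A w a - A z a) / (w - z) - A' a) \<in> hardy p"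
          if "A w \<in> hardy p" "A z \<in> hardy p" "A' \<in> hardy p" for A A'
          using hardy_diff(1)[OF hardy_scale(1)[OF hardy_diff(1)[OF that(1,2) p], of "1 / (w - z)"] that(3) p] p by simp
        have "hardy_norm p (\<lambda>a. ((F w a - F z a) / (w - z) - F' a) + ((G w a - G z a) / (w - z) - G' a))
          \<le> hardy_norm p (\<lambda>a. (F w a - F z a) / (w - z) - F' a) + hardy_norm p (\<lambda>a. (G w a - G z a) / (w - z) - G' a)"
          using elim z F(3) G(3) F'(1) G'(1) p by (intro hardy_add q) (auto simp: vholo_on_def)
        then show ?case unfolding eq using hardy_norm_nonneg by simp
      qed
    qed
    then show "\<exists>H\<in>hardy p. ((\<lambda>w. hardy_norm p (\<lambda>a. (F w a + G w a - (F z a + G z a)) / (w - z) - H a)) \<longlongrightarrow> 0) (at z)"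
      using hardy_add(1)[OF F'(1) G'(1) p] by (rule bexI[of _ "\<lambda>a. F' a + G' a"])
  qed
  moreover have "(\<lambda>a. T (\<lambda>a. F z a + G z a) a - z * (F z a + G z a)) = (\<lambda>z. x z + y z)" if "z \<in> U \<inter> V" for z
  proof
    fix a
    have "T (F z) a - z * F z a = x a" "T (G z) a - z * G z a = y a"
      using F(4)[of z] G(4)[of z] that by (auto dest: fun_cong)
    then show "T (\<lambda>a. F z a + G z a) a - z * (F z a + G z a) = x a + y a"
      unfolding T by (simp add: algebra_simps)
  qed
  moreover have "open (U \<inter> V)" "w \<in> U \<inter> V" using F G by auto
  ultimately show ?thesis unfolding local_spectrum_def ComplD Compl_iff mem_Collect_eq
    using not_not by (auto intro!: exI[of _ "U \<inter> V"] exI[of _ "\<lambda>z a. F z a + G z a"])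
qed

section \<open>The resolvent as a Neumann series\<close>

context second_kind
begin

text \<open>The Neumann series for the inverse of the composition operator minus l, summed
  pointwise; membership in H^p is established afterwards.\<close>

definition res :: "complex \<Rightarrow> (complex \<Rightarrow> complex) \<Rightarrow> complex \<Rightarrow> complex" where
  "res l f z = - (\<Sum>n. (1 / l) ^ Suc n * iter n f z)"

lemma geometric_weight_sums:
  assumes "\<rho>\<^sub>0 < \<rho>1"
  shows "(\<lambda>n. (1 / \<rho>1) ^ Suc n * (C * real (n + 1) * \<rho>\<^sub>0 ^ n * B)) sums (C / \<rho>1 / (1 - \<rho>\<^sub>0 / \<rho>1)\<^sup>2 * B)"
proof -
  have "norm (\<rho>\<^sub>0 / \<rho>1) < 1" using assms \<rho>\<^sub>0 by simp
  from sums_mult[OF geometric_deriv_sums[OF this], of "C / \<rho>1 * B"]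
  have "(\<lambda>n. C / \<rho>1 * B * (real (Suc n) * (\<rho>\<^sub>0 / \<rho>1) ^ n)) sums (C / \<rho>1 * B * (1 / (1 - \<rho>\<^sub>0 / \<rho>1)\<^sup>2))" by simp
  moreover have "(\<lambda>n. C / \<rho>1 * B * (real (Suc n) * (\<rho>\<^sub>0 / \<rho>1) ^ n)) = (\<lambda>n. (1 / \<rho>1) ^ Suc n * (C * real (n + 1) * \<rho>\<^sub>0 ^ n * B))"
    by (simp add: power_divide fun_eq_iff)
  moreover have "C / \<rho>1 * B * (1 / (1 - \<rho>\<^sub>0 / \<rho>1)\<^sup>2) = C / \<rho>1 / (1 - \<rho>\<^sub>0 / \<rho>1)\<^sup>2 * B" by simp
  ultimately show ?thesis by simp
qed

text \<open>The partial sums are bounded in norm by a convergent series of weights and converge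
  locally uniformly by the growth estimate; the equation is an index shift. That \<open>K\<close>
  serves all |l| \<ge> \<rho>1 at once is what makes the difference quotients in l converge
  later.\<close>

lemma res_properties:
  assumes "\<rho>\<^sub>0 < \<rho>1"
  shows "\<exists>K\<ge>0. \<forall>l f. \<rho>1 \<le> cmod l \<longrightarrow> f \<in> hardy p \<longrightarrow> f \<alpha> = 0 \<longrightarrow>
    res l f \<in> hardy p \<and> res l f \<alpha> = 0 \<and> hardy_norm p (res l f) \<le> K * hardy_norm p f \<and>
    (\<forall>z. iter 1 (res l f) z - l * res l f z = f z)"
proof -
  obtain C where C: "0 < C" "\<And>n f. f \<in> hardy p \<Longrightarrow> f \<alpha> = 0 \<Longrightarrow> iter n f \<in> hardy p"
    "\<And>n f. f \<in> hardy p \<Longrightarrow> f \<alpha> = 0 \<Longrightarrow> hardy_norm p (iter n f) \<le> C * real (n + 1) * \<rho>\<^sub>0 ^ n * hardy_norm p f"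
    using iter_norm_bound by blast
  define K where "K = C / \<rho>1 / (1 - \<rho>\<^sub>0 / \<rho>1)\<^sup>2"
  have \<rho>1: "0 < \<rho>1" using \<rho>\<^sub>0 assms by simp
  have K: "0 \<le> K" unfolding K_def using C \<rho>1 by simp
  have *: "res l f \<in> hardy p \<and> res l f \<alpha> = 0 \<and> hardy_norm p (res l f) \<le> K * hardy_norm p f \<and>
    (\<forall>z. iter 1 (res l f) z - l * res l f z = f z)"
    if l: "\<rho>1 \<le> cmod l" and f: "f \<in> hardy p" "f \<alpha> = 0" for l f
  proof -
    define M where "M = (\<lambda>n. (1 / \<rho>1) ^ Suc n * (C * real (n + 1) * \<rho>\<^sub>0 ^ n * hardy_norm p f))"
    have M: "M sums (K * hardy_norm p f)" unfolding M_def K_def by (rule geometric_weight_sums[OF assms])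
    have M0: "0 \<le> M n" for n unfolding M_def using C \<rho>1 \<rho>\<^sub>0 hardy_norm_nonneg[of p f] by simp
    define t where "t = (\<lambda>n z. - ((1 / l) ^ Suc n) * iter n f z)"
    have l0: "l \<noteq> 0" using l \<rho>1 by auto
    have t_hardy: "t n \<in> hardy p" and t_norm: "hardy_norm p (t n) \<le> M n" for n
    proof -
      show "t n \<in> hardy p" unfolding t_def using C(2)[OF f] p by (intro hardy_scale) auto
      have "hardy_norm p (t n) \<le> cmod (- ((1 / l) ^ Suc n)) * hardy_norm p (iter n f)"
        unfolding t_def using C(2)[OF f] p by (intro hardy_scale(2)) auto
      also have "\<dots> \<le> (1 / \<rho>1) ^ Suc n * (C * real (n + 1) * \<rho>\<^sub>0 ^ n * hardy_norm p f)"
      proof (intro mult_mono C(3)[OF f])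
        have "cmod (- ((1 / l) ^ Suc n)) = (1 / cmod l) ^ Suc n" by (simp add: norm_power norm_divide norm_mult)
        also have "\<dots> \<le> (1 / \<rho>1) ^ Suc n" using l \<rho>1 by (intro power_mono frac_le) auto
        finally show "cmod (- ((1 / l) ^ Suc n)) \<le> (1 / \<rho>1) ^ Suc n" .
      qed (use \<rho>1 hardy_norm_nonneg in auto)
      finally show "hardy_norm p (t n) \<le> M n" unfolding M_def .
    qed
    have t_pt: "cmod (t n z) \<le> (4 / (1 - R)) powr (1 / p) * M n" if "cmod z \<le> R" "R < 1" for n z R
      using hardy_growth_mono[OF t_hardy p that t_norm] .
    have sumM: "summable (\<lambda>n. c * M n)" for c using sums_summable[OF M] by (rule summable_mult)
    have summ: "summable (\<lambda>n. t n z)" if "z \<in> ball 0 1" for z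
      using that by (intro summable_comparison_test'[OF sumM[of "(4 / (1 - cmod z)) powr (1 / p)"]] t_pt) auto
    have res_t: "res l f z = (\<Sum>n. t n z)" if "z \<in> ball 0 1" for z
    proof -
      have "(\<lambda>n. - t n z) = (\<lambda>n. (1 / l) ^ Suc n * iter n f z)" by (simp add: t_def)
      then show ?thesis unfolding res_def using suminf_minus[OF summ[OF that]] by simp
    qed
    have out: "res l f z = 0" if "z \<notin> ball 0 1" for z
      using that by (simp add: res_def iter_def)
    define S where "S = (\<lambda>N z. \<Sum>n<N. t n z)"
    have S: "S N \<in> hardy p" "hardy_norm p (S N) \<le> K * hardy_norm p f" for N
    proof -
      show "S N \<in> hardy p" unfolding S_def using t_hardy p by (intro hardy_sum) auto
      have "hardy_norm p (S N) \<le> (\<Sum>n<N. hardy_norm p (t n))" unfolding S_def using t_hardy p by (intro hardy_sum) auto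
      also have "\<dots> \<le> (\<Sum>n<N. M n)" by (intro sum_mono t_norm)
      also have "\<dots> \<le> suminf M" using M0 sums_summable[OF M] by (intro sum_le_suminf) auto
      also have "\<dots> = K * hardy_norm p f" using M by (rule sums_unique[symmetric])
      finally show "hardy_norm p (S N) \<le> K * hardy_norm p f" .
    qed
    have lim: "(\<lambda>N. S N z) \<longlonglongrightarrow> res l f z" if "z \<in> ball 0 1" for z
      unfolding S_def res_t[OF that] by (rule summable_LIMSEQ[OF summ[OF that]])
    have hol: "res l f holomorphic_on ball 0 1"
    proof (rule holomorphic_uniform_sequence[OF open_ball])
      show "S N holomorphic_on ball 0 1" for N by (rule hardy_holomorphic[OF S(1)])
      fix x :: complex assume x: "x \<in> ball 0 1"
      define d where "d = (1 - cmod x) / 2"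
      have sub: "cmod z \<le> (1 + cmod x) / 2" if "z \<in> cball x d" for z
      proof -
        have "cmod z \<le> cmod x + cmod (z - x)" using norm_triangle_sub by blast
        also have "cmod (z - x) \<le> d" using that by (simp add: dist_norm norm_minus_commute)
        finally show ?thesis unfolding d_def by (simp add: field_simps)
      qed
      have x1: "(1 + cmod x) / 2 < 1" using x by simp
      have "uniform_limit (cball x d) (\<lambda>N z. \<Sum>n<N. t n z) (\<lambda>z. \<Sum>n. t n z) sequentially"
        using t_pt[OF sub x1] sumM by (intro Weierstrass_m_test[of _ _ "\<lambda>n. (4 / (1 - (1 + cmod x) / 2)) powr (1 / p) * M n"]) auto
      moreover have ball: "cball x d \<subseteq> ball 0 1"
      proof
        fix z assume "z \<in> cball x d"
        from sub[OF this] x1 show "z \<in> ball 0 1" by simp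
      qed
      ultimately have "uniform_limit (cball x d) S (res l f) sequentially"
        unfolding S_def using res_t by (subst uniform_limit_cong'[where g = "\<lambda>N z. \<Sum>n<N. t n z" and i = "\<lambda>z. \<Sum>n. t n z"]) auto
      moreover have "0 < d" using x by (simp add: d_def)
      ultimately show "\<exists>d>0. cball x d \<subseteq> ball 0 1 \<and> uniform_limit (cball x d) S (res l f) sequentially"
        using ball by blast
    qed
    have 1: "res l f \<in> hardy p" "hardy_norm p (res l f) \<le> K * hardy_norm p f"
      using hardy_pointwise_limit[OF S p hol out lim] by auto
    have 2: "res l f \<alpha> = 0" by (simp add: res_def iter_\<alpha> f)
    have 3: "iter 1 (res l f) z - l * res l f z = f z" for z
    proof (cases "z \<in> ball 0 1")
      case True
      define z' where "z' = \<mu> (of_real r * \<kappa> z)"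
      have z': "z' \<in> ball 0 1" unfolding z'_def using iter_in_disc[OF True, of 1] by simp
      have e: "iter n f z' = iter (Suc n) f z" for n
      proof -
      have "iter n f z' = iter 1 (iter n f) z" using True unfolding iter_def[of 1] z'_def by simp
      then show ?thesis using iter_iter[of 1 n f] by simp
    qed
      have "t n z' = l * t (Suc n) z" for n
        unfolding t_def e using l0 by simp
      then have "res l f z' = (\<Sum>n. l * t (Suc n) z)" using res_t[OF z'] by simp
      also have "\<dots> = l * (\<Sum>n. t (Suc n) z)"
        using summ[OF True] summable_Suc_iff[of "\<lambda>n. t n z"] by (intro suminf_mult) auto
      also have "(\<Sum>n. t (Suc n) z) = res l f z - t 0 z"
        unfolding res_t[OF True] using suminf_split_head[OF summ[OF True]] by simp
      finally have "res l f z' - l * res l f z = - l * t 0 z" by (simp add: algebra_simps)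
      also have "\<dots> = f z" unfolding t_def using l0 iter_0[OF f(1)] by simp
      finally show ?thesis using True by (simp add: iter_def z'_def)
    next
      case False
      then show ?thesis using out hardy_outside[OF f(1)] by (simp add: iter_def)
    qed
    show ?thesis using 1 2 3 by blast
  qed
  show ?thesis using K * by blast
qed

lemma
  assumes "\<rho>\<^sub>0 < cmod l" "f \<in> hardy p" "f \<alpha> = 0"
  shows res_hardy: "res l f \<in> hardy p" and res_\<alpha>: "res l f \<alpha> = 0"
    and iter_res: "iter 1 (res l f) z - l * res l f z = f z"
  using res_properties[OF assms(1)] assms by auto

text \<open>For an eigenvector, l ^ n x is the n-th iterate of x, hence of size at most a constant
  times n \<open>\<rho>\<^sub>0 ^ n\<close> at each point; as |l| exceeds
  \<open>\<rho>\<^sub>0\<close>, dividing by l ^ n leaves 0.\<close>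

lemma iter_injective:
  assumes x: "x \<in> hardy p" "x \<alpha> = 0" and l: "\<rho>\<^sub>0 < cmod l" and eq: "\<And>z. iter 1 x z = l * x z"
  shows "x z = 0"
proof (cases "z \<in> ball 0 1")
  case True
  obtain C where C: "0 < C" "\<And>n f. f \<in> hardy p \<Longrightarrow> f \<alpha> = 0 \<Longrightarrow> iter n f \<in> hardy p"
    "\<And>n f. f \<in> hardy p \<Longrightarrow> f \<alpha> = 0 \<Longrightarrow> hardy_norm p (iter n f) \<le> C * real (n + 1) * \<rho>\<^sub>0 ^ n * hardy_norm p f"
    using iter_norm_bound by blast
  have l0: "0 < cmod l" using l \<rho>\<^sub>0 by linarith
  have pow: "iter n x z = l ^ n * x z" for n and z
  proof (induction n arbitrary: z)
    case 0 then show ?case using iter_0[OF x(1)] by simp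
  next
    case (Suc n)
    have "iter (Suc n) x z = iter 1 (iter n x) z" using iter_iter[of 1 n x] by simp
    also have "iter n x = (\<lambda>z. l ^ n * x z)" using Suc.IH by blast
    also have "iter 1 \<dots> z = l ^ n * iter 1 x z" by (simp add: iter_def)
    also have "iter 1 x z = l * x z" by (rule eq)
    finally show ?case by simp
  qed
  define G where "G = (4 / (1 - cmod z)) powr (1 / p)"
  \<comment> \<open>Arranged as a multiple of the summand in \<open>geometric_weight_sums\<close>,
    whose summability gives the limit 0.\<close>
  have bnd: "cmod (x z) \<le> G * cmod l * ((1 / cmod l) ^ Suc n * (C * real (n + 1) * \<rho>\<^sub>0 ^ n * hardy_norm p x))" for n
  proof -
    have "cmod (iter n x z) \<le> G * (C * real (n + 1) * \<rho>\<^sub>0 ^ n * hardy_norm p x)"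
      unfolding G_def using True by (intro hardy_growth_mono[OF C(2)[OF x] p _ _ C(3)[OF x]]) auto
    then have "cmod l ^ n * cmod (x z) \<le> G * (C * real (n + 1) * \<rho>\<^sub>0 ^ n * hardy_norm p x)"
      unfolding pow by (simp add: norm_mult norm_power)
    then have "cmod (x z) \<le> G * (C * real (n + 1) * \<rho>\<^sub>0 ^ n * hardy_norm p x) / cmod l ^ n"
      using l0 by (simp only: pos_le_divide_eq[OF zero_less_power[OF l0]] mult.commute[of "cmod (x z)"])
    also have "\<dots> = G * cmod l * ((1 / cmod l) ^ Suc n * (C * real (n + 1) * \<rho>\<^sub>0 ^ n * hardy_norm p x))"
    proof -
      have "(1 / cmod l) ^ Suc n = 1 / (cmod l * cmod l ^ n)" by (simp add: power_one_over)
      then show ?thesis using l0 by simp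
    qed
    finally show ?thesis .
  qed
  have "(\<lambda>n. G * cmod l * ((1 / cmod l) ^ Suc n * (C * real (n + 1) * \<rho>\<^sub>0 ^ n * hardy_norm p x))) \<longlonglongrightarrow> G * cmod l * 0"
    by (intro tendsto_mult_left summable_LIMSEQ_zero sums_summable[OF geometric_weight_sums[OF l]])
  then have "cmod (x z) \<le> 0" using bnd by (intro LIMSEQ_le_const) auto
  then show ?thesis by simp
qed (use hardy_outside[OF x(1)] in auto)

text \<open>The difference of the two sides is an eigenvector for \<open>w\<close> vanishing at
  \<alpha>, hence zero by \<open>iter_injective\<close>.\<close>

lemma resolvent_identity:
  assumes "\<rho>\<^sub>0 < cmod w" "\<rho>\<^sub>0 < cmod z" and f: "f \<in> hardy p" "f \<alpha> = 0"
  shows "res w f a - res z f a = (w - z) * res w (res z f) a"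
proof -
  define g where "g = res z f"
  have g: "g \<in> hardy p" "g \<alpha> = 0" "\<And>a. iter 1 g a - z * g a = f a" unfolding g_def using res_hardy res_\<alpha> iter_res assms by auto
  have rf: "res w f \<in> hardy p" "res w f \<alpha> = 0" "\<And>a. iter 1 (res w f) a - w * res w f a = f a" using res_hardy res_\<alpha> iter_res assms by auto
  have rg: "res w g \<in> hardy p" "res w g \<alpha> = 0" "\<And>a. iter 1 (res w g) a - w * res w g a = g a" using res_hardy res_\<alpha> iter_res assms g by auto
  define y where "y = (\<lambda>a. (res w f a - g a) - (w - z) * res w g a)"
  have y: "y \<in> hardy p" unfolding y_def using rf rg g p by (intro hardy_diff hardy_scale) auto
  have y0: "y \<alpha> = 0" unfolding y_def using rf rg g by simp
  have "iter 1 y a = w * y a" for a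
  proof -
    have "iter 1 y a = (iter 1 (res w f) a - iter 1 g a) - (w - z) * iter 1 (res w g) a"
      unfolding iter_def y_def by simp
    then show ?thesis using rf(3)[of a] rg(3)[of a] g(3)[of a] unfolding y_def by algebra
  qed
  from iter_injective[OF y y0 assms(1) this, of a] show ?thesis by (simp add: y_def g_def)
qed

section \<open>Points outside the local spectrum\<close>

lemma not_in_local_spectrum_zero:
  "w \<notin> local_spectrum (hardy p) (hardy_norm p) (comp_op \<phi>) (\<lambda>_. 0)"
proof -
  have "vholo_on (hardy p) (hardy_norm p) UNIV (\<lambda>_ _. 0)"
    unfolding vholo_on_def using hardy_zero p by (auto intro!: bexI[of _ "\<lambda>_. 0"])
  moreover have "(\<lambda>a. comp_op \<phi> (\<lambda>_. 0) a - z * 0) = (\<lambda>_. 0)" for z by (simp add: comp_op_def)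
  ultimately show ?thesis unfolding local_spectrum_def by blast
qed

text \<open>Constants are eigenvectors for the eigenvalue 1, so the constant c / (1 - l) solves the
  equation and only a scalar function has to be differentiated.\<close>

lemma not_in_local_spectrum_const:
  assumes "w \<noteq> 1"
  shows "w \<notin> local_spectrum (hardy p) (hardy_norm p) (comp_op \<phi>) (\<lambda>z. if z \<in> ball 0 1 then c else 0)"
proof -
  define F where "F = (\<lambda>l a. if a \<in> ball (0::complex) 1 then c / (1 - l) else 0)"
  have p0: "0 < p" using p by simp
  have "vholo_on (hardy p) (hardy_norm p) (- {1}) F"
    unfolding vholo_on_def
  proof (intro conjI ballI)
    fix z :: complex assume z: "z \<in> - {1}"
    show "F z \<in> hardy p" unfolding F_def by (rule disc_const_hardy[OF p0])
    define G where "G = (\<lambda>a. if a \<in> ball (0::complex) 1 then c / (1 - z)\<^sup>2 else 0)"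
    have ev: "eventually (\<lambda>w. w \<in> - {1} - {z}) (at z)"
      using z by (intro eventually_at_in_open) auto
    have lim: "((\<lambda>w. c / (1 - w) / (1 - z) - c / (1 - z)\<^sup>2) \<longlongrightarrow> c / (1 - z) / (1 - z) - c / (1 - z)\<^sup>2) (at z)"
      using z by (intro tendsto_intros) auto
    have "((\<lambda>w. hardy_norm p (\<lambda>a. (F w a - F z a) / (w - z) - G a)) \<longlongrightarrow> 0) (at z)"
    proof (rule tendsto_0_le[of "\<lambda>w. c / (1 - w) / (1 - z) - c / (1 - z)\<^sup>2" _ _ 1])
      show "((\<lambda>w. c / (1 - w) / (1 - z) - c / (1 - z)\<^sup>2) \<longlongrightarrow> 0) (at z)"
        using lim by (simp add: power2_eq_square)
      show "\<forall>\<^sub>F w in at z. norm (hardy_norm p (\<lambda>a. (F w a - F z a) / (w - z) - G a)) \<le> norm (c / (1 - w) / (1 - z) - c / (1 - z)\<^sup>2) * 1"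
        using ev
      proof eventually_elim
        case (elim w)
        have "(c / (1 - w) - c / (1 - z)) / (w - z) = c / (1 - w) / (1 - z)"
          using elim z by (simp add: divide_simps) (simp add: algebra_simps)
        then have "(\<lambda>a. (F w a - F z a) / (w - z) - G a)
          = (\<lambda>a. if a \<in> ball 0 1 then c / (1 - w) / (1 - z) - c / (1 - z)\<^sup>2 else 0)"
          by (auto simp: F_def G_def fun_eq_iff)
        then show ?case using disc_const_hardy(2)[OF p0, of "c / (1 - w) / (1 - z) - c / (1 - z)\<^sup>2"] hardy_norm_nonneg
          by (simp only: real_norm_def abs_of_nonneg mult_1_right)
      qed
    qed
    then show "\<exists>G\<in>hardy p. ((\<lambda>w. hardy_norm p (\<lambda>a. (F w a - F z a) / (w - z) - G a)) \<longlongrightarrow> 0) (at z)"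
      by (rule bexI[of _ G]) (simp only: G_def disc_const_hardy(1)[OF p0])
  qed auto
  moreover have "(\<lambda>a. comp_op \<phi> (F z) a - z * F z a) = (\<lambda>z. if z \<in> ball 0 1 then c else 0)" if "z \<in> - {1}" for z
  proof
    fix a show "comp_op \<phi> (F z) a - z * F z a = (if a \<in> ball 0 1 then c else 0)"
    proof (cases "a \<in> ball 0 1")
      case True
      then have "comp_op \<phi> (F z) a = c / (1 - z)"
        unfolding comp_op_eq_iter using iter_in_disc[OF True, of 1] by (simp add: iter_def F_def)
      moreover have "c / (1 - z) - z * (c / (1 - z)) = c"
        using that by (simp add: divide_simps) (simp add: algebra_simps)
      ultimately show ?thesis using True by (simp add: F_def)
    qed (simp add: comp_op_def F_def)
  qed
  moreover have "open (- {1::complex})" "w \<in> - {1}" using assms by auto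
  ultimately show ?thesis unfolding local_spectrum_def by blast
qed

text \<open>The derivative at z is \<open>h\<close>, the squared resolvent applied to f. By two uses
  of the resolvent identity the error of the difference quotient is (w - z) times
  \<open>res w h\<close>, whose norm is bounded uniformly on \<open>U\<close>.\<close>

lemma not_in_local_spectrum_outside:
  assumes f: "f \<in> hardy p" "f \<alpha> = 0" and l: "\<rho>\<^sub>0 < cmod l"
  shows "l \<notin> local_spectrum (hardy p) (hardy_norm p) (comp_op \<phi>) f"
proof -
  obtain \<rho>1 where \<rho>1: "\<rho>\<^sub>0 < \<rho>1" "\<rho>1 < cmod l" using dense[OF l] by blast
  obtain K where K: "0 \<le> K"
    "\<And>l f. \<rho>1 \<le> cmod l \<Longrightarrow> f \<in> hardy p \<Longrightarrow> f \<alpha> = 0 \<Longrightarrow> hardy_norm p (res l f) \<le> K * hardy_norm p f"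
    using res_properties[OF \<rho>1(1)] by auto
  define U where "U = - cball (0::complex) \<rho>1"
  have U: "open U" "l \<in> U" "\<And>z. z \<in> U \<Longrightarrow> \<rho>1 \<le> cmod z" "\<And>z. z \<in> U \<Longrightarrow> \<rho>\<^sub>0 < cmod z"
    unfolding U_def using \<rho>1 by auto
  have "vholo_on (hardy p) (hardy_norm p) U (\<lambda>z. res z f)"
    unfolding vholo_on_def
  proof (intro conjI ballI U(1))
    fix z assume z: "z \<in> U"
    show "res z f \<in> hardy p" using res_hardy[OF U(4)[OF z] f] .
    define g where "g = res z f"
    have g: "g \<in> hardy p" "g \<alpha> = 0" unfolding g_def using res_hardy res_\<alpha> U z f by auto
    define h where "h = res z g"
    have h: "h \<in> hardy p" "h \<alpha> = 0" unfolding h_def using res_hardy res_\<alpha> U z g by auto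
    have "((\<lambda>w. hardy_norm p (\<lambda>a. (res w f a - res z f a) / (w - z) - h a)) \<longlongrightarrow> 0) (at z)"
    proof (rule tendsto_0_le[of "\<lambda>w. w - z" _ _ "K * hardy_norm p h"])
      show "((\<lambda>w. w - z) \<longlongrightarrow> 0) (at z)" by (rule LIM_zero) (rule tendsto_ident_at)
      have ev: "eventually (\<lambda>w. w \<in> U - {z}) (at z)"
        using z U(1) by (intro eventually_at_in_open) auto
      then show "\<forall>\<^sub>F w in at z. norm (hardy_norm p (\<lambda>a. (res w f a - res z f a) / (w - z) - h a)) \<le> norm (w - z) * (K * hardy_norm p h)"
      proof eventually_elim
        case (elim w)
        have w: "w \<in> U" "w \<noteq> z" using elim by auto
        have "(res w f a - res z f a) / (w - z) - h a = (w - z) * res w h a" for a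
        proof -
          have "res w f a - res z f a = (w - z) * res w g a"
            unfolding g_def by (rule resolvent_identity[OF U(4)[OF w(1)] U(4)[OF z] f])
          then have "(res w f a - res z f a) / (w - z) - h a = res w g a - res z g a" using w by (simp add: h_def)
          also have "\<dots> = (w - z) * res w h a"
            unfolding h_def by (rule resolvent_identity[OF U(4)[OF w(1)] U(4)[OF z] g])
          finally show ?thesis .
        qed
        then have "hardy_norm p (\<lambda>a. (res w f a - res z f a) / (w - z) - h a) \<le> cmod (w - z) * hardy_norm p (res w h)"
          using hardy_scale(2)[OF res_hardy[OF U(4)[OF w(1)] h]] p by simp
        also have "\<dots> \<le> cmod (w - z) * (K * hardy_norm p h)"
          using K(2)[OF U(3)[OF w(1)] h] by (intro mult_left_mono) auto
        finally show ?case using hardy_norm_nonneg by simp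
      qed
    qed
    then show "\<exists>G\<in>hardy p. ((\<lambda>w. hardy_norm p (\<lambda>a. (res w f a - res z f a) / (w - z) - G a)) \<longlongrightarrow> 0) (at z)"
      using h by blast
  qed
  moreover have "(\<lambda>a. comp_op \<phi> (res z f) a - z * res z f a) = f" if "z \<in> U" for z
    unfolding comp_op_eq_iter using iter_res[OF U(4)[OF that] f] by auto
  ultimately show ?thesis unfolding local_spectrum_def using U(1,2) by blast
qed

text \<open>At the fixed point \<alpha> the left side of the equation for the value 1 vanishes,
  whatever the solution.\<close>

lemma one_in_local_spectrum:
  assumes "f \<alpha> \<noteq> 0"
  shows "1 \<in> local_spectrum (hardy p) (hardy_norm p) (comp_op \<phi>) f"
proof (rule ccontr)
  assume "1 \<notin> local_spectrum (hardy p) (hardy_norm p) (comp_op \<phi>) f"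
  then obtain F where "(\<lambda>a. comp_op \<phi> (F (1::complex)) a - 1 * F 1 a) = f"
    unfolding local_spectrum_def by blast
  from fun_cong[OF this, of \<alpha>] show False using assms by (simp add: comp_op_eq_iter iter_\<alpha>)
qed

text \<open>Split f into the constant c and f - c: the first can obstruct only at 1, the second only
  on the closed disc of radius \<open>\<rho>\<^sub>0\<close>. Together with
  \<open>one_in_local_spectrum\<close> and \<open>local_spectrum_contains_disc\<close> this
  determines the local spectrum.\<close>

lemma not_in_local_spectrum:
  assumes f: "f \<in> hardy p" and 1: "f \<alpha> = 0 \<or> w \<noteq> 1"
    and 2: "\<rho>\<^sub>0 < cmod w \<or> f = (\<lambda>z. if z \<in> ball 0 1 then f \<alpha> else 0)"
  shows "w \<notin> local_spectrum (hardy p) (hardy_norm p) (comp_op \<phi>) f"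
proof -
  define c where "c = (\<lambda>z::complex. if z \<in> ball 0 1 then f \<alpha> else 0)"
  have c: "c \<in> hardy p" unfolding c_def using p by (intro disc_const_hardy) auto
  have 3: "w \<notin> local_spectrum (hardy p) (hardy_norm p) (comp_op \<phi>) c"
  proof (cases "f \<alpha> = 0")
    case True
    then have "c = (\<lambda>_. 0)" by (auto simp: c_def)
    then show ?thesis using not_in_local_spectrum_zero by simp
  next
    case False
    then show ?thesis unfolding c_def using 1 by (intro not_in_local_spectrum_const) auto
  qed
  show ?thesis
  proof (cases "\<rho>\<^sub>0 < cmod w")
    case True
    have "w \<notin> local_spectrum (hardy p) (hardy_norm p) (comp_op \<phi>) (\<lambda>z. f z - c z)"
      using f c p \<alpha> True by (intro not_in_local_spectrum_outside hardy_diff) (auto simp: c_def)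
    from local_spectrum_add[OF p _ this 3] show ?thesis by (simp add: comp_op_def fun_eq_iff)
  next
    case False
    then have "f = c" using 2 by (simp add: c_def)
    then show ?thesis using 3 by simp
  qed
qed

end

section \<open>Local spectra inside the disc\<close>

lemma holomorphic_isCont:
  assumes "f holomorphic_on S" "open S" "x \<in> S" shows "isCont f x"
  using assms continuous_on_eq_continuous_at holomorphic_on_imp_continuous_on by blast

lemma power_series_bound:
  fixes b :: "nat \<Rightarrow> complex"
  assumes b: "\<And>n. cmod (b n) \<le> B * s ^ n" and s: "0 \<le> s" "s * cmod x < 1"
  shows "summable (\<lambda>n. b n * x ^ n)" "cmod (\<Sum>n. b n * x ^ n) \<le> B / (1 - s * cmod x)"
proof -
  have le: "norm (b n * x ^ n) \<le> B * (s * cmod x) ^ n" for n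
    using mult_right_mono[OF b[of n], of "cmod x ^ n"] by (simp add: norm_mult norm_power power_mult_distrib mult_ac)
  have "(\<lambda>n. B * (s * cmod x) ^ n) sums (B * (1 / (1 - s * cmod x)))"
    using s by (intro sums_mult geometric_sums) simp
  then have sums: "(\<lambda>n. B * (s * cmod x) ^ n) sums (B / (1 - s * cmod x))" by simp
  show "summable (\<lambda>n. b n * x ^ n)" by (rule summable_comparison_test'[OF sums_summable[OF sums] le])
  show "cmod (\<Sum>n. b n * x ^ n) \<le> B / (1 - s * cmod x)"
    using norm_suminf_le[OF le sums_summable[OF sums]] sums_unique[OF sums] by simp
qed

lemma power_series_holomorphic_ball:
  fixes b :: "nat \<Rightarrow> complex"
  assumes b: "\<And>n. cmod (b n) \<le> B * s ^ n" and s: "0 < s"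
  shows "(\<lambda>x. \<Sum>n. b n * x ^ n) holomorphic_on ball 0 (1 / s)"
proof (rule power_series_holomorphic)
  fix w :: complex assume "w \<in> ball 0 (1 / s)"
  then have "s * cmod w < 1" using s by (simp add: field_simps)
  from power_series_bound(1)[OF b _ this] s
  show "(\<lambda>n. b n * (w - 0) ^ n) sums (\<Sum>n. b n * w ^ n)" by (simp add: summable_sums)
qed

text \<open>A Laurent series in which \<open>a n\<close> belongs to the power -(n + 1) of l. The
  shift by one makes the part with \<open>a\<close> tend to 0 at infinity, as the Liouville argument
  requires.\<close>

definition two_sided :: "(nat \<Rightarrow> complex) \<Rightarrow> (nat \<Rightarrow> complex) \<Rightarrow> complex \<Rightarrow> complex" where
  "two_sided a b l = (\<Sum>n. b n * l ^ n) + 1 / l * (\<Sum>n. a n * (1 / l) ^ n)"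

lemma principal_part_holomorphic:
  fixes a :: "nat \<Rightarrow> complex"
  assumes a: "\<And>n. cmod (a n) \<le> A * s ^ n" and s: "0 < s"
  shows "(\<lambda>l. 1 / l * (\<Sum>n. a n * (1 / l) ^ n)) holomorphic_on {l. s < cmod l}"
proof -
  have "((\<lambda>x. \<Sum>n. a n * x ^ n) \<circ> (\<lambda>l. 1 / l)) holomorphic_on {l. s < cmod l}"
    using s by (intro holomorphic_on_compose_gen[OF _ power_series_holomorphic_ball[OF a s]] holomorphic_intros)
      (auto simp: norm_divide intro!: frac_less2)
  then show ?thesis using s by (intro holomorphic_intros) (auto simp: o_def)
qed

context
  fixes a b :: "nat \<Rightarrow> complex" and A B \<rho>1 \<rho>2 :: real
  assumes a: "\<And>n. cmod (a n) \<le> A * \<rho>1 ^ n" and b: "\<And>n. cmod (b n) \<le> B * (1 / \<rho>2) ^ n"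
    and \<rho>: "0 < \<rho>1" "\<rho>1 < \<rho>2"
begin

lemma two_sided_holomorphic: "two_sided a b holomorphic_on {l. \<rho>1 < cmod l \<and> cmod l < \<rho>2}"
proof -
  have "(\<lambda>x. \<Sum>n. b n * x ^ n) holomorphic_on ball 0 \<rho>2"
    using power_series_holomorphic_ball[OF b] \<rho> by simp
  then show ?thesis unfolding two_sided_def
    by (intro holomorphic_on_add holomorphic_on_subset[OF principal_part_holomorphic[OF a \<rho>(1)]])
      (auto elim: holomorphic_on_subset)
qed

lemma two_sided_bound:
  assumes "\<rho>1 < cmod l" "cmod l < \<rho>2"
  shows "cmod (two_sided a b l) \<le> B / (1 - cmod l / \<rho>2) + A / (cmod l - \<rho>1)"
proof -
  have 1: "cmod (\<Sum>n. b n * l ^ n) \<le> B / (1 - 1 / \<rho>2 * cmod l)"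
    using assms \<rho> by (intro power_series_bound(2)[OF b]) auto
  have 2: "cmod (\<Sum>n. a n * (1 / l) ^ n) \<le> A / (1 - \<rho>1 * cmod (1 / l))"
    using assms \<rho> by (intro power_series_bound(2)[OF a]) (auto simp: norm_divide divide_less_eq_1)
  have "cmod (1 / l * (\<Sum>n. a n * (1 / l) ^ n)) \<le> 1 / cmod l * (A / (1 - \<rho>1 * cmod (1 / l)))"
    using 2 unfolding norm_mult by (intro mult_mono) (auto simp: norm_divide)
  also have "\<dots> = A / (cmod l - \<rho>1)" 
  proof -
    have "l \<noteq> 0" using assms \<rho> by force
    then have "cmod l * (1 - \<rho>1 * cmod (1 / l)) = cmod l - \<rho>1" by (simp add: norm_divide right_diff_distrib)
    then show ?thesis by simp
  qed
  finally show ?thesis unfolding two_sided_def using 1 by (intro norm_triangle_le add_mono) auto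
qed

text \<open>If the Laurent series vanishes on an open set, its two halves glue to an entire function
  vanishing at infinity.\<close>

lemma two_sided_zero:
  assumes U: "open U" "U \<noteq> {}" and sub: "\<And>l. l \<in> U \<Longrightarrow> \<rho>1 < cmod l \<and> cmod l < \<rho>2"
    and zero: "\<And>l. l \<in> U \<Longrightarrow> two_sided a b l = 0"
  shows "b 0 = 0"
proof -
  let ?N = "{l::complex. \<rho>1 < cmod l \<and> cmod l < \<rho>2}"
  have oN: "open ?N" by (intro open_Collect_conj open_Collect_less continuous_intros)
  have cN: "connected ?N" using connected_annulus(1)[of \<rho>1 "0::complex" \<rho>2] by simp
  have UN: "U \<subseteq> ?N" using sub by blast
  have z: "two_sided a b l = 0" if "l \<in> ?N" for l
    using analytic_continuation_open[OF U(1) oN U(2) cN UN two_sided_holomorphic holomorphic_on_const zero that] .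
  define P where "P = (\<lambda>l. \<Sum>n. b n * l ^ n)"
  define Q where "Q = (\<lambda>l. - (1 / l * (\<Sum>n. a n * (1 / l) ^ n)))"
  define E where "E = (\<lambda>l. if l \<in> ball 0 \<rho>2 then P l else Q l)"
  have P: "P holomorphic_on ball 0 \<rho>2"
    unfolding P_def using power_series_holomorphic_ball[OF b] \<rho> by simp
  have Q: "Q holomorphic_on {l. \<rho>1 < cmod l}"
    unfolding Q_def by (intro holomorphic_on_minus principal_part_holomorphic[OF a \<rho>(1)])
  have op: "open {l::complex. \<rho>1 < cmod l}" by (intro open_Collect_less continuous_intros)
  have "E holomorphic_on (ball 0 \<rho>2 \<union> {l. \<rho>1 < cmod l})"
    unfolding E_def
  proof (rule holomorphic_on_If_Un[OF P Q open_ball op])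
    fix l :: complex assume "l \<in> ball 0 \<rho>2" "l \<in> {l. \<rho>1 < cmod l}"
    then have "two_sided a b l = 0" by (intro z) simp
    then show "P l = Q l" unfolding P_def Q_def two_sided_def by (simp add: add_eq_0_iff2)
  qed
  moreover have "ball 0 \<rho>2 \<union> {l. \<rho>1 < cmod l} = (UNIV :: complex set)" using \<rho> by auto
  ultimately have E: "E holomorphic_on UNIV" by simp
  have "(\<lambda>x. \<Sum>n. a n * x ^ n) holomorphic_on ball 0 (1 / \<rho>1)"
    by (rule power_series_holomorphic_ball[OF a \<rho>(1)])
  then have c: "isCont (\<lambda>x. \<Sum>n. a n * x ^ n) 0"
    using \<rho> by (intro holomorphic_isCont) auto
  have inv: "((\<lambda>l::complex. 1 / l) \<longlongrightarrow> 0) at_infinity"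
    unfolding inverse_eq_divide[symmetric] by (rule tendsto_inverse_0)
  have "((\<lambda>l. - (1 / l * (\<Sum>n. a n * (1 / l) ^ n))) \<longlongrightarrow> - (0 * (\<Sum>n. a n * 0 ^ n))) at_infinity"
    by (intro tendsto_minus tendsto_mult inv isCont_tendsto_compose[OF c inv])
  then have "(Q \<longlongrightarrow> 0) at_infinity" unfolding Q_def by simp
  then have "(E \<longlongrightarrow> 0) at_infinity"
  proof (rule Lim_transform_eventually)
    show "\<forall>\<^sub>F x in at_infinity. Q x = E x"
      unfolding eventually_at_infinity E_def by (intro exI[of _ \<rho>2]) auto
  qed
  from Liouville_weak[OF E this, of 0] have "P 0 = 0" using \<rho> by (simp add: E_def)
  moreover have "P 0 = b 0" unfolding P_def using powser_sums_zero[of b] by (metis sums_unique)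
  ultimately show ?thesis by simp
qed

end

section \<open>Backward orbits and the two-sided telescoping argument\<close>

context second_kind
begin

definition "ray u = Re (u * (1 - \<omega> * cnj \<alpha>))"
text \<open>\<open>ray\<close> is half the linear part of \<open>level\<close>. For u in
  \<open>K\<close> the level does not decrease along the ray t u, so the whole backward orbit (1 /
  r) ^ n u stays in \<open>H\<close>; for other points of \<open>H\<close> it may leave.\<close>

definition "K = {u. 0 < ray u}"

lemma level_ray: "level (of_real t * u) = 1 - (cmod \<alpha>)\<^sup>2 + 2 * t * ray u"
  unfolding level_def ray_def mult.assoc Re_of_real_mult by simp

lemma K_scale_in_H: assumes "u \<in> K" "0 \<le> t" shows "of_real t * u \<in> H"
proof -
  have "0 \<le> t * ray u" using assms by (simp add: K_def)
  then show ?thesis unfolding H_def mem_Collect_eq level_ray using \<alpha>_sq by linarith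
qed

lemma K_scale: assumes "u \<in> K" "0 < t" shows "of_real t * u \<in> K"
  using assms unfolding K_def ray_def mem_Collect_eq mult.assoc Re_of_real_mult by simp

lemma K_H: "u \<in> K \<Longrightarrow> u \<in> H"
  using K_scale_in_H[of u 1] by simp

lemma iter_\<mu>: assumes "u \<in> H" shows "iter n f (\<mu> u) = f (\<mu> (of_real (r ^ n) * u))"
  using \<mu>_in_disc[OF assms] \<kappa>_\<mu>[OF assms] by (simp add: iter_def)

text \<open>Along the ray, \<open>level\<close> grows at least linearly in t and |1 + t u|^2 at most
  quadratically, so 1 - |\<mu> (t u)| is at least a constant over t. The growth estimate then gives
  t powr (1 / p), which is \<open>(1 / \<rho>\<^sub>0) ^ n\<close> for t = (1 / r) ^ n.\<close>

lemma ray_growth: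
  assumes u: "u \<in> K"
  obtains C where "0 < C" "\<And>f n. f \<in> hardy p \<Longrightarrow> cmod (f (\<mu> (of_real ((1 / r) ^ n) * u))) \<le> C * hardy_norm p f * (1 / \<rho>\<^sub>0) ^ n"
proof -
  define c where "c = ray u"
  have c: "0 < c" using u by (simp add: c_def K_def)
  define D where "D = 4 * (1 + cmod u)\<^sup>2 / c"
  have D: "0 < D" unfolding D_def using c by (intro divide_pos_pos mult_pos_pos zero_less_power) (auto simp: add_pos_nonneg)
  have *: "cmod (f (\<mu> (of_real ((1 / r) ^ n) * u))) \<le> D powr (1 / p) * hardy_norm p f * (1 / \<rho>\<^sub>0) ^ n" if f: "f \<in> hardy p" for f n
  proof -
    define t where "t = (1 / r) ^ n"
    have t: "1 \<le> t" unfolding t_def using r by (intro one_le_power) simp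
    define v where "v = of_real t * u"
    have v: "v \<in> H" unfolding v_def using K_scale_in_H[OF u] t by simp
    have "2 * t * c \<le> level v" unfolding v_def level_ray c_def using \<alpha>_sq by simp
    moreover have "cmod (1 + v) \<le> t * (1 + cmod u)"
    proof -
      have "cmod (1 + v) \<le> 1 + t * cmod u" using norm_triangle_ineq[of 1 v] t by (simp add: v_def norm_mult)
      then show ?thesis using t by (simp add: algebra_simps)
    qed
    then have "(cmod (1 + v))\<^sup>2 \<le> (t * (1 + cmod u))\<^sup>2" by (intro power_mono) auto
    ultimately have "(2 * t * c) / (t * (1 + cmod u))\<^sup>2 \<le> level v / (cmod (1 + v))\<^sup>2"
      using H_nonzero[OF v] v by (intro frac_le) (auto simp: H_def)
    also have "\<dots> = (1 - cmod (\<mu> v)) * (1 + cmod (\<mu> v))"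
      unfolding \<mu>_norm[OF v, symmetric] by (simp add: power2_eq_square algebra_simps)
    also have "\<dots> \<le> (1 - cmod (\<mu> v)) * 2" using \<mu>_in_disc[OF v] by (intro mult_left_mono) auto
    finally have le: "(2 * t * c) / (t * (1 + cmod u))\<^sup>2 / 2 \<le> 1 - cmod (\<mu> v)" by simp
    have eq: "(2 * t * c) / (t * (1 + cmod u))\<^sup>2 / 2 = c / (t * (1 + cmod u)\<^sup>2)"
      using t by (simp add: power2_eq_square)
    have pos: "0 < c / (t * (1 + cmod u)\<^sup>2)" using c t
      by (intro divide_pos_pos mult_pos_pos zero_less_power) (auto simp: add_pos_nonneg)
    have "4 / (1 - cmod (\<mu> v)) \<le> 4 / (c / (t * (1 + cmod u)\<^sup>2))"
      using le pos unfolding eq by (intro divide_left_mono mult_pos_pos) auto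
    also have "\<dots> = D * t" unfolding D_def by simp
    finally have "(4 / (1 - cmod (\<mu> v))) powr (1 / p) \<le> (D * t) powr (1 / p)"
      using p \<mu>_in_disc[OF v] by (intro powr_mono2) auto
    also have "\<dots> = D powr (1 / p) * t powr (1 / p)" using D t by (intro powr_mult)
    also have "t powr (1 / p) = (1 / \<rho>\<^sub>0) ^ n"
    proof -
      have "t = (1 / r) powr real n" unfolding t_def using r by (simp add: powr_realpow)
      then have "t powr (1 / p) = ((1 / r) powr (1 / p)) powr real n" by (simp add: powr_powr mult.commute)
      also have "(1 / r) powr (1 / p) = 1 / \<rho>\<^sub>0" unfolding \<rho>\<^sub>0_def using r by (simp add: powr_divide)
      finally show ?thesis using \<rho>\<^sub>0 by (simp add: powr_realpow)
    qed
    finally have g: "(4 / (1 - cmod (\<mu> v))) powr (1 / p) \<le> D powr (1 / p) * (1 / \<rho>\<^sub>0) ^ n" .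
    have "cmod (f (\<mu> v)) \<le> (4 / (1 - cmod (\<mu> v))) powr (1 / p) * hardy_norm p f"
      using \<mu>_in_disc[OF v] by (intro hardy_growth[OF f p]) simp
    also have "\<dots> \<le> D powr (1 / p) * (1 / \<rho>\<^sub>0) ^ n * hardy_norm p f"
      using g hardy_norm_nonneg by (intro mult_right_mono)
    finally show ?thesis unfolding v_def t_def by (simp add: mult_ac)
  qed
  have "0 < D powr (1 / p)" using D by simp
  from that[OF this *] show ?thesis by blast
qed

text \<open>Holomorphy and growth along backward orbits are what the telescoping argument takes from
  H^p; B may depend on both f and u.\<close>

definition tame :: "(complex \<Rightarrow> complex) \<Rightarrow> bool" where
  "tame f \<longleftrightarrow> f holomorphic_on ball 0 1 \<and> (\<forall>u\<in>K. \<exists>B. \<forall>n. cmod (f (\<mu> (of_real ((1 / r) ^ n) * u))) \<le> B * (1 / \<rho>\<^sub>0) ^ n)"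

text \<open>A zero of order at least k at the fixed point, seen in the half-plane
  coordinate.\<close>

definition vanishing :: "nat \<Rightarrow> (complex \<Rightarrow> complex) \<Rightarrow> bool" where
  "vanishing k f \<longleftrightarrow> (\<exists>h. h holomorphic_on H \<and> (\<forall>u\<in>H. f (\<mu> u) = u ^ k * h u))"

lemma hardy_tame: "f \<in> hardy p \<Longrightarrow> tame f"
  unfolding tame_def using hardy_holomorphic ray_growth by metis

lemma open_H: "open H"
  unfolding H_def level_def by (intro open_Collect_less continuous_intros)

lemma convex_H: "convex H"
proof (rule convexI)
  fix x y :: complex and s t :: real assume *: "x \<in> H" "y \<in> H" "0 \<le> s" "0 \<le> t" "s + t = 1"
  have "level (s *\<^sub>R x + t *\<^sub>R y) = s * level x + t * level y + (1 - (s + t)) * (1 - (cmod \<alpha>)\<^sup>2)"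
    unfolding level_def by (simp add: scaleR_conv_of_real algebra_simps)
  then have "level (s *\<^sub>R x + t *\<^sub>R y) = s * level x + t * level y" using * by simp
  moreover have "0 < s * level x + t * level y"
  proof (cases "s = 0")
    case False
    then have "0 < s * level x" using * by (simp add: H_def)
    moreover have "0 \<le> t * level y" using * by (simp add: H_def)
    ultimately show ?thesis by simp
  qed (use * in \<open>simp add: H_def\<close>)
  ultimately show "s *\<^sub>R x + t *\<^sub>R y \<in> H" by (simp add: H_def)
qed

lemma zero_in_H: "0 \<in> H"
  using \<alpha>_sq by (simp add: H_def level_def)

lemma compose_\<mu>_holomorphic:
  assumes "f holomorphic_on ball 0 1" shows "(\<lambda>u. f (\<mu> u)) holomorphic_on H"
proof -
  have "\<mu> ` H \<subseteq> ball 0 1" using \<mu>_in_disc by blast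
  from holomorphic_on_compose_gen[OF \<mu>_holomorphic assms this] show ?thesis by (simp add: o_def)
qed

lemma vanishing_0: "f holomorphic_on ball 0 1 \<Longrightarrow> vanishing 0 f"
  unfolding vanishing_def using compose_\<mu>_holomorphic by auto

text \<open>In the half-plane coordinate u ^ j is an eigenfunction of composition for r ^ j, so this
  operator removes the j-th Taylor coefficient at the fixed point.\<close>

definition kill :: "nat \<Rightarrow> (complex \<Rightarrow> complex) \<Rightarrow> complex \<Rightarrow> complex" where
  "kill j f = (\<lambda>z. iter 1 f z - of_real (r ^ j) * f z)"

lemma kill_tame: assumes "tame f" shows "tame (kill j f)"
  unfolding tame_def
proof (intro conjI ballI)
  have f: "f holomorphic_on ball 0 1" using assms by (simp add: tame_def)
  show "kill j f holomorphic_on ball 0 1" unfolding kill_def by (intro holomorphic_intros iter_holomorphic f)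
  fix u assume u: "u \<in> K"
  obtain B where B: "\<And>n. cmod (f (\<mu> (of_real ((1 / r) ^ n) * u))) \<le> B * (1 / \<rho>\<^sub>0) ^ n"
    using assms u unfolding tame_def by blast
  obtain B' where B': "\<And>n. cmod (f (\<mu> (of_real ((1 / r) ^ n) * (of_real r * u)))) \<le> B' * (1 / \<rho>\<^sub>0) ^ n"
    using assms K_scale[OF u r(1)] unfolding tame_def by blast
  have "cmod (kill j f (\<mu> (of_real ((1 / r) ^ n) * u))) \<le> (B' + r ^ j * B) * (1 / \<rho>\<^sub>0) ^ n" for n
  proof -
    have v: "of_real ((1 / r) ^ n) * u \<in> H" using r by (intro K_scale_in_H[OF u]) simp
    have "kill j f (\<mu> (of_real ((1 / r) ^ n) * u))
      = f (\<mu> (of_real ((1 / r) ^ n) * (of_real r * u))) - of_real (r ^ j) * f (\<mu> (of_real ((1 / r) ^ n) * u))"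
      unfolding kill_def iter_\<mu>[OF v] by (simp add: mult_ac)
    also have "cmod \<dots> \<le> cmod (f (\<mu> (of_real ((1 / r) ^ n) * (of_real r * u)))) + r ^ j * cmod (f (\<mu> (of_real ((1 / r) ^ n) * u)))"
      using r by (intro order_trans[OF norm_triangle_ineq4]) (simp add: norm_mult norm_power)
    also have "\<dots> \<le> B' * (1 / \<rho>\<^sub>0) ^ n + r ^ j * (B * (1 / \<rho>\<^sub>0) ^ n)"
      using B B' r by (intro add_mono mult_left_mono) auto
    finally show ?thesis by (simp add: algebra_simps)
  qed
  then show "\<exists>B. \<forall>n. cmod (kill j f (\<mu> (of_real ((1 / r) ^ n) * u))) \<le> B * (1 / \<rho>\<^sub>0) ^ n" by blast
qed

text \<open>From f = u ^ j h one obtains u ^ j r ^ j (h (r u) - h u), and the bracket has a zero at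
  u = 0 that can be divided out.\<close>

lemma kill_vanishing: assumes "vanishing j f" shows "vanishing (Suc j) (kill j f)"
proof -
  obtain h where h: "h holomorphic_on H" "\<And>u. u \<in> H \<Longrightarrow> f (\<mu> u) = u ^ j * h u"
    using assms unfolding vanishing_def by blast
  have rH: "of_real r * u \<in> H" if "u \<in> H" for u using H_iter[OF that, of 1] by simp
  define d where "d = (\<lambda>u. of_real (r ^ j) * (h (of_real r * u) - h u))"
  have "(h \<circ> (\<lambda>u. of_real r * u)) holomorphic_on H"
    using rH by (intro holomorphic_on_compose_gen[OF _ h(1)] holomorphic_intros) auto
  then have d: "d holomorphic_on H" unfolding d_def using h(1) by (intro holomorphic_intros) (auto simp: o_def)
  define k where "k = (\<lambda>u. if u = 0 then deriv d 0 else d u / (u - 0))"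
  have k: "k holomorphic_on H"
    by (rule pole_theorem_open_0[OF d open_H, of 0]) (auto simp: k_def d_def)
  have "kill j f (\<mu> u) = u ^ Suc j * k u" if u: "u \<in> H" for u
  proof -
    have "kill j f (\<mu> u) = u ^ j * d u"
      unfolding kill_def iter_\<mu>[OF u] using h(2)[OF u] h(2)[OF rH[OF u]]
      by (simp add: d_def power_mult_distrib algebra_simps)
    moreover have "d u = u * k u" by (simp add: k_def d_def)
    ultimately show ?thesis by (simp add: mult_ac)
  qed
  then show ?thesis unfolding vanishing_def using k by blast
qed

primrec kills :: "nat \<Rightarrow> (complex \<Rightarrow> complex) \<Rightarrow> complex \<Rightarrow> complex" where
  "kills 0 f = f" | "kills (Suc k) f = kill k (kills k f)"

lemma kills_tame: "tame f \<Longrightarrow> tame (kills k f)"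
  by (induction k) (auto intro: kill_tame)

lemma kills_vanishing: assumes "f holomorphic_on ball 0 1" shows "vanishing k (kills k f)"
  by (induction k) (auto intro: kill_vanishing vanishing_0 assms)

text \<open>The operators \<open>kill j\<close> are polynomials in the composition operator, hence
  commute with it.\<close>

lemma kills_equation:
  assumes "\<And>z. iter 1 F z - l * F z = f z"
  shows "iter 1 (kills k F) z - l * kills k F z = kills k f z"
proof (induction k arbitrary: z)
  case 0 show ?case using assms by simp
next
  case (Suc k)
  have e: "iter 1 (kill k g) z = iter 1 (iter 1 g) z - of_real (r ^ k) * iter 1 g z" for g
    unfolding kill_def iter_def by simp
  have f: "kills k f = (\<lambda>z. iter 1 (kills k F) z - l * kills k F z)" using Suc by auto
  have "iter 1 (kills k f) z = iter 1 (iter 1 (kills k F)) z - l * iter 1 (kills k F) z"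
    unfolding f by (simp add: iter_def)
  then show ?case unfolding kills.simps e unfolding kill_def using Suc.IH[of z, symmetric] by algebra
qed

text \<open>The forward orbit converges to 0, an interior point of \<open>H\<close>, so
  \<open>h\<close> stays bounded along it.\<close>

lemma vanishing_decay:
  assumes "vanishing k f" "u \<in> H"
  obtains A where "\<And>n. cmod (f (\<mu> (of_real (r ^ n) * u))) \<le> A * (r ^ k) ^ n"
proof -
  obtain h where h: "h holomorphic_on H" "\<And>u. u \<in> H \<Longrightarrow> f (\<mu> u) = u ^ k * h u"
    using assms unfolding vanishing_def by blast
  have "isCont h 0" by (rule holomorphic_isCont[OF h(1) open_H zero_in_H])
  moreover have "(\<lambda>n. of_real (r ^ n) * u) \<longlonglongrightarrow> of_real 0 * u"
    using r by (intro tendsto_intros LIMSEQ_realpow_zero) auto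
  ultimately have "(\<lambda>n. h (of_real (r ^ n) * u)) \<longlonglongrightarrow> h 0" by (intro isCont_tendsto_compose[of 0 h]) auto
  then have "Bseq (\<lambda>n. h (of_real (r ^ n) * u))" by (rule convergent_imp_Bseq[OF convergentI])
  then obtain M where M: "\<And>n. cmod (h (of_real (r ^ n) * u)) \<le> M" unfolding Bseq_def by auto
  have "cmod (f (\<mu> (of_real (r ^ n) * u))) \<le> (cmod u ^ k * M) * (r ^ k) ^ n" for n
  proof -
    have "cmod (f (\<mu> (of_real (r ^ n) * u))) = (r ^ n * cmod u) ^ k * cmod (h (of_real (r ^ n) * u))"
      using h(2)[OF H_iter[OF assms(2), of n]] r by (simp add: norm_mult norm_power)
    also have "\<dots> \<le> (r ^ n * cmod u) ^ k * M" using M r by (intro mult_left_mono) auto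
    finally show ?thesis by (simp add: power_mult_distrib power_mult[symmetric] mult_ac)
  qed
  then show ?thesis by (rule that)
qed

text \<open>Iterating the equation for \<open>F\<close> forward and backward along the orbit of \<open>u\<close> expresses
  \<open>F (\<mu> u)\<close> as two series in \<open>f\<close>; their difference is a Laurent series in \<open>l\<close>.\<close>

lemma two_sided_orbit_sum:
  assumes F: "tame F" "vanishing k F" "\<And>z. iter 1 F z - l * F z = f z"
    and l: "r ^ k < cmod l" "cmod l < \<rho>\<^sub>0" and u: "u \<in> K"
  shows "two_sided (\<lambda>n. f (\<mu> (of_real (r ^ n) * u))) (\<lambda>n. f (\<mu> (of_real ((1 / r) ^ Suc n) * u))) l = 0"
proof -
  define c where "c = (\<lambda>n. F (\<mu> (of_real (r ^ n) * u)))"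
  define d where "d = (\<lambda>n. F (\<mu> (of_real ((1 / r) ^ n) * u)))"
  have l0: "l \<noteq> 0" using l r by auto
  have step: "F (\<mu> (of_real r * v)) = l * F (\<mu> v) + f (\<mu> v)" if "v \<in> H" for v
    using F(3)[of "\<mu> v"] iter_\<mu>[OF that, of 1 F] by (simp add: algebra_simps)
  have c: "c (Suc n) = l * c n + f (\<mu> (of_real (r ^ n) * u))" for n
    unfolding c_def using step[OF H_iter[OF K_H[OF u], of n]] by (simp add: mult_ac)
  have d: "d n = l * d (Suc n) + f (\<mu> (of_real ((1 / r) ^ Suc n) * u))" for n
  proof -
    have "of_real r * (of_real ((1 / r) ^ Suc n) * u) = of_real ((1 / r) ^ n) * u" using r by simp
    then show ?thesis unfolding d_def using step[OF K_scale_in_H[OF u, of "(1 / r) ^ Suc n"]] r by simp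
  qed
  obtain A where A: "\<And>n. cmod (c n) \<le> A * (r ^ k) ^ n" unfolding c_def using vanishing_decay[OF F(2) K_H[OF u]] by blast
  obtain B where B: "\<And>n. cmod (d n) \<le> B * (1 / \<rho>\<^sub>0) ^ n" unfolding d_def using F(1) u unfolding tame_def by blast
  have "(\<Sum>n<N. f (\<mu> (of_real (r ^ n) * u)) * (1 / l) ^ n) = l * (c N * (1 / l) ^ N - c 0)" for N
  proof (induction N)
    case (Suc N)
    have "l * (c (Suc N) * (1 / l) ^ Suc N) = c (Suc N) * (1 / l) ^ N" using l0 by simp
    then show ?case using Suc unfolding c by (simp add: algebra_simps)
  qed simp
  moreover have "(\<lambda>N. c N * (1 / l) ^ N) \<longlonglongrightarrow> 0"
  proof (rule Lim_null_comparison)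
    show "\<forall>\<^sub>F n in sequentially. norm (c n * (1 / l) ^ n) \<le> A * (r ^ k / cmod l) ^ n"
      using mult_right_mono[OF A, of "(1 / cmod l) ^ n" for n]
      by (intro always_eventually allI) (simp add: norm_mult norm_power norm_divide power_divide)
    show "(\<lambda>n. A * (r ^ k / cmod l) ^ n) \<longlonglongrightarrow> 0"
      using l r l0 by (intro tendsto_mult_right_zero LIMSEQ_realpow_zero) auto
  qed
  then have "(\<lambda>N. l * (c N * (1 / l) ^ N - c 0)) \<longlonglongrightarrow> l * (0 - c 0)" by (intro tendsto_intros)
  ultimately have 1: "(\<lambda>n. f (\<mu> (of_real (r ^ n) * u)) * (1 / l) ^ n) sums (l * (0 - c 0))" unfolding sums_def by simp
  have "(\<Sum>n<N. f (\<mu> (of_real ((1 / r) ^ Suc n) * u)) * l ^ n) = d 0 - d N * l ^ N" for N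
  proof (induction N)
    case (Suc N) then show ?case using d[of N] by (simp add: algebra_simps)
  qed simp
  moreover have "(\<lambda>N. d N * l ^ N) \<longlonglongrightarrow> 0"
  proof (rule Lim_null_comparison)
    show "\<forall>\<^sub>F n in sequentially. norm (d n * l ^ n) \<le> B * (cmod l / \<rho>\<^sub>0) ^ n"
      using mult_right_mono[OF B, of "cmod l ^ n" for n]
      by (intro always_eventually allI) (simp add: norm_mult norm_power power_divide)
    show "(\<lambda>n. B * (cmod l / \<rho>\<^sub>0) ^ n) \<longlonglongrightarrow> 0"
      using l \<rho>\<^sub>0 by (intro tendsto_mult_right_zero LIMSEQ_realpow_zero) auto
  qed
  then have "(\<lambda>N. d 0 - d N * l ^ N) \<longlonglongrightarrow> d 0 - 0" by (intro tendsto_intros)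
  ultimately have 2: "(\<lambda>n. f (\<mu> (of_real ((1 / r) ^ Suc n) * u)) * l ^ n) sums (d 0 - 0)" unfolding sums_def by simp
  have "c 0 = d 0" by (simp add: c_def d_def)
  then show ?thesis unfolding two_sided_def using sums_unique[OF 1, symmetric] sums_unique[OF 2, symmetric] l0 by simp
qed

text \<open>The coefficients of the Laurent series come from f alone. Solutions that may vary
  arbitrarily with l therefore make one and the same series vanish on all of
  \<open>U\<close>.\<close>

lemma solvable_imp_zero_on_K:
  assumes f: "tame f" "vanishing k f" and k: "0 < k"
    and U: "open U" "U \<noteq> {}" "\<And>l. l \<in> U \<Longrightarrow> r ^ k < cmod l \<and> cmod l < \<rho>\<^sub>0"
    and F: "\<And>l. l \<in> U \<Longrightarrow> \<exists>F. tame F \<and> vanishing k F \<and> (\<forall>z. iter 1 F z - l * F z = f z)"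
    and u: "u \<in> K"
  shows "f (\<mu> u) = 0"
proof -
  \<comment> \<open>The backward coefficients start at the orbit point v / r, so v = r u makes the
    coefficient with index 0 the value at u.\<close>
  define v where "v = of_real r * u"
  have v: "v \<in> K" unfolding v_def using K_scale[OF u r(1)] .
  obtain A where A: "\<And>n. cmod (f (\<mu> (of_real (r ^ n) * v))) \<le> A * (r ^ k) ^ n" using vanishing_decay[OF f(2) K_H[OF v]] by blast
  obtain B where B: "\<And>n. cmod (f (\<mu> (of_real ((1 / r) ^ n) * v))) \<le> B * (1 / \<rho>\<^sub>0) ^ n" using f(1) v unfolding tame_def by blast
  have B': "cmod (f (\<mu> (of_real ((1 / r) ^ Suc n) * v))) \<le> (B / \<rho>\<^sub>0) * (1 / \<rho>\<^sub>0) ^ n" for n using B[of "Suc n"] by simp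
  obtain l where "l \<in> U" using U by blast
  then have "r ^ k < \<rho>\<^sub>0" using U(3) by fastforce
  have "f (\<mu> (of_real ((1 / r) ^ Suc 0) * v)) = 0"
  proof (rule two_sided_zero[OF A B'])
    show "0 < r ^ k" "r ^ k < \<rho>\<^sub>0" using r \<open>r ^ k < \<rho>\<^sub>0\<close> by auto
    fix l assume l: "l \<in> U"
    obtain F where "tame F" "vanishing k F" "\<And>z. iter 1 F z - l * F z = f z" using F[OF l] by blast
    from two_sided_orbit_sum[OF this _ _ v] U(3)[OF l]
    show "two_sided (\<lambda>n. f (\<mu> (of_real (r ^ n) * v))) (\<lambda>n. f (\<mu> (of_real ((1 / r) ^ Suc n) * v))) l = 0" by blast
  qed (use U in auto)
  then show ?thesis unfolding v_def using r by simp
qed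

text \<open>Under the hypothesis each backward step multiplies f by r ^ (-j). For j > 0 a nonzero
  value would outgrow the tame rate, since r ^ j \<le> r < \<open>\<rho>\<^sub>0\<close>; the last
  inequality rests on p > 1.\<close>

lemma kill_zero_imp_zero:
  assumes f: "tame f" and j: "0 < j" and z: "\<And>u. u \<in> K \<Longrightarrow> kill j f (\<mu> u) = 0" and u: "u \<in> K"
  shows "f (\<mu> u) = 0"
proof -
  have step: "f (\<mu> (of_real r * v)) = of_real (r ^ j) * f (\<mu> v)" if "v \<in> K" for v
    using z[OF that] iter_\<mu>[OF K_H[OF that], of 1 f] by (simp add: kill_def)
  have eq: "f (\<mu> u) = of_real (r ^ j) ^ n * f (\<mu> (of_real ((1 / r) ^ n) * u))" for n
  proof (induction n)
    case (Suc n)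
    have "of_real r * (of_real ((1 / r) ^ Suc n) * u) = of_real ((1 / r) ^ n) * u" using r by simp
    then show ?case using step[OF K_scale[OF u, of "(1 / r) ^ Suc n"]] r Suc by simp
  qed simp
  obtain B where B: "\<And>n. cmod (f (\<mu> (of_real ((1 / r) ^ n) * u))) \<le> B * (1 / \<rho>\<^sub>0) ^ n" using f u unfolding tame_def by blast
  have "cmod (f (\<mu> u)) \<le> B * (r ^ j / \<rho>\<^sub>0) ^ n" for n
  proof -
    have "cmod (f (\<mu> u)) = (r ^ j) ^ n * cmod (f (\<mu> (of_real ((1 / r) ^ n) * u)))"
      using r by (subst eq[of n]) (simp add: norm_mult norm_power)
    also have "\<dots> \<le> (r ^ j) ^ n * (B * (1 / \<rho>\<^sub>0) ^ n)" using B r by (intro mult_left_mono) auto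
    finally show ?thesis by (simp add: power_divide mult_ac)
  qed
  moreover have "(\<lambda>n. B * (r ^ j / \<rho>\<^sub>0) ^ n) \<longlonglongrightarrow> 0"
  proof (intro tendsto_mult_right_zero LIMSEQ_realpow_zero)
    have "r ^ j \<le> r ^ 1" using j r by (intro power_decreasing) auto
    then show "r ^ j / \<rho>\<^sub>0 < 1" using \<rho>\<^sub>0 by simp
    show "0 \<le> r ^ j / \<rho>\<^sub>0" using r \<rho>\<^sub>0 by simp
  qed
  ultimately have "cmod (f (\<mu> u)) \<le> 0" by (intro LIMSEQ_le_const) auto
  then show ?thesis by simp
qed

text \<open>The operators are undone from the last to the first. Those with j > 0 are injective
  along \<open>K\<close>; the one with j = 0 leaves a function invariant under u to r u, which
  equals its limit at the fixed point.\<close>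

lemma kills_zero_imp_const:
  assumes f: "tame f" and z: "\<And>u. u \<in> K \<Longrightarrow> kills (Suc k) f (\<mu> u) = 0" and u: "u \<in> K"
  shows "f (\<mu> u) = f \<alpha>"
  using z
proof (induction k)
  case 0
  have step: "f (\<mu> (of_real r * v)) = f (\<mu> v)" if "v \<in> K" for v
    using 0[OF that] iter_\<mu>[OF K_H[OF that], of 1 f] by (simp add: kill_def)
  have eq: "f (\<mu> (of_real (r ^ n) * u)) = f (\<mu> u)" for n
    by (induction n) (use step[OF K_scale[OF u r_power(1)]] in \<open>simp_all add: mult_ac\<close>)
  have "(\<lambda>u. f (\<mu> u)) holomorphic_on H" using f unfolding tame_def by (intro compose_\<mu>_holomorphic) auto
  then have "isCont (\<lambda>u. f (\<mu> u)) 0" by (rule holomorphic_isCont[OF _ open_H zero_in_H])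
  moreover have "(\<lambda>n. of_real (r ^ n) * u) \<longlonglongrightarrow> of_real 0 * u"
    using r by (intro tendsto_intros LIMSEQ_realpow_zero) auto
  ultimately have "(\<lambda>n. f (\<mu> (of_real (r ^ n) * u))) \<longlonglongrightarrow> f (\<mu> 0)" by (intro isCont_tendsto_compose[of 0 "\<lambda>u. f (\<mu> u)"]) auto
  then have "(\<lambda>n::nat. f (\<mu> u)) \<longlonglongrightarrow> f \<alpha>" unfolding eq by (simp add: \<mu>_0)
  then show ?case by (rule LIMSEQ_unique[OF tendsto_const])
next
  case (Suc k)
  show ?case
  proof (rule Suc.IH)
    fix u assume "u \<in> K"
    then show "kills (Suc k) f (\<mu> u) = 0"
      using Suc.prems by (intro kill_zero_imp_zero[of "kills (Suc k) f" "Suc k"] kills_tame f) auto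
  qed
qed

lemma one_minus_in_K: "1 - \<alpha> * cnj \<omega> \<in> K"
proof -
  have "(1 - \<alpha> * cnj \<omega>) * (1 - \<omega> * cnj \<alpha>) = (1 - \<alpha> * cnj \<omega>) * cnj (1 - \<alpha> * cnj \<omega>)" by simp
  also have "\<dots> = of_real ((cmod (1 - \<alpha> * cnj \<omega>))\<^sup>2)" by (simp only: complex_norm_square)
  finally have "ray (1 - \<alpha> * cnj \<omega>) = (cmod (1 - \<alpha> * cnj \<omega>))\<^sup>2" unfolding ray_def by simp
  moreover have "cmod (\<alpha> * cnj \<omega>) < 1" using \<alpha> \<omega> by (simp add: norm_mult)
  then have "1 - \<alpha> * cnj \<omega> \<noteq> 0" by auto
  ultimately show ?thesis unfolding K_def by simp
qed

text \<open>Solvability near w gives solvability on an open subset of an annulus inside the disc of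
  radius \<open>\<rho>\<^sub>0\<close>. The Laurent argument then makes f constant on the image of
  \<open>K\<close>, and analytic continuation in the connected set \<open>H\<close> extends this to
  the whole unit disc.\<close>

lemma local_spectrum_contains_disc:
  assumes f: "f \<in> hardy p" and w: "cmod w \<le> \<rho>\<^sub>0"
    and out: "w \<notin> local_spectrum (hardy p) (hardy_norm p) (comp_op \<phi>) f"
  shows "f = (\<lambda>z. if z \<in> ball 0 1 then f \<alpha> else 0)"
proof -
  obtain U F where U: "open U" "w \<in> U" and F: "\<And>z. z \<in> U \<Longrightarrow> F z \<in> hardy p"
    "\<And>z. z \<in> U \<Longrightarrow> (\<lambda>a. comp_op \<phi> (F z) a - z * F z a) = f"
    using out unfolding local_spectrum_def vholo_on_def by blast
  \<comment> \<open>w may lie on the bounding circle or be 0; the open set \<open>U\<close> still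
    contains some l with 0 < |l| < \<open>\<rho>\<^sub>0\<close>.\<close>
  have "w \<in> closure (ball 0 \<rho>\<^sub>0)" using w \<rho>\<^sub>0 by simp
  then have "U \<inter> ball 0 \<rho>\<^sub>0 \<noteq> {}" using open_Int_closure_eq_empty[OF U(1), of "ball 0 \<rho>\<^sub>0"] U(2) by blast
  moreover have "open (U \<inter> ball 0 \<rho>\<^sub>0)" using U by auto
  ultimately have "infinite (U \<inter> ball 0 \<rho>\<^sub>0)" using finite_imp_not_open by blast
  then have "\<not> U \<inter> ball 0 \<rho>\<^sub>0 \<subseteq> {0}" using finite_subset by blast
  then obtain l where l: "l \<in> U" "cmod l < \<rho>\<^sub>0" "l \<noteq> 0"
    by (metis IntE mem_ball_0 singletonI subsetI)
  \<comment> \<open>The smaller |l| is, the more Taylor coefficients must be removed before the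
    forward series converges. Passing to \<open>Suc k\<close> guarantees that \<open>kill 0\<close>
    is among the operators.\<close>
  obtain k where k: "r ^ k < cmod l" using real_arch_pow_inv[of "cmod l" r] l r by auto
  have "r ^ Suc k \<le> r ^ k" using r by (intro power_decreasing) auto
  then have k': "r ^ Suc k < cmod l" using k by linarith
  define V where "V = U \<inter> {l. r ^ Suc k < cmod l \<and> cmod l < \<rho>\<^sub>0}"
  have V: "open V" "V \<noteq> {}" unfolding V_def using U(1) l k'
    by (auto intro!: open_Int open_Collect_conj open_Collect_less continuous_intros)
  have fh: "f holomorphic_on ball 0 1" by (rule hardy_holomorphic[OF f])
  have zero: "kills (Suc k) f (\<mu> u) = 0" if "u \<in> K" for u
  proof (rule solvable_imp_zero_on_K[OF kills_tame[OF hardy_tame[OF f]] kills_vanishing[OF fh] _ V _ _ that])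
    fix l assume l: "l \<in> V"
    have "iter 1 (F l) z - l * F l z = f z" for z
      using fun_cong[OF F(2)[of l], of z] l unfolding V_def comp_op_eq_iter by simp
    from kills_equation[OF this] F(1)[of l] l
    show "\<exists>G. tame G \<and> vanishing (Suc k) G \<and> (\<forall>z. iter 1 G z - l * G z = kills (Suc k) f z)"
      unfolding V_def using kills_tame[OF hardy_tame] kills_vanishing[OF hardy_holomorphic] by blast
  qed (auto simp: V_def)
  have const: "f (\<mu> u) = f \<alpha>" if "u \<in> K" for u by (rule kills_zero_imp_const[OF hardy_tame[OF f] zero that])
  have "open K" unfolding K_def ray_def by (intro open_Collect_less continuous_intros)
  have "f (\<mu> u) = f \<alpha>" if "u \<in> H" for u
    using analytic_continuation_open[OF \<open>open K\<close> open_H _ convex_connected[OF convex_H] _ compose_\<mu>_holomorphic[OF fh] holomorphic_on_const const that]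
      one_minus_in_K K_H by blast
  then have "f z = f \<alpha>" if "z \<in> ball 0 1" for z using \<kappa>_in_H[OF that] \<mu>_\<kappa>[OF that] by metis
  then show ?thesis using hardy_outside[OF f] by auto
qed

end

section \<open>Property (C) and eigenvectors of the adjoint\<close>

text \<open>Cauchy's inequality on discs of radius d / 2 bounds the second derivative by 2 M / (d /
  2)^2 = 8 M / d^2. The remainder depends on q only through M, as uniformity over the unit ball of
  H^p requires.\<close>

lemma first_order_remainder:
  assumes q: "q holomorphic_on ball z R" and "cball z d \<subseteq> ball z R" "0 < d"
    and M: "\<And>x. x \<in> cball z d \<Longrightarrow> cmod (q x) \<le> M" and w: "cmod (w - z) \<le> d / 2"
  shows "cmod (q w - q z - deriv q z * (w - z)) \<le> 8 * M / d\<^sup>2 * (cmod (w - z))\<^sup>2"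
proof -
  define S where "S = cball z (d / 2)"
  have S: "x \<in> ball z R" if "x \<in> S" for x
    using that assms(2,3) unfolding S_def by (auto simp: subset_iff)
  have "cmod ((deriv ^^ 0) q w - (\<Sum>i\<le>1. (deriv ^^ i) q z * (w - z) ^ i / fact i))
    \<le> 8 * M / d\<^sup>2 * cmod (w - z) ^ Suc 1 / fact 1"
  proof (rule complex_Taylor)
    show "convex S" "z \<in> S" "w \<in> S" unfolding S_def using w \<open>0 < d\<close> by (auto simp: dist_norm norm_minus_commute)
    show "((deriv ^^ i) q has_field_derivative (deriv ^^ Suc i) q x) (at x within S)" if "x \<in> S" for i x
      using has_field_derivative_higher_deriv[OF q open_ball S[OF that], of i] by (rule has_field_derivative_at_within)
    show "cmod ((deriv ^^ Suc 1) q x) \<le> 8 * M / d\<^sup>2" if x: "x \<in> S" for x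
    proof -
      have sub: "cball x (d / 2) \<subseteq> cball z d"
      proof
        fix y assume y: "y \<in> cball x (d / 2)"
        have "dist z y \<le> dist z x + dist x y" by (rule dist_triangle)
        then show "y \<in> cball z d" using x y unfolding S_def by simp
      qed
      have "cmod ((deriv ^^ 2) q x) \<le> fact 2 * M / (d / 2) ^ 2"
      proof (rule Cauchy_inequality)
        show "q holomorphic_on ball x (d / 2)"
          using sub assms(2) by (intro holomorphic_on_subset[OF q]) (auto simp: subset_iff)
        show "continuous_on (cball x (d / 2)) q"
          using sub assms(2) by (intro continuous_on_subset[OF holomorphic_on_imp_continuous_on[OF q]]) auto
        show "cmod (q y) \<le> M" if "cmod (x - y) = d / 2" for y
          using M[of y] sub that by (auto simp: dist_norm subset_iff)
      qed (use \<open>0 < d\<close> in auto)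
      also have "\<dots> = 8 * M / d\<^sup>2" by (simp add: power_divide)
      finally show ?thesis by (simp add: numeral_2_eq_2)
    qed
  qed
  then show ?thesis by (simp add: numeral_2_eq_2 algebra_simps)
qed

lemma dual_norm_bounds:
  assumes p: "0 < p" and B: "\<And>f. f \<in> hardy p \<Longrightarrow> hardy_norm p f \<le> 1 \<Longrightarrow> cmod (L f) \<le> B"
  shows "0 \<le> dual_norm p L" "dual_norm p L \<le> B"
proof -
  have z: "(\<lambda>_. 0) \<in> {f\<in>hardy p. hardy_norm p f \<le> 1}" using hardy_zero[OF p] by simp
  then show "dual_norm p L \<le> B" unfolding dual_norm_def using B by (intro cSUP_least) auto
  have "cmod (L (\<lambda>_. 0)) \<le> dual_norm p L"
    unfolding dual_norm_def using z B by (intro cSUP_upper bdd_aboveI[of _ B]) auto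
  then show "0 \<le> dual_norm p L" using norm_ge_zero order_trans by blast
qed

text \<open>Pointwise holomorphy with local norm bounds implies norm holomorphy: the pointwise
  derivative \<open>G\<close> is a bounded functional by Cauchy's inequality, and the first-order
  remainder is uniform over the unit ball.\<close>

lemma dual_holomorphic:
  assumes p: "1 < p" and U: "open U" and dual: "\<And>l. l \<in> U \<Longrightarrow> F l \<in> hardy_dual p"
    and hol: "\<And>f. f \<in> hardy p \<Longrightarrow> (\<lambda>l. F l f) holomorphic_on U"
    and bound: "\<And>z. z \<in> U \<Longrightarrow> \<exists>d>0. \<exists>M. cball z d \<subseteq> U \<and> (\<forall>l\<in>cball z d. \<forall>f\<in>hardy p. cmod (F l f) \<le> M * hardy_norm p f)"
  shows "vholo_on (hardy_dual p) (dual_norm p) U F"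
  unfolding vholo_on_def
proof (intro conjI ballI U dual)
  fix z assume z: "z \<in> U"
  have p0: "0 < p" using p by simp
  obtain e M where e: "0 < e" "cball z e \<subseteq> U" and M: "\<And>l f. l \<in> cball z e \<Longrightarrow> f \<in> hardy p \<Longrightarrow> cmod (F l f) \<le> M * hardy_norm p f"
    using bound[OF z] by blast
  define d where "d = e / 2"
  have d: "0 < d" "cball z d \<subseteq> ball z e" "ball z e \<subseteq> U" "cball z d \<subseteq> cball z e" unfolding d_def using e by auto
  define G where "G = (\<lambda>f. if f \<in> hardy p then deriv (\<lambda>l. F l f) z else 0)"
  have hol_e: "(\<lambda>l. F l f) holomorphic_on ball z e" if "f \<in> hardy p" for f
    using hol[OF that] d(3) by (rule holomorphic_on_subset)
  have fd: "(\<lambda>l. F l f) field_differentiable at z" if "f \<in> hardy p" for f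
    using hol[OF that] U z holomorphic_on_imp_differentiable_at by blast
  have ev: "\<forall>\<^sub>F l in nhds z. l \<in> U" using U z by (rule eventually_nhds_in_open)
  have G: "G \<in> hardy_dual p"
    unfolding hardy_dual_def mem_Collect_eq
  proof (intro conjI ballI allI impI)
    fix f g assume f: "f \<in> hardy p" and g: "g \<in> hardy p"
    have "deriv (\<lambda>l. F l (\<lambda>z. f z + g z)) z = deriv (\<lambda>l. F l f + F l g) z"
      by (rule deriv_cong_ev[OF eventually_mono[OF ev] refl]) (use dual f g in \<open>auto simp: hardy_dual_def\<close>)
    also have "\<dots> = deriv (\<lambda>l. F l f) z + deriv (\<lambda>l. F l g) z" using f g by (intro deriv_add fd)
    finally show "G (\<lambda>z. f z + g z) = G f + G g" unfolding G_def using f g hardy_add(1)[OF f g p] by simp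
  next
    fix f c assume f: "f \<in> hardy p"
    have "deriv (\<lambda>l. F l (\<lambda>z. c * f z)) z = deriv (\<lambda>l. c * F l f) z"
      by (rule deriv_cong_ev[OF eventually_mono[OF ev] refl]) (use dual f in \<open>auto simp: hardy_dual_def\<close>)
    also have "\<dots> = c * deriv (\<lambda>l. F l f) z" using f by (intro deriv_cmult fd)
    finally show "G (\<lambda>z. c * f z) = c * G f" unfolding G_def using f hardy_scale(1)[OF f p0] by simp
  next
    have "cmod (G f) \<le> M / d * hardy_norm p f" if f: "f \<in> hardy p" for f
    proof -
      have "cmod ((deriv ^^ 1) (\<lambda>l. F l f) z) \<le> fact 1 * (M * hardy_norm p f) / d ^ 1"
      proof (rule Cauchy_inequality)
        show "(\<lambda>l. F l f) holomorphic_on ball z d"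
          using d by (intro holomorphic_on_subset[OF hol_e[OF f]]) auto
        show "continuous_on (cball z d) (\<lambda>l. F l f)"
          using d by (intro continuous_on_subset[OF holomorphic_on_imp_continuous_on[OF hol_e[OF f]]]) auto
        show "cmod (F x f) \<le> M * hardy_norm p f" if "cmod (z - x) = d" for x
          using M[OF _ f, of x] d that by (auto simp: dist_norm subset_iff)
      qed (use d in auto)
      then show ?thesis using f by (simp add: G_def)
    qed
    then show "\<exists>K. \<forall>f\<in>hardy p. cmod (G f) \<le> K * hardy_norm p f" by blast
  next
    fix f assume "f \<notin> hardy p" then show "G f = 0" by (simp add: G_def)
  qed
  have "((\<lambda>w. dual_norm p (\<lambda>f. (F w f - F z f) / (w - z) - G f)) \<longlongrightarrow> 0) (at z)"
  proof (rule tendsto_0_le[of "\<lambda>w. w - z" _ _ "8 * \<bar>M\<bar> / d\<^sup>2"])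
    show "((\<lambda>w. w - z) \<longlongrightarrow> 0) (at z)" by (rule LIM_zero) (rule tendsto_ident_at)
    have "\<forall>\<^sub>F w in at z. w \<in> ball z (d / 2) - {z}" using d by (intro eventually_at_in_open) auto
    then show "\<forall>\<^sub>F w in at z. norm (dual_norm p (\<lambda>f. (F w f - F z f) / (w - z) - G f)) \<le> norm (w - z) * (8 * \<bar>M\<bar> / d\<^sup>2)"
    proof eventually_elim
      case (elim w)
      have w: "w \<noteq> z" "cmod (w - z) \<le> d / 2" using elim by (auto simp: dist_norm norm_minus_commute)
      have "cmod ((F w f - F z f) / (w - z) - G f) \<le> norm (w - z) * (8 * \<bar>M\<bar> / d\<^sup>2)"
        if f: "f \<in> hardy p" "hardy_norm p f \<le> 1" for f
      proof -
        have "cmod (F x f) \<le> \<bar>M\<bar>" if "x \<in> cball z d" for x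
        proof -
          have "cmod (F x f) \<le> M * hardy_norm p f" using M[OF _ f(1)] that d by blast
          also have "\<dots> \<le> \<bar>M\<bar> * 1" using f hardy_norm_nonneg by (intro mult_mono) auto
          finally show ?thesis by simp
        qed
        from first_order_remainder[OF hol_e[OF f(1)] d(2,1) this w(2)]
        have le: "cmod (F w f - F z f - G f * (w - z)) \<le> 8 * \<bar>M\<bar> / d\<^sup>2 * (cmod (w - z))\<^sup>2" using f by (simp add: G_def)
        have "(F w f - F z f) / (w - z) - G f = (F w f - F z f - G f * (w - z)) / (w - z)"
          using w by (simp add: diff_divide_distrib)
        then have "cmod ((F w f - F z f) / (w - z) - G f) = cmod (F w f - F z f - G f * (w - z)) / cmod (w - z)"
          by (simp add: norm_divide)
        also have "\<dots> \<le> 8 * \<bar>M\<bar> / d\<^sup>2 * (cmod (w - z))\<^sup>2 / cmod (w - z)" using le by (intro divide_right_mono) auto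
        also have "\<dots> = norm (w - z) * (8 * \<bar>M\<bar> / d\<^sup>2)" using w by (simp add: power2_eq_square)
        finally show ?thesis .
      qed
      from dual_norm_bounds[OF p0 this] show ?case by simp
    qed
  qed
  then show "\<exists>G\<in>hardy_dual p. ((\<lambda>w. dual_norm p (\<lambda>f. (F w f - F z f) / (w - z) - G f)) \<longlongrightarrow> 0) (at z)"
    using G by (rule bexI)
qed

section \<open>Property (C) of the composition operator\<close>

context second_kind
begin

text \<open>A point w outside S imposes closed conditions on every member of the sequence: vanishing
  at \<alpha> if w = 1, constancy if |w| \<le> \<open>\<rho>\<^sub>0\<close>. Point evaluations are
  continuous, so the limit inherits them, and \<open>not_in_local_spectrum\<close> translates them
  back.\<close>

lemma property_C_comp_op: "property_C (hardy p) (hardy_norm p) (comp_op \<phi>)"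
  unfolding property_C_def norm_closed_in_def
proof (intro allI impI, elim conjE)
  fix S xs x
  assume S: "closed S" and xs: "\<forall>n. xs n \<in> local_spectral_subspace (hardy p) (hardy_norm p) (comp_op \<phi>) S"
    and x: "x \<in> hardy p" and lim: "(\<lambda>n. hardy_norm p (\<lambda>a. xs n a - x a)) \<longlonglongrightarrow> 0"
  have xn: "xs n \<in> hardy p" and sub: "local_spectrum (hardy p) (hardy_norm p) (comp_op \<phi>) (xs n) \<subseteq> S" for n
    using xs unfolding local_spectral_subspace_def by auto
  have pt: "(\<lambda>n. xs n z) \<longlonglongrightarrow> x z" if z: "z \<in> ball 0 1" for z
  proof -
    have "(\<lambda>n. xs n z - x z) \<longlonglongrightarrow> 0"
    proof (rule tendsto_0_le[OF lim, of _ "(4 / (1 - cmod z)) powr (1 / p)"])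
      show "\<forall>\<^sub>F n in sequentially. norm (xs n z - x z) \<le> norm (hardy_norm p (\<lambda>a. xs n a - x a)) * (4 / (1 - cmod z)) powr (1 / p)"
        using hardy_growth[OF hardy_diff(1)[OF xn x p] p, of z] z hardy_norm_nonneg
        by (intro always_eventually allI) (simp add: mult.commute)
    qed
    then show ?thesis by (simp add: LIM_zero_iff)
  qed
  have \<alpha>b: "\<alpha> \<in> ball 0 1" using \<alpha> by simp
  have "w \<notin> local_spectrum (hardy p) (hardy_norm p) (comp_op \<phi>) x" if w: "w \<notin> S" for w
  proof (rule not_in_local_spectrum[OF x])
    have out: "w \<notin> local_spectrum (hardy p) (hardy_norm p) (comp_op \<phi>) (xs n)" for n using sub w by blast
    show "x \<alpha> = 0 \<or> w \<noteq> 1"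
    proof (cases "w = 1")
      case True
      then have "xs n \<alpha> = 0" for n using one_in_local_spectrum out by blast
      then have "(\<lambda>n::nat. 0) \<longlonglongrightarrow> x \<alpha>" using pt[OF \<alpha>b] by simp
      then show ?thesis using LIMSEQ_unique[OF tendsto_const] by metis
    qed simp
    show "\<rho>\<^sub>0 < cmod w \<or> x = (\<lambda>z. if z \<in> ball 0 1 then x \<alpha> else 0)"
    proof (cases "\<rho>\<^sub>0 < cmod w")
      case False
      then have c: "xs n = (\<lambda>z. if z \<in> ball 0 1 then xs n \<alpha> else 0)" for n
        by (intro local_spectrum_contains_disc[OF xn _ out]) simp
      have "x z = x \<alpha>" if z: "z \<in> ball 0 1" for z
      proof -
        have "xs n z = xs n \<alpha>" for n using fun_cong[OF c, of n z] z by simp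
        then show ?thesis using LIMSEQ_unique[OF pt[OF z]] pt[OF \<alpha>b] by simp
      qed
      then show ?thesis using hardy_outside[OF x] by auto
    qed simp
  qed
  then show "x \<in> local_spectral_subspace (hardy p) (hardy_norm p) (comp_op \<phi>) S"
    unfolding local_spectral_subspace_def using x by blast
qed

section \<open>An analytic family of eigenvectors of the adjoint\<close>

definition "u\<^sub>0 = 1 - \<alpha> * cnj \<omega>"
definition "fwd f n = f (\<mu> (of_real (r ^ n) * u\<^sub>0)) - f \<alpha>"
text \<open>The exponent starts at 1 because the point \<open>u\<^sub>0\<close> itself is already
  counted in \<open>fwd f 0\<close>.\<close>

definition "bwd f n = f (\<mu> (of_real ((1 / r) ^ Suc n) * u\<^sub>0)) - f \<alpha>"

text \<open>For \<open>r < |l| < \<rho>\<^sub>0\<close> this is an eigenvector of the adjoint for the eigenvalue \<open>l\<close>.\<close>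

definition eigenfunctional :: "complex \<Rightarrow> (complex \<Rightarrow> complex) \<Rightarrow> complex" where
  "eigenfunctional l f = (if f \<in> hardy p then two_sided (fwd f) (bwd f) l else 0)"

definition "\<Omega> = {l. r < cmod l \<and> cmod l < \<rho>\<^sub>0}"

lemma u\<^sub>0: "u\<^sub>0 \<in> K"
  unfolding u\<^sub>0_def by (rule one_minus_in_K)

text \<open>The constant must be uniform in f. So f - f \<alpha> is divided by z - \<alpha> and the
  quotient bounded by the maximum principle on a disc containing the forward orbit; the remaining
  factor z - \<alpha> is the same for all f and decays like r ^ n.\<close>

lemma fwd_bound:
  obtains A where "0 \<le> A" "\<And>f n. f \<in> hardy p \<Longrightarrow> cmod (fwd f n) \<le> A * hardy_norm p f * r ^ n"
proof -
  define d where "d = (1 - cmod \<alpha>) / 2"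
  \<comment> \<open>The forward orbit of \<open>u\<^sub>0\<close> stays in |z| \<le> R by
    \<open>\<mu>_away_from_circle\<close> with d = 0; \<open>u\<^sub>0\<close> has the form required
    there.\<close>
  define R where "R = 1 - (1 - cmod \<alpha>)\<^sup>2 / 18"
  have d: "0 < d" unfolding d_def using \<alpha> by simp
  have R1: "R < 1" unfolding R_def using \<alpha> by simp
  have R\<alpha>: "d \<le> R - cmod \<alpha>"
  proof -
    have "(1 - cmod \<alpha>)\<^sup>2 \<le> (1 - cmod \<alpha>) ^ 1" using \<alpha> by (intro power_decreasing) auto
    then show ?thesis unfolding R_def d_def using \<alpha> by simp
  qed
  have R0: "0 < R" using R\<alpha> d norm_ge_zero[of \<alpha>] by linarith
  define G where "G = (4 / (1 - R)) powr (1 / p)"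
  have G: "cmod (f z) \<le> G * hardy_norm p f" if "f \<in> hardy p" "cmod z \<le> R" for f z
    unfolding G_def by (rule hardy_growth_mono[OF that(1) p that(2) R1 order_refl])
  have G0: "0 \<le> G" unfolding G_def by simp
  have lip: "cmod (f z - f \<alpha>) \<le> cmod (z - \<alpha>) * (2 * G * hardy_norm p f / d)" if f: "f \<in> hardy p" and z: "cmod z \<le> R" for f z
  proof -
    have "(\<lambda>z. f z - f \<alpha>) holomorphic_on ball 0 1" using hardy_holomorphic[OF f] by (intro holomorphic_intros)
    then obtain h where h: "h holomorphic_on ball 0 1" "\<And>z. z \<in> ball 0 1 \<Longrightarrow> f z - f \<alpha> = (z - \<alpha>) * h z"
      using divide_zero[of "\<lambda>z. f z - f \<alpha>"] by auto
    have sub: "cball 0 R \<subseteq> ball (0::complex) 1" using R1 by auto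
    have "cmod (h z) \<le> 2 * G * hardy_norm p f / d"
    proof (rule maximum_modulus_frontier[of h "cball 0 R"])
      show "h holomorphic_on interior (cball 0 R)"
        using sub interior_subset by (intro holomorphic_on_subset[OF h(1)]) blast
      show "continuous_on (closure (cball 0 R)) h"
        using sub by (intro continuous_on_subset[OF holomorphic_on_imp_continuous_on[OF h(1)]]) simp
      fix y :: complex assume "y \<in> frontier (cball 0 R)"
      then have y: "cmod y = R" using R0 by simp
      have "d * cmod (h y) \<le> cmod (y - \<alpha>) * cmod (h y)"
        using norm_triangle_ineq2[of y \<alpha>] R\<alpha> y by (intro mult_right_mono) auto
      also have "\<dots> = cmod (f y - f \<alpha>)" using h(2)[of y] R1 y by (simp add: norm_mult)
      also have "\<dots> \<le> cmod (f y) + cmod (f \<alpha>)" by (rule norm_triangle_ineq4)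
      also have "\<dots> \<le> G * hardy_norm p f + G * hardy_norm p f"
        using y d R\<alpha> by (intro add_mono G[OF f]) auto
      finally show "cmod (h y) \<le> 2 * G * hardy_norm p f / d" using d by (simp add: pos_le_divide_eq mult_ac)
    qed (use z in auto)
    moreover have "z \<in> ball 0 1" using z R1 by simp
    ultimately show ?thesis unfolding h(2)[OF \<open>z \<in> ball 0 1\<close>] norm_mult by (intro mult_left_mono) auto
  qed
  have v: "vanishing 1 (\<lambda>z. z - \<alpha>)"
    unfolding vanishing_def
  proof (intro exI conjI ballI)
    show "(\<lambda>u. (\<omega> - \<alpha>) / (1 + u)) holomorphic_on H" using H_nonzero by (intro holomorphic_intros) auto
    show "\<mu> u - \<alpha> = u ^ 1 * ((\<omega> - \<alpha>) / (1 + u))" if "u \<in> H" for u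
      unfolding \<mu>_def using H_nonzero[OF that] by (simp add: field_simps)
  qed
  obtain A0 where A0: "\<And>n. cmod (\<mu> (of_real (r ^ n) * u\<^sub>0) - \<alpha>) \<le> A0 * (r ^ 1) ^ n"
    using vanishing_decay[OF v K_H[OF u\<^sub>0]] by blast
  have A00: "0 \<le> A0" using order_trans[OF norm_ge_zero A0[of 0]] by simp
  have "cmod (fwd f n) \<le> (A0 * (2 * G / d)) * hardy_norm p f * r ^ n" if f: "f \<in> hardy p" for f n
  proof -
    have "cmod (\<mu> (of_real (r ^ n) * u\<^sub>0)) \<le> R"
      using \<mu>_away_from_circle[of "r ^ n" 0 "of_real (r ^ n) * u\<^sub>0"] r_power[of n] unfolding R_def u\<^sub>0_def by simp
    from lip[OF f this]
    have "cmod (fwd f n) \<le> cmod (\<mu> (of_real (r ^ n) * u\<^sub>0) - \<alpha>) * (2 * G * hardy_norm p f / d)" unfolding fwd_def .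
    also have "\<dots> \<le> (A0 * r ^ n) * (2 * G * hardy_norm p f / d)"
      using A0[of n] G0 d hardy_norm_nonneg by (intro mult_right_mono) auto
    finally show ?thesis by (simp add: mult_ac)
  qed
  moreover have "0 \<le> A0 * (2 * G / d)" using A00 G0 d by simp
  ultimately show ?thesis using that by blast
qed

lemma bwd_bound:
  obtains B where "0 \<le> B" "\<And>f n. f \<in> hardy p \<Longrightarrow> cmod (bwd f n) \<le> B * hardy_norm p f * (1 / \<rho>\<^sub>0) ^ n"
proof -
  obtain C where C: "0 < C" "\<And>f n. f \<in> hardy p \<Longrightarrow> cmod (f (\<mu> (of_real ((1 / r) ^ n) * u\<^sub>0))) \<le> C * hardy_norm p f * (1 / \<rho>\<^sub>0) ^ n"
    using ray_growth[OF u\<^sub>0] by blast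
  define G where "G = (4 / (1 - cmod \<alpha>)) powr (1 / p)"
  have "cmod (bwd f n) \<le> (C / \<rho>\<^sub>0 + G) * hardy_norm p f * (1 / \<rho>\<^sub>0) ^ n" if f: "f \<in> hardy p" for f n
  proof -
    have "cmod (bwd f n) \<le> cmod (f (\<mu> (of_real ((1 / r) ^ Suc n) * u\<^sub>0))) + cmod (f \<alpha>)"
      unfolding bwd_def by (rule norm_triangle_ineq4)
    also have "\<dots> \<le> C * hardy_norm p f * (1 / \<rho>\<^sub>0) ^ Suc n + G * hardy_norm p f * 1"
      using hardy_growth[OF f p \<alpha>] unfolding G_def by (intro add_mono C(2)[OF f]) simp
    also have "\<dots> \<le> C * hardy_norm p f * (1 / \<rho>\<^sub>0) ^ Suc n + G * hardy_norm p f * (1 / \<rho>\<^sub>0) ^ n"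
    proof (intro add_left_mono mult_left_mono)
      show "1 \<le> (1 / \<rho>\<^sub>0) ^ n" using \<rho>\<^sub>0 by (intro one_le_power) simp
    qed (simp add: G_def hardy_norm_nonneg)
    also have "\<dots> = (C / \<rho>\<^sub>0 + G) * hardy_norm p f * (1 / \<rho>\<^sub>0) ^ n" by (simp add: algebra_simps)
    finally show ?thesis .
  qed
  moreover have "0 \<le> C / \<rho>\<^sub>0 + G" unfolding G_def using C \<rho>\<^sub>0 by simp
  ultimately show ?thesis using that by blast
qed

lemma
  assumes f: "f \<in> hardy p"
  shows fwd_geometric: "\<exists>A. \<forall>n. cmod (fwd f n) \<le> A * r ^ n"
    and bwd_geometric: "\<exists>B. \<forall>n. cmod (bwd f n) \<le> B * (1 / \<rho>\<^sub>0) ^ n"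
proof -
  obtain A where A: "0 \<le> A" "\<And>f n. f \<in> hardy p \<Longrightarrow> cmod (fwd f n) \<le> A * hardy_norm p f * r ^ n" using fwd_bound by blast
  obtain B where B: "0 \<le> B" "\<And>f n. f \<in> hardy p \<Longrightarrow> cmod (bwd f n) \<le> B * hardy_norm p f * (1 / \<rho>\<^sub>0) ^ n" using bwd_bound by blast
  show "\<exists>A. \<forall>n. cmod (fwd f n) \<le> A * r ^ n" "\<exists>B. \<forall>n. cmod (bwd f n) \<le> B * (1 / \<rho>\<^sub>0) ^ n"
    using A(2)[OF f] B(2)[OF f] by blast+
qed

lemma fwd_summable: assumes "f \<in> hardy p" "l \<in> \<Omega>" shows "summable (\<lambda>n. fwd f n * (1 / l) ^ n)"
proof -
  obtain A where A: "\<And>n. cmod (fwd f n) \<le> A * r ^ n" using fwd_geometric[OF assms(1)] by blast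
  have "r * cmod (1 / l) < 1" using assms(2) r unfolding \<Omega>_def by (auto simp: norm_divide divide_less_eq_1)
  then show ?thesis using r by (intro power_series_bound(1)[OF A]) auto
qed

lemma bwd_summable: assumes "f \<in> hardy p" "l \<in> \<Omega>" shows "summable (\<lambda>n. bwd f n * l ^ n)"
proof -
  obtain B where B: "\<And>n. cmod (bwd f n) \<le> B * (1 / \<rho>\<^sub>0) ^ n" using bwd_geometric[OF assms(1)] by blast
  show ?thesis using assms(2) \<rho>\<^sub>0 unfolding \<Omega>_def by (intro power_series_bound(1)[OF B]) auto
qed

lemma eigenfunctional_add:
  assumes f: "f \<in> hardy p" and g: "g \<in> hardy p" and l: "l \<in> \<Omega>"
  shows "eigenfunctional l (\<lambda>z. f z + g z) = eigenfunctional l f + eigenfunctional l g"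
proof -
  have e: "fwd (\<lambda>z. f z + g z) n * x = fwd f n * x + fwd g n * x" "bwd (\<lambda>z. f z + g z) n * x = bwd f n * x + bwd g n * x" for n x
    unfolding fwd_def bwd_def by (simp_all add: algebra_simps)
  have "two_sided (fwd (\<lambda>z. f z + g z)) (bwd (\<lambda>z. f z + g z)) l = two_sided (fwd f) (bwd f) l + two_sided (fwd g) (bwd g) l"
    unfolding two_sided_def e suminf_add[OF fwd_summable[OF f l] fwd_summable[OF g l], symmetric]
      suminf_add[OF bwd_summable[OF f l] bwd_summable[OF g l], symmetric]
    by (simp add: distrib_left)
  then show ?thesis unfolding eigenfunctional_def using f g hardy_add(1)[OF f g p] by simp
qed

lemma eigenfunctional_scale:
  assumes f: "f \<in> hardy p" and l: "l \<in> \<Omega>"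
  shows "eigenfunctional l (\<lambda>z. c * f z) = c * eigenfunctional l f"
proof -
  have e: "fwd (\<lambda>z. c * f z) n * x = c * (fwd f n * x)" "bwd (\<lambda>z. c * f z) n * x = c * (bwd f n * x)" for n x
    unfolding fwd_def bwd_def by (simp_all add: algebra_simps)
  have "two_sided (fwd (\<lambda>z. c * f z)) (bwd (\<lambda>z. c * f z)) l = c * two_sided (fwd f) (bwd f) l"
    unfolding two_sided_def e suminf_mult[OF fwd_summable[OF f l]] suminf_mult[OF bwd_summable[OF f l]]
    by (simp add: distrib_left)
  then show ?thesis unfolding eigenfunctional_def using f hardy_scale(1)[OF f] p by simp
qed

text \<open>Composition shifts the two-sided sequence of orbit values by one place, which multiplies
  the Laurent series by l; the term at \<open>u\<^sub>0\<close> moves from \<open>fwd\<close> to the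
  head of \<open>bwd\<close>.\<close>

lemma eigenfunctional_iter:
  assumes f: "f \<in> hardy p" and l: "l \<in> \<Omega>"
  shows "eigenfunctional l (iter 1 f) = l * eigenfunctional l f"
proof -
  have l0: "l \<noteq> 0" using l r by (auto simp: \<Omega>_def)
  have F: "fwd (iter 1 f) n = fwd f (Suc n)" for n
    unfolding fwd_def iter_\<mu>[OF H_iter[OF K_H[OF u\<^sub>0]]] iter_\<alpha> by (simp add: mult_ac)
  have bH: "of_real ((1 / r) ^ Suc n) * u\<^sub>0 \<in> H" for n using r by (intro K_scale_in_H[OF u\<^sub>0]) simp
  have shift: "of_real (r ^ 1) * (of_real ((1 / r) ^ Suc n) * u\<^sub>0) = of_real ((1 / r) ^ n) * u\<^sub>0" for n using r by simp
  have B0: "bwd (iter 1 f) 0 = fwd f 0"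
    unfolding bwd_def fwd_def iter_\<mu>[OF bH] iter_\<alpha> shift by simp
  have B: "bwd (iter 1 f) (Suc n) = bwd f n" for n
    unfolding bwd_def iter_\<mu>[OF bH] iter_\<alpha> shift by simp
  have h: "iter 1 f \<in> hardy p" using iter_hardy[OF f] .
  have "(\<Sum>n. bwd (iter 1 f) n * l ^ n) = bwd (iter 1 f) 0 + (\<Sum>n. bwd (iter 1 f) (Suc n) * l ^ Suc n)"
    using suminf_split_head[OF bwd_summable[OF h l]] by simp
  also have "(\<Sum>n. bwd (iter 1 f) (Suc n) * l ^ Suc n) = (\<Sum>n. l * (bwd f n * l ^ n))" unfolding B by (simp add: mult_ac)
  also have "\<dots> = l * (\<Sum>n. bwd f n * l ^ n)" by (rule suminf_mult[OF bwd_summable[OF f l]])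
  finally have 1: "(\<Sum>n. bwd (iter 1 f) n * l ^ n) = fwd f 0 + l * (\<Sum>n. bwd f n * l ^ n)" unfolding B0 .
  have "(\<Sum>n. fwd f n * (1 / l) ^ n) = fwd f 0 + (\<Sum>n. fwd f (Suc n) * (1 / l) ^ Suc n)"
    using suminf_split_head[OF fwd_summable[OF f l]] by simp
  also have "(\<Sum>n. fwd f (Suc n) * (1 / l) ^ Suc n) = (\<Sum>n. 1 / l * (fwd (iter 1 f) n * (1 / l) ^ n))" unfolding F by (simp add: mult_ac)
  also have "\<dots> = 1 / l * (\<Sum>n. fwd (iter 1 f) n * (1 / l) ^ n)" by (rule suminf_mult[OF fwd_summable[OF h l]])
  finally have 2: "(\<Sum>n. fwd f n * (1 / l) ^ n) = fwd f 0 + 1 / l * (\<Sum>n. fwd (iter 1 f) n * (1 / l) ^ n)" .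
  show ?thesis unfolding eigenfunctional_def two_sided_def using f h 1 2 l0 by (simp add: distrib_left)
qed

lemma eigenfunctional_bound:
  obtains B where "\<And>l f. l \<in> \<Omega> \<Longrightarrow> f \<in> hardy p \<Longrightarrow>
      cmod (eigenfunctional l f) \<le> B * (1 / (1 - cmod l / \<rho>\<^sub>0) + 1 / (cmod l - r)) * hardy_norm p f"
proof -
  obtain A where A: "0 \<le> A" "\<And>f n. f \<in> hardy p \<Longrightarrow> cmod (fwd f n) \<le> A * hardy_norm p f * r ^ n" using fwd_bound by blast
  obtain B where B: "0 \<le> B" "\<And>f n. f \<in> hardy p \<Longrightarrow> cmod (bwd f n) \<le> B * hardy_norm p f * (1 / \<rho>\<^sub>0) ^ n" using bwd_bound by blast
  show ?thesis
  proof (rule that[of "A + B"])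
    fix l f assume l: "l \<in> \<Omega>" and f: "f \<in> hardy p"
    have l': "r < cmod l" "cmod l < \<rho>\<^sub>0" using l by (auto simp: \<Omega>_def)
    have "cmod (two_sided (fwd f) (bwd f) l) \<le> B * hardy_norm p f / (1 - cmod l / \<rho>\<^sub>0) + A * hardy_norm p f / (cmod l - r)"
      by (rule two_sided_bound[OF A(2)[OF f] B(2)[OF f] r(1) \<rho>\<^sub>0(3) l'])
    also have "\<dots> \<le> (A + B) * hardy_norm p f / (1 - cmod l / \<rho>\<^sub>0) + (A + B) * hardy_norm p f / (cmod l - r)"
      using A B hardy_norm_nonneg[of p f] l' \<rho>\<^sub>0 by (intro add_mono divide_right_mono mult_right_mono) auto
    finally show "cmod (eigenfunctional l f) \<le> (A + B) * (1 / (1 - cmod l / \<rho>\<^sub>0) + 1 / (cmod l - r)) * hardy_norm p f"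
      using f by (simp add: eigenfunctional_def algebra_simps)
  qed
qed

lemma eigenfunctional_dual: assumes "l \<in> \<Omega>" shows "eigenfunctional l \<in> hardy_dual p"
  unfolding hardy_dual_def mem_Collect_eq
proof (intro conjI ballI allI impI)
  show "\<exists>K. \<forall>f\<in>hardy p. cmod (eigenfunctional l f) \<le> K * hardy_norm p f"
    using eigenfunctional_bound assms by metis
qed (use assms eigenfunctional_add eigenfunctional_scale in \<open>auto simp: eigenfunctional_def\<close>)

lemma open_\<Omega>: "open \<Omega>"
  unfolding \<Omega>_def by (intro open_Collect_conj open_Collect_less continuous_intros)

lemma \<Omega>_nonempty: "\<Omega> \<noteq> {}"
proof -
  obtain x where "r < x" "x < \<rho>\<^sub>0" using dense[OF \<rho>\<^sub>0(3)] by blast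
  then have "of_real x \<in> \<Omega>" using r by (simp add: \<Omega>_def)
  then show ?thesis by blast
qed

lemma eigenfunctional_holomorphic:
  assumes f: "f \<in> hardy p" shows "(\<lambda>l. eigenfunctional l f) holomorphic_on \<Omega>"
proof -
  obtain A B where "\<And>n. cmod (fwd f n) \<le> A * r ^ n" "\<And>n. cmod (bwd f n) \<le> B * (1 / \<rho>\<^sub>0) ^ n"
    using fwd_geometric[OF f] bwd_geometric[OF f] by blast
  from two_sided_holomorphic[OF this r(1) \<rho>\<^sub>0(3)] show ?thesis using f by (simp add: eigenfunctional_def \<Omega>_def)
qed

lemma eigenfunctional_vholo: "vholo_on (hardy_dual p) (dual_norm p) \<Omega> eigenfunctional"
proof (rule dual_holomorphic[OF p open_\<Omega> eigenfunctional_dual eigenfunctional_holomorphic])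
  fix z assume z: "z \<in> \<Omega>"
  obtain d where d: "0 < d" "cball z d \<subseteq> \<Omega>" using open_\<Omega> z open_contains_cball by blast
  obtain B where B: "\<And>l f. l \<in> \<Omega> \<Longrightarrow> f \<in> hardy p \<Longrightarrow>
      cmod (eigenfunctional l f) \<le> B * (1 / (1 - cmod l / \<rho>\<^sub>0) + 1 / (cmod l - r)) * hardy_norm p f"
    using eigenfunctional_bound by blast
  have "continuous_on (cball z d) (\<lambda>l. B * (1 / (1 - cmod l / \<rho>\<^sub>0) + 1 / (cmod l - r)))"
    using d(2) \<rho>\<^sub>0 unfolding \<Omega>_def by (intro continuous_intros) (auto simp: subset_iff)
  then have "bounded ((\<lambda>l. B * (1 / (1 - cmod l / \<rho>\<^sub>0) + 1 / (cmod l - r))) ` cball z d)"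
    by (intro compact_imp_bounded compact_continuous_image compact_cball)
  then obtain M where "\<forall>x\<in>(\<lambda>l. B * (1 / (1 - cmod l / \<rho>\<^sub>0) + 1 / (cmod l - r))) ` cball z d. norm x \<le> M"
    unfolding bounded_iff by blast
  then have M: "\<bar>B * (1 / (1 - cmod l / \<rho>\<^sub>0) + 1 / (cmod l - r))\<bar> \<le> M" if "l \<in> cball z d" for l
    using that by simp
  have "cmod (eigenfunctional l f) \<le> M * hardy_norm p f" if "l \<in> cball z d" "f \<in> hardy p" for l f
  proof -
    have "cmod (eigenfunctional l f) \<le> B * (1 / (1 - cmod l / \<rho>\<^sub>0) + 1 / (cmod l - r)) * hardy_norm p f"
      using that d by (intro B) auto
    also have "\<dots> \<le> M * hardy_norm p f" using M[OF that(1)] hardy_norm_nonneg by (intro mult_right_mono) auto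
    finally show ?thesis .
  qed
  then show "\<exists>d>0. \<exists>M. cball z d \<subseteq> \<Omega> \<and> (\<forall>l\<in>cball z d. \<forall>f\<in>hardy p. cmod (eigenfunctional l f) \<le> M * hardy_norm p f)"
    using d by blast
qed

text \<open>If all the eigenvectors vanished, the Laurent series of the identity function would be
  zero, and so would its coefficient \<open>bwd f 0\<close>. Then \<open>\<mu>\<close> would take
  the value \<alpha> at \<open>u\<^sub>0\<close> / r as well as at 0, against injectivity.\<close>

lemma not_SVEP_adjoint: "\<not> SVEP (hardy_dual p) (dual_norm p) (hardy_adjoint p (comp_op \<phi>))"
proof
  assume "SVEP (hardy_dual p) (dual_norm p) (hardy_adjoint p (comp_op \<phi>))"
  moreover have "(\<lambda>f. hardy_adjoint p (comp_op \<phi>) (eigenfunctional l) f - l * eigenfunctional l f) = (\<lambda>f. 0)" if "l \<in> \<Omega>" for l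
  proof
    fix f show "hardy_adjoint p (comp_op \<phi>) (eigenfunctional l) f - l * eigenfunctional l f = 0"
    proof (cases "f \<in> hardy p")
      case True
      then show ?thesis using eigenfunctional_iter[OF True that] by (simp add: hardy_adjoint_def comp_op_eq_iter)
    qed (simp add: hardy_adjoint_def eigenfunctional_def)
  qed
  ultimately have zero: "eigenfunctional l = (\<lambda>f. 0)" if "l \<in> \<Omega>" for l
    using that open_\<Omega> eigenfunctional_vholo unfolding SVEP_def by blast
  define f where "f = (\<lambda>z::complex. if z \<in> ball 0 1 then z else 0)"
  have f: "f \<in> hardy p"
  proof (rule hardy_bounded(1)[of _ 1])
    show "f holomorphic_on ball 0 1" by (rule holomorphic_transform[of "\<lambda>z. z"]) (auto simp: f_def)
  qed (use p in \<open>auto simp: f_def\<close>)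
  obtain A B where AB: "\<And>n. cmod (fwd f n) \<le> A * r ^ n" "\<And>n. cmod (bwd f n) \<le> B * (1 / \<rho>\<^sub>0) ^ n"
    using fwd_geometric[OF f] bwd_geometric[OF f] by blast
  have z: "two_sided (fwd f) (bwd f) l = 0" if "l \<in> \<Omega>" for l
    using fun_cong[OF zero[OF that], of f] f by (simp add: eigenfunctional_def)
  have "bwd f 0 = 0"
    by (rule two_sided_zero[OF AB r(1) \<rho>\<^sub>0(3) open_\<Omega> \<Omega>_nonempty _ z]) (auto simp: \<Omega>_def)
  moreover define v where "v = of_real (1 / r) * u\<^sub>0"
  ultimately have "\<mu> v = \<alpha>"
    using \<mu>_in_disc[OF K_scale_in_H[OF u\<^sub>0, of "1 / r"]] r \<alpha> by (simp add: bwd_def f_def v_def)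
  then have "\<kappa> \<alpha> = v" using \<kappa>_\<mu>[OF K_scale_in_H[OF u\<^sub>0, of "1 / r"]] r by (simp add: v_def)
  then have "u\<^sub>0 = 0" using r by (simp add: \<kappa>_\<alpha> v_def)
  then show False using u\<^sub>0 by (simp add: K_def ray_def)
qed

end

section \<open>Normal form of a hyperbolic map of second kind\<close>

text \<open>The coordinate \<open>(z - \<alpha>) / (\<omega> - z)\<close> conjugates the map to \<open>u \<mapsto> m u\<close> on a half-plane;
  a half-plane with \<open>0\<close> in its interior is mapped into itself only if \<open>0 < m \<le> 1\<close>.\<close>

lemma half_plane_multiplier:
  fixes m e :: complex and h :: real
  assumes h: "0 < h" and e: "e \<noteq> 0" and inv: "\<And>u. 0 < h + Re (u * e) \<Longrightarrow> 0 < h + Re (m * u * e)"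
  shows "Im m = 0" "0 \<le> Re m" "Re m \<le> 1"
proof -
  have inv': "0 < h + Re (m * v)" if "0 < h + Re v" for v
    using inv[of "v / e"] that e by simp
  \<comment> \<open>In each of the three cases v is admissible and chosen so that Re (m v) = -h,
    which puts m v on the boundary of the half-plane.\<close>
  show I: "Im m = 0"
  proof (rule ccontr)
    assume n: "Im m \<noteq> 0"
    show False using inv'[of "\<i> * of_real (h / Im m)"] n h by simp
  qed
  show R: "0 \<le> Re m"
  proof (rule ccontr)
    assume n: "\<not> 0 \<le> Re m"
    show False using inv'[of "of_real (- h / Re m)"] n h I divide_pos_neg[of h "Re m"] by simp
  qed
  show "Re m \<le> 1"
  proof (rule ccontr)
    assume n: "\<not> Re m \<le> 1"
    show False using inv'[of "of_real (- h / Re m)"] n h by (simp add: field_simps)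
  qed
qed

text \<open>In the coordinate \<open>\<kappa>\<close> the map is multiplication by (c \<omega> + d)
  / (c \<alpha> + d), because differences of values of a linear fractional map factor through the
  determinant. Invariance of the half-plane places this number in [0, 1]. It is not 0 since \<omega>
  is no pole, and not 1 since the map would be the identity and hence onto the disc.\<close>

lemma hyperbolic_nonaut_2nd_second_kind:
  assumes "hyperbolic_nonaut_2nd \<phi>" "1 < p"
  obtains \<alpha> \<omega> r where "second_kind \<alpha> \<omega> r p \<phi>"
proof -
  obtain a b c d where *: "a * d - b * c \<noteq> 0 \<and>
      (\<forall>z\<in>ball 0 1. c * z + d \<noteq> 0 \<and> \<phi> z = (a * z + b) / (c * z + d)) \<and>
      \<phi> ` ball 0 1 \<subseteq> ball 0 1 \<and> \<phi> ` ball 0 1 \<noteq> ball 0 1 \<and>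
      (\<exists>z0\<in>ball 0 1. \<exists>w0\<in>sphere 0 1. {z. c * z + d \<noteq> 0 \<and> (a * z + b) / (c * z + d) = z} = {z0, w0})"
    using assms(1) unfolding hyperbolic_nonaut_2nd_def by (elim exE) (rule that)
  then have det: "a * d - b * c \<noteq> 0"
    and \<phi>: "\<And>z. z \<in> ball 0 1 \<Longrightarrow> c * z + d \<noteq> 0 \<and> \<phi> z = (a * z + b) / (c * z + d)"
    and self: "\<phi> ` ball 0 1 \<subseteq> ball 0 1" and nonaut: "\<phi> ` ball 0 1 \<noteq> ball 0 1"
    and fp: "\<exists>z0\<in>ball 0 1. \<exists>w0\<in>sphere 0 1. {z. c * z + d \<noteq> 0 \<and> (a * z + b) / (c * z + d) = z} = {z0, w0}"
    by blast+
  obtain \<alpha> \<omega> where \<alpha>: "cmod \<alpha> < 1" and \<omega>: "cmod \<omega> = 1"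
    and fps: "{z. c * z + d \<noteq> 0 \<and> (a * z + b) / (c * z + d) = z} = {\<alpha>, \<omega>}"
    using fp by auto
  have "\<alpha> \<in> {z. c * z + d \<noteq> 0 \<and> (a * z + b) / (c * z + d) = z}" "\<omega> \<in> {z. c * z + d \<noteq> 0 \<and> (a * z + b) / (c * z + d) = z}"
    unfolding fps by auto
  then have A: "c * \<alpha> + d \<noteq> 0" "a * \<alpha> + b = \<alpha> * (c * \<alpha> + d)" and W: "c * \<omega> + d \<noteq> 0" "a * \<omega> + b = \<omega> * (c * \<omega> + d)"
    by (auto simp: field_simps)
  define m where "m = (c * \<omega> + d) / (c * \<alpha> + d)"
  have m0: "m \<noteq> 0" unfolding m_def using A W by simp
  \<comment> \<open>The ratio 1/2 and the map are placeholders: the facts drawn from this instance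
    concern \<open>\<kappa>\<close>, \<open>\<mu>\<close>, \<open>H\<close> and \<alpha>, which
    depend on the two fixed points alone.\<close>
  interpret pre: second_kind \<alpha> \<omega> "1/2" p "\<lambda>z. (\<alpha> + \<omega> * (of_real (1/2) * ((z - \<alpha>) / (\<omega> - z)))) / (1 + of_real (1/2) * ((z - \<alpha>) / (\<omega> - z)))"
    by unfold_locales (use \<alpha> \<omega> assms(2) in auto)
  have \<kappa>\<phi>: "pre.\<kappa> (\<phi> z) = m * pre.\<kappa> z" if z: "z \<in> ball 0 1" for z
  proof -
    define q where "q = c * z + d"
    have q: "q \<noteq> 0" "\<phi> z = (a * z + b) / q" using \<phi>[OF z] unfolding q_def by auto
    have wz: "\<omega> - z \<noteq> 0" by (rule pre.\<omega>_minus(1)[OF z])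
    have "(\<phi> z - \<alpha>) * (q * (c * \<alpha> + d)) = ((a * z + b) - \<alpha> * q) * (c * \<alpha> + d)"
      unfolding q(2) using q(1) by (simp add: left_diff_distrib)
    also have "\<dots> = (a * z + b) * (c * \<alpha> + d) - (\<alpha> * (c * \<alpha> + d)) * q" by (simp add: algebra_simps)
    also have "\<dots> = (a * d - b * c) * (z - \<alpha>)" unfolding A(2)[symmetric] q_def by (simp add: algebra_simps)
    finally have 1: "(\<phi> z - \<alpha>) * (q * (c * \<alpha> + d)) = (a * d - b * c) * (z - \<alpha>)" .
    have "(\<omega> - \<phi> z) * (q * (c * \<omega> + d)) = (\<omega> * q - (a * z + b)) * (c * \<omega> + d)"
      unfolding q(2) using q(1) by (simp add: left_diff_distrib)
    also have "\<dots> = (\<omega> * (c * \<omega> + d)) * q - (a * z + b) * (c * \<omega> + d)" by (simp add: algebra_simps)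
    also have "\<dots> = (a * d - b * c) * (\<omega> - z)" unfolding W(2)[symmetric] q_def by (simp add: algebra_simps)
    finally have 2: "(\<omega> - \<phi> z) * (q * (c * \<omega> + d)) = (a * d - b * c) * (\<omega> - z)" .
    have n2: "\<omega> - \<phi> z \<noteq> 0" using 2 det wz by auto
    have 3: "\<phi> z - \<alpha> = (a * d - b * c) * (z - \<alpha>) / (q * (c * \<alpha> + d))"
      using 1 q(1) A(1) by (simp add: eq_divide_eq)
    have 4: "\<omega> - \<phi> z = (a * d - b * c) * (\<omega> - z) / (q * (c * \<omega> + d))"
      using 2 q(1) W(1) by (simp add: eq_divide_eq)
    show ?thesis unfolding pre.\<kappa>_def 3 4 m_def using det q(1) A(1) W(1) wz by (simp add: divide_simps)
  qed
  have "0 < (1 - (cmod \<alpha>)\<^sup>2) / 2" using pre.\<alpha>_sq by simp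
  moreover have "1 - \<omega> * cnj \<alpha> \<noteq> 0"
  proof
    assume "1 - \<omega> * cnj \<alpha> = 0"
    then have "cmod (\<omega> * cnj \<alpha>) = 1" by simp
    then show False using \<alpha> \<omega> by (simp add: norm_mult)
  qed
  moreover have "0 < (1 - (cmod \<alpha>)\<^sup>2) / 2 + Re (m * u * (1 - \<omega> * cnj \<alpha>))"
    if "0 < (1 - (cmod \<alpha>)\<^sup>2) / 2 + Re (u * (1 - \<omega> * cnj \<alpha>))" for u
  proof -
    have u: "u \<in> pre.H" using that unfolding pre.H_def pre.level_def by (simp add: field_simps)
    have z: "pre.\<mu> u \<in> ball 0 1" by (rule pre.\<mu>_in_disc[OF u])
    then have "\<phi> (pre.\<mu> u) \<in> ball 0 1" using self by blast
    from pre.\<kappa>_in_H[OF this] have "m * u \<in> pre.H" unfolding \<kappa>\<phi>[OF z] pre.\<kappa>_\<mu>[OF u] .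
    then show ?thesis unfolding pre.H_def pre.level_def by (simp add: field_simps)
  qed
  ultimately have m: "Im m = 0" "0 \<le> Re m" "Re m \<le> 1" using half_plane_multiplier by blast+
  define r where "r = Re m"
  have mr: "m = of_real r" unfolding r_def using m(1) by (simp add: complex_eq_iff)
  have \<phi>\<mu>: "\<phi> z = pre.\<mu> (of_real r * pre.\<kappa> z)" if z: "z \<in> ball 0 1" for z
  proof -
    have "\<phi> z \<in> ball 0 1" using self z by blast
    from pre.\<mu>_\<kappa>[OF this] show ?thesis unfolding \<kappa>\<phi>[OF z] mr by simp
  qed
  have "r \<noteq> 1"
  proof
    assume "r = 1"
    then have "\<phi> z = z" if "z \<in> ball 0 1" for z using \<phi>\<mu>[OF that] pre.\<mu>_\<kappa>[OF that] by simp
    then have "\<phi> ` ball 0 1 = ball 0 1" by force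
    then show False using nonaut by simp
  qed
  moreover have "r \<noteq> 0" using m0 mr by auto
  ultimately have r: "0 < r" "r < 1" using m unfolding r_def by auto
  have "second_kind \<alpha> \<omega> r p \<phi>"
    by unfold_locales (use \<alpha> \<omega> r assms(2) \<phi>\<mu> in \<open>auto simp: pre.\<mu>_def pre.\<kappa>_def\<close>)
  then show ?thesis by (rule that)
qed

theorem theorem4p3:
  fixes \<phi> :: "complex \<Rightarrow> complex" and p :: real
  assumes "hyperbolic_nonaut_2nd \<phi>" and "1 < p"
  shows "property_C (hardy p) (hardy_norm p) (comp_op \<phi>) \<and>
         \<not> SVEP (hardy_dual p) (dual_norm p) (hardy_adjoint p (comp_op \<phi>))"
proof -
  obtain \<alpha> \<omega> r where "second_kind \<alpha> \<omega> r p \<phi>"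
    using hyperbolic_nonaut_2nd_second_kind[OF assms] .
  then interpret second_kind \<alpha> \<omega> r p \<phi> .
  show ?thesis using property_C_comp_op not_SVEP_adjoint by blast
qed

end
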